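(* Let $D\subset\mathbb{C}^n$ be a bounded strictly pseudoconvex domain with $C^2$ boundary. If a bounded domain $\Omega\subset\mathbb{C}^n$ can be exhausted by $D$, then $\Omega$ is biholomorphic to $D$ or to the unit ball $B^n$ of $\mathbb{C}^n$.
   Context: $B^n$ denotes the open unit ball in $\mathbb{C}^n$. For domains $D,\Omega\subset\mathbb{C}^n$, we say that $\Omega$ can be exhausted by $D$ if for every compact subset $K\subset\Omega$ there exists an injective holomorphic map $f:D\to\Omega$ such that $K\subset f(D)$. *)

theory Defs
  imports "HOL-Analysis.Analysis"
begin

text \<open>
  \<open>\<complex>\<^sup>n\<close> is the type \<^typ>\<open>complex ^ 'n\<close>, with \<open>n = CARD('n) \<ge> 1\<close>; its norm is the Euclidean one.
\<close>

definition complex_domain :: "(complex ^ 'n) set \<Rightarrow> bool" where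
  "complex_domain D \<longleftrightarrow> open D \<and> connected D \<and> D \<noteq> {}"

definition holomorphic_map_on :: "(complex ^ 'n \<Rightarrow> complex ^ 'm) \<Rightarrow> (complex ^ 'n) set \<Rightarrow> bool" where
  "holomorphic_map_on f D \<longleftrightarrow>
     (\<forall>z\<in>D. \<exists>f'. (f has_derivative f') (at z) \<and> (\<forall>c v. f' (c *s v) = c *s f' v))"

definition biholomorphic :: "(complex ^ 'n) set \<Rightarrow> (complex ^ 'm) set \<Rightarrow> bool" where
  "biholomorphic D W \<longleftrightarrow>
     (\<exists>f g. holomorphic_map_on f D \<and> holomorphic_map_on g W \<and> f ` D \<subseteq> W \<and> g ` W \<subseteq> D \<and>
            (\<forall>z\<in>D. g (f z) = z) \<and> (\<forall>w\<in>W. f (g w) = w))"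

definition exhausted_by :: "(complex ^ 'n) set \<Rightarrow> (complex ^ 'n) set \<Rightarrow> bool" where
  "exhausted_by W D \<longleftrightarrow>
     (\<forall>K. compact K \<and> K \<subseteq> W \<longrightarrow>
        (\<exists>f. holomorphic_map_on f D \<and> inj_on f D \<and> f ` D \<subseteq> W \<and> K \<subseteq> f ` D))"

text \<open>Twice continuously differentiable, with the second derivative as a bounded bilinear map.\<close>

definition C2_on :: "('a::real_normed_vector \<Rightarrow> real) \<Rightarrow> 'a set \<Rightarrow> bool" where
  "C2_on r U \<longleftrightarrow>
     (\<exists>(r' :: 'a \<Rightarrow> 'a \<Rightarrow>\<^sub>L real) (r'' :: 'a \<Rightarrow> 'a \<Rightarrow>\<^sub>L 'a \<Rightarrow>\<^sub>L real).
        (\<forall>z\<in>U. (r has_derivative blinfun_apply (r' z)) (at z)) \<and>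
        (\<forall>z\<in>U. (r' has_derivative blinfun_apply (r'' z)) (at z)) \<and>
        continuous_on U r'')"

text \<open>
  The Wirtinger operators \<open>\<partial>/\<partial>z\<^sub>j = (\<partial>/\<partial>x\<^sub>j - \<i> \<partial>/\<partial>y\<^sub>j)/2\<close> and
  \<open>\<partial>/\<partial>z\<^sub>j\<^sup>* = (\<partial>/\<partial>x\<^sub>j + \<i> \<partial>/\<partial>y\<^sub>j)/2\<close> (star denoting conjugation),
  where \<open>z\<^sub>j = x\<^sub>j + \<i> y\<^sub>j\<close>.
\<close>

definition wirtinger :: "'n \<Rightarrow> (complex ^ 'n \<Rightarrow> complex) \<Rightarrow> complex ^ 'n \<Rightarrow> complex" where
  "wirtinger j f z =
     (frechet_derivative f (at z) (axis j 1) - \<i> * frechet_derivative f (at z) (axis j \<i>)) / 2"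

definition wirtinger_bar :: "'n \<Rightarrow> (complex ^ 'n \<Rightarrow> complex) \<Rightarrow> complex ^ 'n \<Rightarrow> complex" where
  "wirtinger_bar j f z =
     (frechet_derivative f (at z) (axis j 1) + \<i> * frechet_derivative f (at z) (axis j \<i>)) / 2"

text \<open>The double sum is real where \<open>r\<close> is \<open>C\<^sup>2\<close>, so taking its real part loses nothing.\<close>

definition levi_form :: "(complex ^ 'n \<Rightarrow> real) \<Rightarrow> complex ^ 'n \<Rightarrow> complex ^ 'n \<Rightarrow> real" where
  "levi_form r p v =
     Re (\<Sum>j\<in>UNIV. \<Sum>k\<in>UNIV.
           wirtinger j (wirtinger_bar k (\<lambda>z. complex_of_real (r z))) p * v $ j * cnj (v $ k))"

definition complex_tangent :: "(complex ^ 'n \<Rightarrow> real) \<Rightarrow> complex ^ 'n \<Rightarrow> (complex ^ 'n) set" where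
  "complex_tangent r p =
     {v. (\<Sum>j\<in>UNIV. wirtinger j (\<lambda>z. complex_of_real (r z)) p * v $ j) = 0}"

definition C2_defining_near ::
    "(complex ^ 'n) set \<Rightarrow> complex ^ 'n \<Rightarrow> (complex ^ 'n) set \<Rightarrow> (complex ^ 'n \<Rightarrow> real) \<Rightarrow> bool" where
  "C2_defining_near D p U r \<longleftrightarrow>
     open U \<and> p \<in> U \<and> C2_on r U \<and> D \<inter> U = {z\<in>U. r z < 0} \<and>
     (\<forall>z\<in>U. frechet_derivative r (at z) \<noteq> (\<lambda>_. 0))"

definition C2_boundary :: "(complex ^ 'n) set \<Rightarrow> bool" where
  "C2_boundary D \<longleftrightarrow> (\<forall>p\<in>frontier D. \<exists>U r. C2_defining_near D p U r)"

text \<open>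
  Positivity of the Levi form on the complex tangent space does not depend on the choice of the
  defining function, so one local defining function per boundary point suffices.
\<close>

definition strictly_pseudoconvex :: "(complex ^ 'n) set \<Rightarrow> bool" where
  "strictly_pseudoconvex D \<longleftrightarrow>
     (\<forall>p\<in>frontier D. \<exists>U r. C2_defining_near D p U r \<and>
        (\<forall>v\<in>complex_tangent r p. v \<noteq> 0 \<longrightarrow> levi_form r p v > 0))"

end

theory Submission
  imports Defs "HOL-Complex_Analysis.Complex_Analysis"
begin

text \<open>
  Let \<open>f\<^sub>k : D \<rightarrow> \<Omega>\<close> be injective holomorphic maps whose images exhaust \<open>\<Omega>\<close>, and fix \<open>p \<in> \<Omega>\<close>. After passing to a
  subsequence the points \<open>f\<^sub>k\<^sup>-\<^sup>1 p\<close> converge to some \<open>q\<close> in the closure of \<open>D\<close>. If \<open>q \<in> D\<close>, then Montel's and Hurwitz'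
  theorems show that the maps \<open>f\<^sub>k\<^sup>-\<^sup>1\<close> and \<open>f\<^sub>k\<close> converge to mutually inverse biholomorphisms between \<open>\<Omega>\<close> and \<open>D\<close>. If
  \<open>q\<close> is a boundary point, a local peak function forces \<open>f\<^sub>k\<^sup>-\<^sup>1\<close> to converge to the constant \<open>q\<close>, locally uniformly. In
  coordinates adapted to a point \<open>z\<close> near \<open>q\<close> the domain \<open>D\<close> is squeezed between two nearly equal balls, so that a
  neighbourhood of \<open>q\<close> in \<open>D\<close> can be mapped injectively into the unit ball, with \<open>z\<close> going to the centre and with an image
  containing almost the whole ball. Composing with \<open>f\<^sub>k\<^sup>-\<^sup>1\<close> and taking limits as before gives a biholomorphism of \<open>\<Omega>\<close> with
  the ball.

  That \<open>f\<^sub>k\<^sup>-\<^sup>1\<close> is holomorphic (Osgood's theorem) follows from a variant of Rado's theorem on complex lines: the inverse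
  is continuous, and holomorphic off the zero set of the continuous function \<open>det f\<^sub>k' \<circ> f\<^sub>k\<^sup>-\<^sup>1\<close>, which has no interior
  by Sard's theorem.
\<close>

text \<open>Three obstacles shape the argument. The inverse maps live on varying open sets that only
  eventually contain a given compact set, so everything about limits is stated for sequences with
  domains \<open>A k\<close>. A limit of injective maps may degenerate; if the base points converge
  to an interior point, this is excluded by \<open>det (jac E q) * det (jac G p) = 1\<close>, which
  limits inherit from the chain rule. One limit theorem built on this serves both target domains. If
  \<open>q\<close> is a boundary point, the limit is constant and carries no information, so the
  maps are rescaled before the limit is taken.

  The boundary is only of class \<open>C^2\<close>, so the rescaling rests on a second order
  expansion whose error \<open>e |x|^2\<close> is uniform in the centre \<open>z\<close>. The Levi
  form is at first positive only on complex tangent vectors; replacing \<open>r\<close> by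
  \<open>r + 2 c r^2\<close> makes it positive definite without changing \<open>D\<close> near
  \<open>q\<close>. A quadratic holomorphic shear then removes the pluriharmonic second order term,
  and what remains are sublevel sets of \<open>2 Re <x,n> + (1 +- e) |x|^2\<close>, which are
  Euclidean balls.\<close>

no_notation fps_nth (infixl "$" 75)

section \<open>Rado's theorem\<close>

text \<open>If \<open>a > B\<close>, the powers of \<open>a / B\<close> eventually exceed
  \<open>C / b\<close>. Used to discard a fixed factor from an estimate for high powers.\<close>

lemma power_bounded_imp_le:
  fixes a b :: real
  assumes "0 \<le> a" "0 < B" "0 < b" and le: "\<And>k::nat. a ^ k * b \<le> B ^ k * C"
  shows "a \<le> B"
proof (rule ccontr)
  assume "\<not> a \<le> B"
  then have "1 < a / B" using assms by simp
  then obtain k where k: "C / b < (a / B) ^ k" using real_arch_pow by blast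
  then have "C < (a/B)^k * b" using assms by (simp add: field_simps)
  then have "B ^ k * C < a ^ k * b" using assms by (simp add: field_simps power_divide)
  with le[of k] show False by simp
qed

text \<open>A frontier point of \<open>V\<close> lies on the unit circle or is a zero of
  \<open>h\<close>. The product \<open>w^k h\<close> vanishes at the zeros, so the maximum modulus
  principle sees only the circle; letting \<open>k\<close> grow removes the factor
  \<open>h\<close>.\<close>

lemma maximum_modulus_off_zeros:
  fixes h w :: "complex \<Rightarrow> complex"
  assumes h: "continuous_on (cball 0 1) h" and V: "V = {z \<in> ball 0 1. h z \<noteq> 0}"
    and hh: "h holomorphic_on V" and wh: "w holomorphic_on V"
    and wc: "continuous_on (closure V) w"
    and B0: "B > 0" and B: "\<And>z. z \<in> closure V \<Longrightarrow> norm z = 1 \<Longrightarrow> norm (w z) \<le> B" and z: "z \<in> V"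
  shows "norm (w z) \<le> B"
proof -
  have clV: "closure V \<subseteq> cball 0 1"
    by (rule closure_minimal) (auto simp: V)
  have hcb: "continuous_on (ball 0 1) h" using h by (rule continuous_on_subset) auto
  have oV: "open V"
  proof -
    have "V = ball 0 1 \<inter> h -` (- {0})" by (auto simp: V)
    then show ?thesis using continuous_open_preimage[OF hcb, of "- {0}"] by auto
  qed
  obtain C where C: "\<And>z. z \<in> cball 0 1 \<Longrightarrow> norm (h z) \<le> C"
    using compact_imp_bounded[OF compact_continuous_image[OF h compact_cball]]
    by (auto simp: bounded_iff) (metis mem_cball_0)
  have fr: "norm x = 1 \<or> h x = 0" if "x \<in> frontier V" for x
  proof -
    have "x \<in> closure V" "x \<notin> V" using that oV by (auto simp: frontier_def interior_open)
    with clV show ?thesis by (auto simp: V)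
  qed
  show ?thesis
  proof (rule power_bounded_imp_le[where b = "norm (h z)" and C = C])
    show "norm (h z) > 0" using z by (auto simp: V)
    fix k :: nat
    have "norm (w z ^ k * h z) \<le> B ^ k * C"
    proof (rule maximum_modulus_frontier[where f = "\<lambda>z. w z ^ k * h z" and S = V])
      show "(\<lambda>z. w z ^ k * h z) holomorphic_on interior V"
        using oV wh hh by (auto simp: interior_open intro!: holomorphic_intros)
      show "continuous_on (closure V) (\<lambda>z. w z ^ k * h z)"
        using clV by (intro continuous_intros wc continuous_on_subset[OF h])
      show "bounded V" by (rule bounded_subset[OF bounded_ball[of 0 1]]) (auto simp: V)
      fix x assume x: "x \<in> frontier V"
      then have xc: "x \<in> closure V" by (simp add: frontier_def)
      show "norm (w x ^ k * h x) \<le> B ^ k * C"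
      proof (cases "h x = 0")
        case True
        have "0 \<le> C" using order_trans[OF norm_ge_zero C[of 0]] by simp
        with True B0 show ?thesis by simp
      next
        case False
        with fr[OF x] have "norm x = 1" by auto
        then have "norm (w x) \<le> B" using B[OF xc] by simp
        moreover have "norm (h x) \<le> C" using xc clV C by auto
        ultimately show ?thesis using B0
          by (auto simp: norm_mult norm_power intro!: mult_mono power_mono)
      qed
    qed (use z in auto)
    then show "norm (w z) ^ k * norm (h z) \<le> B ^ k * C" by (simp add: norm_mult norm_power)
  qed (use B0 in auto)
qed

text \<open>If \<open>V\<close> were not dense, some \<open>a\<close> outside its closure would be
  close to \<open>V\<close> but far from the circle, and \<open>1 / (z - a)\<close> would be larger
  at a point of \<open>V\<close> than on the circle.\<close>

lemma nonzero_set_dense: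
  fixes h :: "complex \<Rightarrow> complex"
  assumes h: "continuous_on (cball 0 1) h" and V: "V = {z \<in> ball 0 1. h z \<noteq> 0}"
    and hh: "h holomorphic_on V" and ne: "V \<noteq> {}"
  shows "ball 0 1 \<subseteq> closure V"
proof (rule ccontr)
  assume nsub: "\<not> ball 0 1 \<subseteq> closure V"
  have "ball (0::complex) 1 \<inter> frontier (closure V) \<noteq> {}"
  proof (rule connected_Int_frontier)
    show "ball 0 1 \<inter> closure V \<noteq> {}" using ne closure_subset[of V] by (auto simp: V)
    show "ball 0 1 - closure V \<noteq> {}" using nsub by auto
  qed simp
  then obtain c where c: "norm c < 1" "c \<in> frontier (closure V)" by auto
  \<comment> \<open>A third of the distance from \<open>c\<close> to the circle: \<open>a\<close>
    within \<open>d\<close> of \<open>c\<close> keeps distance at least \<open>2 d\<close> from the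
    circle, while \<open>x\<close> within \<open>d\<close> of \<open>c\<close> has distance below
    \<open>2 d\<close> from \<open>a\<close>.\<close>
  define d where "d = (1 - norm c) / 3"
  have d: "d > 0" and d3: "3 * d = 1 - norm c" using c by (simp_all add: d_def)
  have "c \<in> closure (- closure V)" using c by (simp add: frontier_closures)
  then obtain a where a: "a \<notin> closure V" "dist a c < d"
    using d by (auto simp: closure_approachable)
  have "c \<in> closure V" using c by (simp add: frontier_closures)
  then obtain x where x: "x \<in> V" "dist x c < d" using d by (auto simp: closure_approachable)
  have na: "norm a < norm c + d" using a(2) norm_triangle_ineq3[of a c] by (simp add: dist_norm)
  have xa: "norm (x - a) < 2 * d" using a(2) x(2) dist_triangle[of x a c]
    by (simp add: dist_norm norm_minus_commute)
  have "norm (1 / (x - a)) \<le> 1 / (2 * d)"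
  proof (rule maximum_modulus_off_zeros[OF h V hh _ _ _ _ x(1)])
    show "(\<lambda>z. 1 / (z - a)) holomorphic_on V"
      using a closure_subset[of V] by (auto intro!: holomorphic_intros)
    show "continuous_on (closure V) (\<lambda>z. 1 / (z - a))"
      using a by (auto intro!: continuous_intros)
    show "0 < 1 / (2 * d)" using d by simp
    fix z :: complex assume "z \<in> closure V" "norm z = 1"
    then have "norm (z - a) \<ge> 2 * d"
      using norm_triangle_ineq2[of z a] na d3 by linarith
    then show "norm (1 / (z - a)) \<le> 1 / (2 * d)" using d by (simp add: norm_divide frac_le)
  qed
  moreover have "x \<noteq> a" using x a closure_subset[of V] by auto
  then have "norm (x - a) > 0" by simp
  then have "norm (1 / (x - a)) > 1 / (2 * d)" using xa frac_less2[of 1 1 "norm (x - a)" "2 * d"] by (simp add: norm_divide)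
  ultimately show False by simp
qed

section \<open>Approximation by real parts of polynomials on the unit circle\<close>

text \<open>Analytic and conjugate parts are kept apart because a real function of this form is the
  real part of the single polynomial \<open>p + q\<close> on the circle.\<close>

definition circle_trig :: "(complex \<Rightarrow> complex) \<Rightarrow> bool" where
  "circle_trig g \<longleftrightarrow> (\<exists>p q. \<forall>z. norm z = 1 \<longrightarrow> g z = poly p z + cnj (poly q z))"

text \<open>On the circle \<open>z * cnj z = 1\<close>, so multiplication by \<open>z\<close> lowers
  the degree of the conjugate part, whose constant coefficient moves to the analytic part.\<close>

lemma circle_trig_mult_id:
  assumes "circle_trig g" shows "circle_trig (\<lambda>z. z * g z)"
proof -
  obtain p q where pq: "\<And>z. norm z = 1 \<Longrightarrow> g z = poly p z + cnj (poly q z)"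
    using assms by (auto simp: circle_trig_def)
  obtain c q1 where q: "q = pCons c q1" by (cases q)
  have "z * g z = poly (pCons (cnj 0) p + [:0, cnj c:]) z + cnj (poly q1 z)" if "norm z = 1" for z
  proof -
    have "z * cnj z = 1" using that by (simp add: complex_norm_square[symmetric])
    then have "z * (cnj z * w) = w" for w by (simp add: mult.assoc[symmetric])
    then show ?thesis by (simp add: pq[OF that] q algebra_simps)
  qed
  then show ?thesis unfolding circle_trig_def by blast
qed

lemma circle_trig_cnj: "circle_trig g \<Longrightarrow> circle_trig (\<lambda>z. cnj (g z))"
  unfolding circle_trig_def by (metis complex_cnj_add complex_cnj_cnj add.commute)

lemma circle_trig_add:
  assumes "circle_trig f" "circle_trig g" shows "circle_trig (\<lambda>z. f z + g z)"
proof -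
  obtain p q p' q' where "\<forall>z. norm z = 1 \<longrightarrow> f z = poly p z + cnj (poly q z)"
     "\<forall>z. norm z = 1 \<longrightarrow> g z = poly p' z + cnj (poly q' z)" using assms by (auto simp: circle_trig_def)
  then have "\<forall>z. norm z = 1 \<longrightarrow> f z + g z = poly (p+p') z + cnj (poly (q+q') z)" by simp
  then show ?thesis unfolding circle_trig_def by blast
qed

lemma circle_trig_cmult:
  assumes "circle_trig f" shows "circle_trig (\<lambda>z. c * f z)"
proof -
  obtain p q where "\<forall>z. norm z = 1 \<longrightarrow> f z = poly p z + cnj (poly q z)" using assms by (auto simp: circle_trig_def)
  then have "\<forall>z. norm z = 1 \<longrightarrow> c * f z = poly (smult c p) z + cnj (poly (smult (cnj c) q) z)" by (simp add: algebra_simps)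
  then show ?thesis unfolding circle_trig_def by blast
qed

text \<open>Trigonometric polynomials on the circle form an algebra because each polynomial function is a multiplier of them.\<close>

lemma circle_trig_mult_polynomial:
  fixes g :: "complex \<Rightarrow> real"
  assumes "real_polynomial_function g" "circle_trig f"
  shows "circle_trig (\<lambda>z. of_real (g z) * f z)"
  using assms
proof (induction arbitrary: f rule: real_polynomial_function.induct)
  case (linear g)
  then have lin: "linear g" by (simp add: bounded_linear.linear)
  \<comment> \<open>With this \<open>c\<close> the real linear form \<open>g\<close> is twice the
    real part of \<open>c * z\<close>, so multiplication by it reduces to multiplication by
    \<open>z\<close> and, through conjugation, by \<open>cnj z\<close>.\<close>
  define c where "c = (of_real (g 1) - \<i> * of_real (g \<i>)) / 2"
  have "of_real (g z) = c * z + cnj c * cnj z" for z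
  proof -
    have "g z = g (Re z *\<^sub>R 1 + Im z *\<^sub>R \<i>)" by (simp add: complex_eq[symmetric] scaleR_conv_of_real mult.commute)
    also have "\<dots> = Re z * g 1 + Im z * g \<i>" by (simp add: linear_add[OF lin] linear_scale[OF lin])
    finally show ?thesis by (simp add: c_def complex_eq_iff field_simps)
  qed
  then have eq: "of_real (g z) * f z = c * (z * f z) + cnj c * cnj (z * cnj (f z))" for z
    by (simp add: algebra_simps)
  show ?case unfolding eq
    by (intro circle_trig_add circle_trig_cmult circle_trig_mult_id circle_trig_cnj linear)
next
  case (const c)
  then show ?case by (simp add: circle_trig_cmult)
next
  case (add g1 g2)
  then show ?case using circle_trig_add[OF add.IH(1)[OF add.prems] add.IH(2)[OF add.prems]] by (simp add: algebra_simps)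
next
  case (mult g1 g2)
  then show ?case using mult.IH(1)[OF mult.IH(2)[OF mult.prems]] by (simp add: algebra_simps)
qed

lemma circle_real_approx:
  fixes u :: "complex \<Rightarrow> real"
  assumes "continuous_on (sphere 0 1) u" "e > 0"
  obtains p where "\<And>z. norm z = 1 \<Longrightarrow> \<bar>u z - Re (poly p z)\<bar> < e"
proof -
  obtain g where g: "real_polynomial_function g" "\<And>z. z \<in> sphere 0 1 \<Longrightarrow> \<bar>u z - g z\<bar> < e"
    using Stone_Weierstrass_real_polynomial_function[OF _ assms] by auto
  have "circle_trig (\<lambda>_. 1)" unfolding circle_trig_def by (rule exI[of _ 1], rule exI[of _ 0]) simp
  from circle_trig_mult_polynomial[OF g(1) this] obtain p q
    where pq: "\<And>z. norm z = 1 \<Longrightarrow> of_real (g z) = poly p z + cnj (poly q z)" by (auto simp: circle_trig_def)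
  have "g z = Re (poly (p + q) z)" if "norm z = 1" for z
    using arg_cong[OF pq[OF that], of Re] by simp
  with g(2) show thesis by (intro that[of "p+q"]) simp
qed

section \<open>Holomorphic limits from control of real parts\<close>

text \<open>A bound on the real part bounds the modulus of \<open>exp (f / e)\<close> by
  \<open>exp 1\<close>, and Cauchy's inequality applies to that function. Its value at the centre
  has modulus at least \<open>exp (-1)\<close>, hence the factor \<open>exp 2\<close>.\<close>

lemma deriv_bound_of_Re_bound:
  assumes f: "f holomorphic_on ball a R" and r: "0 < r" "r < R" and e: "e > 0"
    and b: "\<And>z. z \<in> ball a R \<Longrightarrow> \<bar>Re (f z)\<bar> \<le> e"
  shows "norm (deriv f a) \<le> exp 2 * e / r"
proof -
  define F where "F = (\<lambda>z. exp (f z / of_real e))"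
  have hF: "F holomorphic_on ball a R" unfolding F_def using f e by (intro holomorphic_intros) auto
  have nF: "norm (F z) = exp (Re (f z) / e)" for z by (simp add: F_def)
  have "norm ((deriv ^^ 1) F a) \<le> fact 1 * exp 1 / r ^ 1"
  proof (rule Cauchy_inequality)
    show "F holomorphic_on ball a r" using r by (intro holomorphic_on_subset[OF hF]) auto
    show "continuous_on (cball a r) F"
      using r by (intro holomorphic_on_imp_continuous_on holomorphic_on_subset[OF hF]) auto
    fix x assume "norm (a - x) = r"
    then have "x \<in> ball a R" using r by (simp add: dist_norm)
    from b[OF this] show "norm (F x) \<le> exp 1" using e by (simp add: nF abs_le_iff)
  qed (use r in auto)
  then have 1: "norm (deriv F a) \<le> exp 1 / r" by simp
  have "(f has_field_derivative deriv f a) (at a)"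
    using f r by (intro holomorphic_derivI[of _ "ball a R"]) auto
  then have "(F has_field_derivative (F a * (deriv f a / of_real e))) (at a)"
    unfolding F_def using e by (auto intro!: derivative_eq_intros)
  then have "deriv F a = F a * (deriv f a / of_real e)" by (rule DERIV_imp_deriv)
  then have 2: "exp (Re (f a) / e) * (norm (deriv f a) / e) \<le> exp 1 / r"
    using 1 e by (simp add: norm_mult nF norm_divide)
  have "\<bar>Re (f a)\<bar> \<le> e" using b[of a] r by simp
  then have "exp (-1) \<le> exp (Re (f a) / e)" using e by (simp add: field_simps abs_le_iff)
  then have "exp (-1) * (norm (deriv f a) / e) \<le> exp 1 / r"
    using 2 e by (meson mult_right_mono divide_nonneg_pos norm_ge_zero order_trans)
  then have le: "exp 1 * (exp (-1) * (norm (deriv f a) / e)) \<le> exp 1 * (exp 1 / r)"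
    by (rule mult_left_mono) simp
  have "norm (deriv f a) / e = exp 1 * (exp (-1) * (norm (deriv f a) / e))"
    by (simp add: exp_minus)
  also note le
  also have "exp 1 * (exp 1 / r) = exp 2 / r" using exp_add[of "1::real" 1] by simp
  finally have "norm (deriv f a) / e \<le> exp 2 / r" .
  then show ?thesis using e by (simp add: field_simps)
qed

text \<open>Closeness of real parts bounds the differences of the derivatives, and these control the
  polynomials up to their values at 0. Halving the radius leaves room for a disc of radius 1/2
  around each point.\<close>

lemma Re_uniform_limit_polynomials:
  assumes a: "\<And>e. e > 0 \<Longrightarrow> \<exists>p. \<forall>z\<in>ball 0 1. \<bar>U z - Re (poly p z)\<bar> \<le> e"
  shows "\<exists>P. P holomorphic_on ball 0 (1/2) \<and> (\<forall>z\<in>ball 0 (1/2). Re (P z) = U z - U 0)"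
proof -
  have "\<exists>p. \<forall>z\<in>ball 0 1. \<bar>U z - Re (poly p z)\<bar> \<le> inverse (real (Suc k))" for k
    by (rule a) simp
  then obtain p where p: "\<And>k z. norm z < 1 \<Longrightarrow> \<bar>U z - Re (poly (p k) z)\<bar> \<le> inverse (real (Suc k))"
    by (simp only: mem_ball_0 Ball_def) metis
  \<comment> \<open>Real parts say nothing about imaginary constants, hence the normalisation at
    0.\<close>
  define q where "q k z = poly (p k) z - poly (p k) 0" for k z
  have bound: "norm (q k z - q m z) \<le> exp 2 * 16 * e" if z: "z \<in> ball 0 (1/2)"
    and e: "inverse (real (Suc k)) \<le> e" "inverse (real (Suc m)) \<le> e" for k m z e
  proof -
    have e0: "e > 0" using e(1) by (meson inverse_positive_iff_positive less_le_trans of_nat_0_less_iff zero_less_Suc)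
    define f where "f = (\<lambda>z. poly (p k) z - poly (p m) z)"
    have hf: "f holomorphic_on A" for A unfolding f_def by (intro holomorphic_intros)
    have "norm (f z - f 0) \<le> (exp 2 * (2 * e) / (1/4)) * norm (z - 0)"
    proof (rule field_differentiable_bound[where S = "ball 0 (1/2)"])
      fix x :: complex assume x: "x \<in> ball 0 (1/2)"
      show "(f has_field_derivative deriv f x) (at x within ball 0 (1/2))"
        using holomorphic_derivI[OF hf open_UNIV] has_field_derivative_at_within by blast
      show "norm (deriv f x) \<le> exp 2 * (2 * e) / (1/4)"
      proof (rule deriv_bound_of_Re_bound[OF hf[of "ball x (1/2)"]])
        fix y assume "y \<in> ball x (1/2)"
        then have "norm y < 1" using x norm_triangle_ineq2[of y x] by (simp add: dist_norm norm_minus_commute)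
        then have "\<bar>U y - Re (poly (p k) y)\<bar> \<le> e" "\<bar>U y - Re (poly (p m) y)\<bar> \<le> e"
          using p[of y k] p[of y m] e by auto
        then show "\<bar>Re (f y)\<bar> \<le> 2 * e" by (simp add: f_def)
      qed (use e0 in auto)
    qed (use z in auto)
    also have "\<dots> \<le> (exp 2 * (2 * e) / (1/4)) * 2" using z e0 by (intro mult_left_mono) auto
    finally show ?thesis by (simp add: f_def q_def algebra_simps)
  qed
  have "uniformly_Cauchy_on (ball 0 (1/2)) q"
  proof (rule uniformly_Cauchy_onI)
    fix e :: real assume "e > 0"
    define e' where "e' = e / (exp 2 * 32)"
    have e': "e' > 0" using \<open>e > 0\<close> by (simp add: e'_def)
    then obtain N where N: "inverse (real (Suc N)) < e'" using reals_Archimedean by blast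
    have le: "inverse (real (Suc n)) \<le> e'" if "n \<ge> N" for n
    proof -
      have "inverse (real (Suc n)) \<le> inverse (real (Suc N))" using that by (intro le_imp_inverse_le) auto
      with N show ?thesis by linarith
    qed
    have "dist (q m x) (q n x) < e" if "x \<in> ball 0 (1/2)" "m \<ge> N" "n \<ge> N" for x m n
    proof -
      have "norm (q m x - q n x) \<le> exp 2 * 16 * e'" using bound[OF that(1) le le] that by blast
      also have "\<dots> < e" using \<open>e > 0\<close> by (simp add: e'_def)
      finally show ?thesis by (simp add: dist_norm)
    qed
    then show "\<exists>M. \<forall>x\<in>ball 0 (1/2). \<forall>m\<ge>M. \<forall>n\<ge>M. dist (q m x) (q n x) < e" by blast
  qed
  then obtain P where P: "uniform_limit (ball 0 (1/2)) q P sequentially"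
    using Cauchy_uniformly_convergent uniformly_convergent_on_def by blast
  show ?thesis
  proof (intro exI[of _ P] conjI ballI)
    show "P holomorphic_on ball 0 (1/2)"
    proof (rule holomorphic_uniform_sequence)
      show "q n holomorphic_on ball 0 (1/2)" for n unfolding q_def by (intro holomorphic_intros)
      fix x :: complex assume "x \<in> ball 0 (1/2)"
      then obtain d where "d > 0" "cball x d \<subseteq> ball 0 (1/2)" using open_ball open_contains_cball by blast
      then show "\<exists>d>0. cball x d \<subseteq> ball 0 (1/2) \<and> uniform_limit (cball x d) q P sequentially"
        using uniform_limit_on_subset[OF P] by blast
    qed simp
    have lim: "(\<lambda>k. Re (poly (p k) y)) \<longlonglongrightarrow> U y" if "norm y < 1" for y
    proof (rule LIMSEQ_I)
      fix r :: real assume "r > 0"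
      then obtain N where N: "inverse (real (Suc N)) < r" using reals_Archimedean by blast
      have "norm (Re (poly (p n) y) - U y) < r" if "n \<ge> N" for n
      proof -
        have "inverse (real (Suc n)) \<le> inverse (real (Suc N))" using that by (intro le_imp_inverse_le) auto
        then show ?thesis using p[OF \<open>norm y < 1\<close>, of n] N unfolding real_norm_def by linarith
      qed
      then show "\<exists>no. \<forall>n\<ge>no. norm (Re (poly (p n) y) - U y) < r" by blast
    qed
    fix z :: complex assume z: "z \<in> ball 0 (1/2)"
    have "(\<lambda>k. q k z) \<longlonglongrightarrow> P z" by (rule tendsto_uniform_limitI[OF P z])
    then have "(\<lambda>k. Re (q k z)) \<longlonglongrightarrow> Re (P z)" by (rule tendsto_Re)
    moreover have "(\<lambda>k. Re (q k z)) \<longlonglongrightarrow> U z - U 0"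
      unfolding q_def minus_complex.sel using z by (intro tendsto_diff lim) auto
    ultimately show "Re (P z) = U z - U 0" by (rule LIMSEQ_unique)
  qed
qed

text \<open>Both \<open>exp (u - p)\<close> and \<open>exp (p - u)\<close> are bounded by
  \<open>exp e\<close> on the circle, hence on the nonzero set of \<open>h\<close>; density of that
  set gives the whole disc.\<close>

lemma Re_approx_off_zeros:
  fixes h u :: "complex \<Rightarrow> complex"
  assumes h: "continuous_on (cball 0 1) h" and u: "continuous_on (cball 0 1) u"
    and V: "V = {z \<in> ball 0 1. h z \<noteq> 0}" and hV: "h holomorphic_on V" "u holomorphic_on V" and ne: "V \<noteq> {}"
    and e: "e > 0"
  shows "\<exists>p. \<forall>z\<in>ball 0 1. \<bar>Re (u z) - Re (poly p z)\<bar> \<le> e"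
proof -
  have "continuous_on (sphere 0 1) (\<lambda>z. Re (u z))"
    by (intro continuous_intros continuous_on_subset[OF u]) auto
  then obtain p where p: "\<And>z. norm z = 1 \<Longrightarrow> \<bar>Re (u z) - Re (poly p z)\<bar> < e"
    using circle_real_approx e by metis
  have clV: "closure V \<subseteq> cball 0 1"
    by (rule closure_minimal) (auto simp: V)
  have uc: "continuous_on (closure V) u" by (rule continuous_on_subset[OF u clV])
  have *: "norm (exp (c * (u z - poly p z))) \<le> exp e" if c: "c = 1 \<or> c = -1" and z: "z \<in> V" for c z
  proof (rule maximum_modulus_off_zeros[OF h V hV(1) _ _ _ _ z])
    show "(\<lambda>z. exp (c * (u z - poly p z))) holomorphic_on V" using hV by (intro holomorphic_intros)
    show "continuous_on (closure V) (\<lambda>z. exp (c * (u z - poly p z)))" by (intro continuous_intros uc)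
    fix z :: complex assume "norm z = 1"
    then show "norm (exp (c * (u z - poly p z))) \<le> exp e" using p[of z] c by (auto simp: abs_less_iff)
  qed auto
  have onV: "\<bar>Re (u z) - Re (poly p z)\<bar> \<le> e" if "z \<in> V" for z
    using *[OF _ that, of 1] *[OF _ that, of "-1"] by (simp add: abs_le_iff)
  have "\<bar>Re (u z) - Re (poly p z)\<bar> \<le> e" if "z \<in> closure V" for z
    by (rule continuous_le_on_closure[OF _ that onV]) (intro continuous_intros uc)
  then show ?thesis using nonzero_set_dense[OF h V hV(1) ne] by blast
qed

text \<open>Generalises Rado's theorem, which is the case \<open>u = h\<close>.\<close>

theorem rado:
  fixes h u :: "complex \<Rightarrow> complex"
  assumes h: "continuous_on (cball 0 1) h" and u: "continuous_on (cball 0 1) u"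
    and V: "V = {z \<in> ball 0 1. h z \<noteq> 0}" and hV: "h holomorphic_on V" "u holomorphic_on V" and ne: "V \<noteq> {}"
  shows "u holomorphic_on ball 0 (1/2)"
proof -
  have apr: "\<exists>p. \<forall>z\<in>ball 0 1. \<bar>Re (u z) - Re (poly p z)\<bar> \<le> e" if "e > 0" for e
    by (rule Re_approx_off_zeros[OF h u V hV ne that])
  obtain P where P: "P holomorphic_on ball 0 (1/2)" "\<And>z. z \<in> ball 0 (1/2) \<Longrightarrow> Re (P z) = Re (u z) - Re (u 0)"
    using Re_uniform_limit_polynomials[of "\<lambda>z. Re (u z)"] apr by (metis (no_types, lifting))
  \<comment> \<open>Multiplication by \<open>- \<i>\<close> turns the imaginary part into a real
    part, so the same approximation yields \<open>Q\<close>.\<close>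
  have iu: "continuous_on (cball 0 1) (\<lambda>z. - \<i> * u z)" "(\<lambda>z. - \<i> * u z) holomorphic_on V"
    using u hV by (auto intro!: continuous_intros holomorphic_intros)
  have api: "\<exists>p. \<forall>z\<in>ball 0 1. \<bar>Im (u z) - Re (poly p z)\<bar> \<le> e" if "e > 0" for e
    using Re_approx_off_zeros[OF h iu(1) V hV(1) iu(2) ne that] by simp
  obtain Q where Q: "Q holomorphic_on ball 0 (1/2)" "\<And>z. z \<in> ball 0 (1/2) \<Longrightarrow> Re (Q z) = Im (u z) - Im (u 0)"
    using Re_uniform_limit_polynomials[of "\<lambda>z. Im (u z)"] api by (metis (no_types, lifting))
  have oV: "open V"
  proof -
    have hcb: "continuous_on (ball 0 1) h" using h by (rule continuous_on_subset) auto
    have "V = ball 0 1 \<inter> h -` (- {0})" by (auto simp: V)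
    then show ?thesis using continuous_open_preimage[OF hcb, of "- {0}"] by auto
  qed
  let ?B = "ball (0::complex) (1/2)"
  \<comment> \<open>A holomorphic function with constant real part is not open, hence locally
    constant.\<close>
  have zero: "deriv g z = 0" if g: "g holomorphic_on V \<inter> ?B" and c: "\<And>w. w \<in> V \<inter> ?B \<Longrightarrow> Re (g w) = c" and z: "z \<in> V \<inter> ?B" for g c z
  proof -
    obtain d where d: "d > 0" "ball z d \<subseteq> V \<inter> ?B" using oV z by (meson open_Int open_ball open_contains_ball)
    have "g constant_on ball z d"
    proof (rule ccontr)
      assume "\<not> g constant_on ball z d"
      then have "open (g ` ball z d)"
        using holomorphic_on_subset[OF g d(2)] by (intro open_mapping_thm[of g "ball z d"]) auto
      moreover have "g z \<in> g ` ball z d" using d by auto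
      ultimately obtain s where s: "s > 0" "ball (g z) s \<subseteq> g ` ball z d" using open_contains_ball by blast
      have "g z + of_real (s/2) \<in> ball (g z) s" using s by (simp add: dist_norm)
      then obtain w where w: "w \<in> ball z d" "g z + of_real (s/2) = g w" using s by auto
      then have "w \<in> V \<inter> ?B" using d by blast
      then have "Re (g z + of_real (s/2)) = c" using c w by simp
      then show False using c[OF z] s by simp
    qed
    then obtain k where k: "\<And>w. w \<in> ball z d \<Longrightarrow> g w = k" by (auto simp: constant_on_def)
    have "(g has_field_derivative 0) (at z)"
      by (rule has_field_derivative_transform_within_open[of "\<lambda>_. k" _ _ "ball z d"]) (use k d in auto)
    then show ?thesis by (rule DERIV_imp_deriv)
  qed
  have fd: "f field_differentiable at z" if "f holomorphic_on ?B" "z \<in> ?B" for f z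
    using that holomorphic_on_imp_differentiable_at by blast
  have ud: "u field_differentiable at z" if "z \<in> V" for z
    using hV(2) oV that holomorphic_on_imp_differentiable_at by blast
  \<comment> \<open>On \<open>V\<close> both \<open>u - P\<close> and \<open>- \<i> * u - Q\<close>
    have constant real part, so the derivative of \<open>P\<close> is that of \<open>u\<close>, and
    the derivative of \<open>Q\<close> is \<open>- \<i>\<close> times it.\<close>
  have dQ: "deriv Q z + \<i> * deriv P z = 0" if z: "z \<in> V \<inter> ?B" for z
  proof -
    have "deriv (\<lambda>z. u z - P z) z = 0"
      by (rule zero[where c = "Re (u 0)", OF _ _ z]) (use P hV(2) in \<open>auto intro!: holomorphic_intros intro: holomorphic_on_subset\<close>)
    then have 1: "deriv u z = deriv P z" using fd[OF P(1)] ud z by (simp add: deriv_diff)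
    have "deriv (\<lambda>z. - \<i> * u z - Q z) z = 0"
      by (rule zero[where c = "Im (u 0)", OF _ _ z]) (use Q hV(2) in \<open>auto intro!: holomorphic_intros intro: holomorphic_on_subset\<close>)
    then have 2: "- \<i> * deriv u z = deriv Q z" using fd[OF Q(1)] ud z by (simp add: deriv_diff deriv_cmult field_differentiable_mult field_differentiable_minus)
    show ?thesis unfolding 2[symmetric] 1 by simp
  qed
  \<comment> \<open>The relation no longer mentions \<open>u\<close>, so continuity and the density
    of \<open>V\<close> extend it across the zeros of \<open>h\<close>.\<close>
  have dQ': "deriv Q z + \<i> * deriv P z = 0" if z: "z \<in> ?B" for z
  proof -
    have "continuous_on ?B (\<lambda>z. deriv Q z + \<i> * deriv P z)"
      using P Q by (intro holomorphic_on_imp_continuous_on holomorphic_intros holomorphic_deriv) auto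
    then have op: "open {z \<in> ?B. deriv Q z + \<i> * deriv P z \<noteq> 0}"
      using continuous_open_preimage[of ?B "\<lambda>z. deriv Q z + \<i> * deriv P z" "- {0}"]
      by (simp add: Int_def vimage_def open_Compl)
    show ?thesis
    proof (rule ccontr)
      assume "deriv Q z + \<i> * deriv P z \<noteq> 0"
      then have "z \<in> {z \<in> ?B. deriv Q z + \<i> * deriv P z \<noteq> 0}" using z by simp
      moreover have "z \<in> closure V" using nonzero_set_dense[OF h V hV(1) ne] z by auto
      ultimately have "V \<inter> {z \<in> ?B. deriv Q z + \<i> * deriv P z \<noteq> 0} \<noteq> {}"
        using op open_Int_closure_eq_empty by fast
      then show False using dQ by blast
    qed
  qed
  have "\<exists>c. \<forall>z\<in>?B. Q z + \<i> * P z = c"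
  proof (rule has_field_derivative_zero_constant)
    fix z assume z: "z \<in> ?B"
    have "((\<lambda>z. Q z + \<i> * P z) has_field_derivative (deriv Q z + \<i> * deriv P z)) (at z)"
      using z by (intro derivative_intros DERIV_cmult holomorphic_derivI[OF P(1)] holomorphic_derivI[OF Q(1)]) auto
    then show "((\<lambda>z. Q z + \<i> * P z) has_field_derivative 0) (at z within ?B)"
      using dQ'[OF z] has_field_derivative_at_within by metis
  qed simp
  then obtain c where c: "\<And>z. z \<in> ?B \<Longrightarrow> Q z + \<i> * P z = c" by blast
  \<comment> \<open>\<open>P\<close> recovers \<open>Re u\<close> by construction;
    \<open>Q + \<i> * P = c\<close> shows that \<open>Im P\<close> recovers \<open>Im u\<close> up
    to a constant.\<close>
  have ueq: "u z = P z + (\<i> * of_real (Re c) + u 0)" if "z \<in> ?B" for z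
  proof -
    have "Re (Q z) - Im (P z) = Re c" using c[OF that] by auto
    then show ?thesis using P(2)[OF that] Q(2)[OF that] by (simp add: complex_eq_iff)
  qed
  have "(\<lambda>z. P z + (\<i> * of_real (Re c) + u 0)) holomorphic_on ?B" using P by (intro holomorphic_intros)
  then show ?thesis using ueq holomorphic_cong by (metis (no_types, lifting))
qed

section \<open>Holomorphic functions on complex lines\<close>

lemma norm_vector_scalar_mult: "norm (c *s v) = cmod c * norm (v :: complex ^ 'n)"
  by (simp add: norm_vec_def vector_scalar_mult_def norm_mult L2_set_right_distrib)

lemma bounded_linear_scalar_left: "bounded_linear (\<lambda>c. c *s (v :: complex ^ 'n))"
proof (rule bounded_linear_intro)
  show "(x + y) *s v = x *s v + y *s v" for x y by (simp add: vec_eq_iff algebra_simps)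
  show "(r *\<^sub>R x) *s v = r *\<^sub>R (x *s v)" for r x by (simp add: vec_eq_iff)
  show "norm (x *s v) \<le> norm x * norm v" for x by (simp add: norm_vector_scalar_mult)
qed

lemma bounded_linear_scalar_right: "bounded_linear (\<lambda>v :: complex ^ 'n. c *s v)"
proof (rule bounded_linear_intro)
  show "c *s (x + y) = c *s x + c *s y" for x y :: "complex^'n" by (simp add: vec_eq_iff algebra_simps)
  show "c *s (r *\<^sub>R x) = r *\<^sub>R (c *s x)" for r and x :: "complex^'n" by (simp add: vec_eq_iff)
  show "norm (c *s x) \<le> norm x * norm c" for x :: "complex^'n" by (simp add: norm_vector_scalar_mult)
qed

lemmas continuous_on_scalar_left [continuous_intros] =
  bounded_linear.continuous_on[OF bounded_linear_scalar_left]
lemmas continuous_on_scalar_right [continuous_intros] =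
  bounded_linear.continuous_on[OF bounded_linear_scalar_right]

lemma scalar_of_real: "complex_of_real r *s (v :: complex ^ 'n) = r *\<^sub>R v"
  by (simp add: vec_eq_iff flip: scaleR_conv_of_real)

lemma open_slice:
  assumes "open (D :: (complex ^ 'n) set)" shows "open {\<zeta>. z + \<zeta> *s v \<in> D}"
proof -
  have "continuous_on UNIV (\<lambda>\<zeta>. z + \<zeta> *s v)" by (intro continuous_intros)
  from open_vimage[OF assms this] show ?thesis by (simp add: vimage_def)
qed

text \<open>Equivalent to complex differentiability, but visibly preserved by locally uniform limits.\<close>

definition slice_hol :: "(complex ^ 'n \<Rightarrow> complex) \<Rightarrow> (complex ^ 'n) set \<Rightarrow> bool" where
  "slice_hol f D \<longleftrightarrow> continuous_on D f \<and> (\<forall>z v. (\<lambda>\<zeta>. f (z + \<zeta> *s v)) holomorphic_on {\<zeta>. z + \<zeta> *s v \<in> D})"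

lemma slice_holI:
  assumes "continuous_on D f" "\<And>z v. (\<lambda>\<zeta>. f (z + \<zeta> *s v)) holomorphic_on {\<zeta>. z + \<zeta> *s v \<in> D}"
  shows "slice_hol f D"
  using assms by (simp add: slice_hol_def)

lemma slice_hol_cont: "slice_hol f D \<Longrightarrow> continuous_on D f"
  by (simp add: slice_hol_def)

lemma slice_holD: "slice_hol f D \<Longrightarrow> (\<lambda>\<zeta>. f (z + \<zeta> *s v)) holomorphic_on {\<zeta>. z + \<zeta> *s v \<in> D}"
  by (simp add: slice_hol_def)

lemma slice_hol_slice:
  assumes "slice_hol f D" "\<And>\<zeta>. \<zeta> \<in> S \<Longrightarrow> z + \<zeta> *s v \<in> D"
  shows "(\<lambda>\<zeta>. f (z + \<zeta> *s v)) holomorphic_on S"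
  using slice_holD[OF assms(1), of z v] by (rule holomorphic_on_subset) (use assms(2) in auto)

lemma slice_hol_subset:
  assumes "slice_hol f D" "E \<subseteq> D" shows "slice_hol f E"
proof (rule slice_holI)
  show "continuous_on E f" by (rule continuous_on_subset[OF slice_hol_cont[OF assms(1)] assms(2)])
  show "(\<lambda>\<zeta>. f (z + \<zeta> *s v)) holomorphic_on {\<zeta>. z + \<zeta> *s v \<in> E}" for z v
    by (rule slice_hol_slice[OF assms(1)]) (use assms(2) in auto)
qed

lemma slice_hol_const [intro]: "slice_hol (\<lambda>_. c) D"
  by (auto simp: slice_hol_def)

lemma slice_hol_add: "slice_hol f D \<Longrightarrow> slice_hol g D \<Longrightarrow> slice_hol (\<lambda>z. f z + g z) D"
  by (auto simp: slice_hol_def intro!: continuous_intros holomorphic_intros)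

lemma slice_hol_diff: "slice_hol f D \<Longrightarrow> slice_hol g D \<Longrightarrow> slice_hol (\<lambda>z. f z - g z) D"
  by (auto simp: slice_hol_def intro!: continuous_intros holomorphic_intros)

lemma slice_hol_mult: "slice_hol f D \<Longrightarrow> slice_hol g D \<Longrightarrow> slice_hol (\<lambda>z. f z * g z) D"
  by (auto simp: slice_hol_def intro!: continuous_intros holomorphic_intros)

lemma slice_hol_divide: "slice_hol f D \<Longrightarrow> slice_hol g D \<Longrightarrow> (\<And>z. z \<in> D \<Longrightarrow> g z \<noteq> 0) \<Longrightarrow> slice_hol (\<lambda>z. f z / g z) D"
  by (auto simp: slice_hol_def intro!: continuous_intros holomorphic_intros)

lemma slice_hol_sum: "(\<And>i. i \<in> I \<Longrightarrow> slice_hol (f i) D) \<Longrightarrow> slice_hol (\<lambda>z. \<Sum>i\<in>I. f i z) D"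
  by (auto simp: slice_hol_def intro!: continuous_intros holomorphic_intros)

lemma slice_hol_prod: "(\<And>i. i \<in> I \<Longrightarrow> slice_hol (f i) D) \<Longrightarrow> slice_hol (\<lambda>z. \<Prod>i\<in>I. f i z) D"
  by (auto simp: slice_hol_def intro!: continuous_intros holomorphic_intros)

lemma slice_hol_comp_entire:
  assumes "slice_hol f D" "F holomorphic_on UNIV" shows "slice_hol (\<lambda>z. F (f z)) D"
proof (rule slice_holI)
  show "continuous_on D (\<lambda>z. F (f z))"
    using continuous_on_compose2[OF holomorphic_on_imp_continuous_on[OF assms(2)] slice_hol_cont[OF assms(1)]] by auto
  show "(\<lambda>\<zeta>. F (f (z + \<zeta> *s v))) holomorphic_on {\<zeta>. z + \<zeta> *s v \<in> D}" for z v
    using holomorphic_on_compose_gen[OF slice_holD[OF assms(1)] assms(2)] by (simp add: o_def)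
qed

lemma slice_hol_translate:
  assumes "slice_hol f D" "\<And>z. z \<in> E \<Longrightarrow> z + a \<in> D" shows "slice_hol (\<lambda>z. f (z + a)) E"
proof (rule slice_holI)
  show "continuous_on E (\<lambda>z. f (z + a))"
    by (rule continuous_on_compose2[OF slice_hol_cont[OF assms(1)]]) (use assms(2) in \<open>auto intro!: continuous_intros\<close>)
  show "(\<lambda>\<zeta>. f (z + \<zeta> *s v + a)) holomorphic_on {\<zeta>. z + \<zeta> *s v \<in> E}" for z v
  proof -
    have eq: "z + \<zeta> *s v + a = (z + a) + \<zeta> *s v" for \<zeta> by (simp add: add_ac)
    show ?thesis unfolding eq
    proof (rule slice_hol_slice[OF assms(1)])
      show "z + a + \<zeta> *s v \<in> D" if "\<zeta> \<in> {\<zeta>. z + \<zeta> *s v \<in> E}" for \<zeta>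
        using assms(2) that unfolding eq[symmetric] by simp
    qed
  qed
qed

lemma slice_hol_local:
  assumes "open D" "\<And>x. x \<in> D \<Longrightarrow> \<exists>r>0. slice_hol f (ball x r)"
  shows "slice_hol f D"
proof (rule slice_holI)
  show "continuous_on D f"
  proof (rule continuous_at_imp_continuous_on, rule ballI)
    fix x assume "x \<in> D"
    then obtain r where "r > 0" "slice_hol f (ball x r)" using assms(2) by blast
    then show "isCont f x" using slice_hol_cont continuous_on_interior by (metis centre_in_ball interior_ball)
  qed
  fix z v
  show "(\<lambda>\<zeta>. f (z + \<zeta> *s v)) holomorphic_on {\<zeta>. z + \<zeta> *s v \<in> D}"
    unfolding holomorphic_on_def
  proof safe
    fix \<zeta> assume "z + \<zeta> *s v \<in> D"
    then obtain r where r: "r > 0" "slice_hol f (ball (z + \<zeta> *s v) r)" using assms(2) by blast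
    have "(\<lambda>\<zeta>. f (z + \<zeta> *s v)) field_differentiable at \<zeta>"
      using slice_holD[OF r(2), of z v] r(1) open_slice[of "ball (z + \<zeta> *s v) r" z v]
      by (intro holomorphic_on_imp_differentiable_at) auto
    then show "(\<lambda>\<zeta>. f (z + \<zeta> *s v)) field_differentiable at \<zeta> within {\<zeta>. z + \<zeta> *s v \<in> D}"
      by (rule field_differentiable_at_within)
  qed
qed

lemma complex_frechet_imp_slice_hol:
  fixes f :: "complex ^ 'n \<Rightarrow> complex"
  assumes "\<And>z. z \<in> D \<Longrightarrow> \<exists>f'. (f has_derivative f') (at z) \<and> (\<forall>c v. f' (c *s v) = c * f' v)"
  shows "slice_hol f D"
proof (rule slice_holI)
  show "continuous_on D f"
    using assms by (meson continuous_at_imp_continuous_on has_derivative_continuous)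
  fix z v
  show "(\<lambda>\<zeta>. f (z + \<zeta> *s v)) holomorphic_on {\<zeta>. z + \<zeta> *s v \<in> D}"
    unfolding holomorphic_on_def
  proof safe
    fix \<zeta> assume "z + \<zeta> *s v \<in> D"
    then obtain f' where f': "(f has_derivative f') (at (z + \<zeta> *s v))" "\<And>c v. f' (c *s v) = c * f' v"
      using assms by blast
    have "((\<lambda>\<zeta>. z + \<zeta> *s v) has_derivative (\<lambda>h. h *s v)) (at \<zeta>)"
      by (rule has_derivative_eq_rhs[OF has_derivative_add[OF has_derivative_const
           bounded_linear_imp_has_derivative[OF bounded_linear_scalar_left]]]) simp
    from has_derivative_compose[OF this f'(1)]
    have "((\<lambda>\<zeta>. f (z + \<zeta> *s v)) has_derivative (\<lambda>h. f' v * h)) (at \<zeta>)" by (simp add: f'(2) mult.commute)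
    then show "(\<lambda>\<zeta>. f (z + \<zeta> *s v)) field_differentiable at \<zeta> within {\<zeta>. z + \<zeta> *s v \<in> D}"
      using field_differentiable_at_within field_differentiable_def has_field_derivative_def by blast
  qed
qed

section \<open>Directional complex derivatives and joint differentiability\<close>

text \<open>Defined on the line alone, so that linearity in \<open>v\<close> and joint
  differentiability can be derived and are not presupposed.\<close>

definition dd :: "complex ^ 'n \<Rightarrow> (complex ^ 'n \<Rightarrow> complex) \<Rightarrow> complex ^ 'n \<Rightarrow> complex" where
  "dd v f z = deriv (\<lambda>\<zeta>. f (z + \<zeta> *s v)) 0"

lemma slice_in_cball: "cball (z :: complex ^ 'n) r \<subseteq> D \<Longrightarrow> v \<noteq> 0 \<Longrightarrow> norm \<zeta> \<le> r / norm v \<Longrightarrow> z + \<zeta> *s v \<in> D"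
  by (rule subsetD[of "cball z r"]) (auto simp: dist_norm norm_vector_scalar_mult field_simps)

lemma dd_zero [simp]: "dd 0 f z = 0"
  by (simp add: dd_def)

lemma dd_bound:
  assumes "slice_hol f D" "cball z r \<subseteq> D" "r > 0" "\<And>w. w \<in> cball z r \<Longrightarrow> norm (f w) \<le> M"
  shows "norm (dd v f z) \<le> M * norm v / r"
proof (cases "v = 0")
  case True
  then show ?thesis by simp
next
  case False
  define R where "R = r / norm v"
  have R: "R > 0" using False assms by (simp add: R_def)
  have hol: "(\<lambda>\<zeta>. f (z + \<zeta> *s v)) holomorphic_on cball 0 R"
    by (rule slice_hol_slice[OF assms(1)]) (use slice_in_cball[OF assms(2) False] in \<open>auto simp: R_def\<close>)
  have "norm ((deriv ^^ 1) (\<lambda>\<zeta>. f (z + \<zeta> *s v)) 0) \<le> fact 1 * M / R ^ 1"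
  proof (rule Cauchy_inequality[OF holomorphic_on_subset[OF hol ball_subset_cball] holomorphic_on_imp_continuous_on[OF hol] R])
    fix x :: complex assume "norm (0 - x) = R"
    then show "norm (f (z + x *s v)) \<le> M"
      by (intro assms(4) slice_in_cball[OF subset_refl False]) (auto simp: R_def)
  qed
  then show ?thesis by (simp add: dd_def R_def)
qed

text \<open>Taylor's formula in one variable, at parameter 1 on the line through \<open>z\<close> in
  direction \<open>h\<close>, where \<open>f\<close> is bounded on a disc of radius
  \<open>R >= 2\<close>. The error depends on \<open>h\<close> only through its norm, which later
  gives differentiability in all directions at once.\<close>

lemma dd_taylor:
  assumes f: "slice_hol f D" "cball z r \<subseteq> D" "r > 0" and M: "\<And>w. w \<in> cball z r \<Longrightarrow> norm (f w) \<le> M"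
    and h: "norm h \<le> r / 2" and D: "open D"
  shows "norm (f (z + h) - f z - dd h f z) \<le> 8 * M * (norm h / r)\<^sup>2"
proof (cases "h = 0")
  case True
  then show ?thesis by simp
next
  case False
  define R where "R = r / norm h"
  have R: "R \<ge> 2" using False assms by (simp add: R_def field_simps)
  have M0: "0 \<le> M" using order_trans[OF norm_ge_zero M[of z]] assms(3) by simp
  define \<phi> where "\<phi> = (\<lambda>\<zeta>. f (z + \<zeta> *s h))"
  let ?S = "{\<zeta>. z + \<zeta> *s h \<in> D}"
  have oS: "open ?S" by (rule open_slice[OF D])
  have hol: "\<phi> holomorphic_on ?S" unfolding \<phi>_def by (rule slice_holD[OF f(1)])
  have sub: "cball 0 R \<subseteq> ?S" using slice_in_cball[OF f(2) False] by (auto simp: R_def)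
  have dd: "(deriv ^^ k) \<phi> holomorphic_on ?S" for k by (rule holomorphic_higher_deriv[OF hol oS])
  have 2: "norm ((deriv ^^ 2) \<phi> x) \<le> 8 * M / R\<^sup>2" if x: "x \<in> cball 0 1" for x
  proof -
    have in_cb: "y \<in> cball 0 R" if "dist x y \<le> R - 1" for y
    proof -
      have "norm y \<le> norm x + dist x y" by (metis dist_norm norm_minus_commute norm_triangle_sub)
      then show ?thesis using that x by auto
    qed
    then have "cball x (R - 1) \<subseteq> cball 0 R" by (meson mem_cball subsetI)
    then have sub': "cball x (R - 1) \<subseteq> ?S" using sub by blast
    have "norm ((deriv ^^ 2) \<phi> x) \<le> fact 2 * M / (R - 1) ^ 2"
    proof (rule Cauchy_inequality)
      show "\<phi> holomorphic_on ball x (R - 1)"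
        using holomorphic_on_subset[OF hol] sub' ball_subset_cball by blast
      show "continuous_on (cball x (R - 1)) \<phi>"
        using holomorphic_on_subset[OF hol] sub' holomorphic_on_imp_continuous_on by blast
      show "0 < R - 1" using R by simp
      fix y assume "norm (x - y) = R - 1"
      then have "y \<in> cball 0 R" using in_cb by (simp add: dist_norm)
      then show "norm (\<phi> y) \<le> M" unfolding \<phi>_def
        by (intro M slice_in_cball[OF subset_refl False]) (auto simp: R_def)
    qed
    \<comment> \<open>\<open>R - 1 >= R / 2\<close>, which is the origin of the constant 8.\<close>
    also have "\<dots> \<le> fact 2 * M / (R / 2) ^ 2" using R M0
      by (intro divide_left_mono power_mono mult_pos_pos) auto
    also have "\<dots> = 8 * M / R\<^sup>2" by (simp add: power2_eq_square)
    finally show ?thesis .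
  qed
  have "norm ((deriv ^^ 0) \<phi> 1 - (\<Sum>i\<le>1. (deriv ^^ i) \<phi> 0 * (1 - 0) ^ i / fact i)) \<le> (8 * M / R\<^sup>2) * norm (1 - 0 :: complex) ^ Suc 1 / fact 1"
  proof (rule complex_Taylor[of "cball 0 1"])
    fix i :: nat and x :: complex assume "x \<in> cball 0 1"
    then have "x \<in> ?S" using sub R by (auto simp: subset_iff)
    then have "((deriv ^^ i) \<phi> has_field_derivative deriv ((deriv ^^ i) \<phi>) x) (at x)"
      by (rule holomorphic_derivI[OF dd oS])
    then show "((deriv ^^ i) \<phi> has_field_derivative (deriv ^^ (Suc i)) \<phi> x) (at x within cball 0 1)"
      by (simp add: has_field_derivative_at_within)
  next
    fix x :: complex assume "x \<in> cball 0 1"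
    from 2[OF this] show "norm ((deriv ^^ Suc 1) \<phi> x) \<le> 8 * M / R\<^sup>2" by (simp add: numeral_2_eq_2)
  qed auto
  then show ?thesis using assms(3) by (simp add: \<phi>_def dd_def R_def power_divide field_simps)
qed

lemma slice_hol_uniform_limit:
  assumes "open S" and ev: "\<forall>\<^sub>F k in sequentially. slice_hol (f k) S" and ul: "uniform_limit S f g sequentially"
  shows "slice_hol g S"
proof (rule slice_holI)
  show "continuous_on S g"
    by (rule uniform_limit_theorem[OF _ ul]) (use ev in \<open>auto elim!: eventually_mono slice_hol_cont\<close>)
  fix z v
  obtain N where N: "\<And>k. k \<ge> N \<Longrightarrow> slice_hol (f k) S" using ev by (auto simp: eventually_sequentially)
  let ?T = "{\<zeta>. z + \<zeta> *s v \<in> S}"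
  have ulT: "uniform_limit ?T (\<lambda>k \<zeta>. f (k + N) (z + \<zeta> *s v)) (\<lambda>\<zeta>. g (z + \<zeta> *s v)) sequentially"
    unfolding uniform_limit_iff
  proof safe
    fix e :: real assume "e > 0"
    then obtain M where M: "\<And>k x. k \<ge> M \<Longrightarrow> x \<in> S \<Longrightarrow> dist (f k x) (g x) < e"
      using ul unfolding uniform_limit_iff eventually_sequentially by metis
    show "\<forall>\<^sub>F k in sequentially. \<forall>x\<in>?T. dist (f (k + N) (z + x *s v)) (g (z + x *s v)) < e"
      unfolding eventually_sequentially by (rule exI[of _ M]) (use M in auto)
  qed
  show "(\<lambda>\<zeta>. g (z + \<zeta> *s v)) holomorphic_on ?T"
  proof (rule holomorphic_uniform_sequence)
    show "open ?T" by (rule open_slice[OF assms(1)])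
    show "(\<lambda>\<zeta>. f (k + N) (z + \<zeta> *s v)) holomorphic_on ?T" for k by (rule slice_holD[OF N]) simp
    fix x assume "x \<in> ?T"
    then obtain d where "d > 0" "cball x d \<subseteq> ?T" using \<open>open ?T\<close> open_contains_cball by blast
    then show "\<exists>d>0. cball x d \<subseteq> ?T \<and> uniform_limit (cball x d) (\<lambda>k \<zeta>. f (k + N) (z + \<zeta> *s v)) (\<lambda>\<zeta>. g (z + \<zeta> *s v)) sequentially"
      using uniform_limit_on_subset[OF ulT] by blast
  qed
qed

lemma slice_hol_bounded_cball:
  assumes "slice_hol f D" "cball z r \<subseteq> D"
  obtains M where "M > 0" "\<And>w. w \<in> cball z r \<Longrightarrow> norm (f w) \<le> M"
proof -
  have "compact (f ` cball z r)"
    by (intro compact_continuous_image continuous_on_subset[OF slice_hol_cont[OF assms(1)] assms(2)] compact_cball)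
  then obtain M where "M > 0" "\<forall>x\<in>f ` cball z r. norm x \<le> M" using compact_imp_bounded bounded_pos by blast
  then show thesis using that by auto
qed

lemma dd_scale:
  assumes "slice_hol f D" "open D" "z \<in> D"
  shows "dd (c *s v) f z = c * dd v f z"
proof -
  have "((\<lambda>\<zeta>. f (z + \<zeta> *s v)) has_field_derivative dd v f z) (at (c * 0))"
    unfolding dd_def using holomorphic_derivI[OF slice_holD[OF assms(1)] open_slice[OF assms(2)], of 0 z v] assms(3) by simp
  from DERIV_chain2[where f = "\<lambda>\<zeta>. f (z + \<zeta> *s v)" and g = "\<lambda>x. c * x" and x = 0 and s = UNIV and Db = c, OF this]
  have "((\<lambda>\<zeta>. f (z + (c * \<zeta>) *s v)) has_field_derivative dd v f z * c) (at 0)"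
    by (auto intro!: derivative_eq_intros)
  then have "((\<lambda>\<zeta>. f (z + \<zeta> *s (c *s v))) has_field_derivative dd v f z * c) (at 0)"
    by (simp add: vector_smult_assoc mult.commute)
  then show ?thesis unfolding dd_def[of "c *s v"] by (simp add: DERIV_imp_deriv mult.commute)
qed

text \<open>Near each point the difference quotients along \<open>v\<close> converge uniformly by
  the quadratic Taylor bound, and uniform limits inherit holomorphy on lines.\<close>

lemma slice_hol_dd:
  assumes f: "slice_hol f D" and D: "open D"
  shows "slice_hol (dd v f) D"
proof (rule slice_hol_local[OF D])
  fix x assume "x \<in> D"
  then obtain r0 where "r0 > 0" and r0: "cball x r0 \<subseteq> D" using D open_contains_cball by blast
  define r where "r = r0 / 2"
  have r: "r > 0" "r0 = 2 * r" using \<open>r0 > 0\<close> by (simp_all add: r_def)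
  obtain M where M: "M > 0" "\<And>w. w \<in> cball x r0 \<Longrightarrow> norm (f w) \<le> M" using slice_hol_bounded_cball[OF f r0] by blast
  have cb: "cball y r \<subseteq> cball x r0" if "y \<in> ball x r" for y
  proof
    fix w assume "w \<in> cball y r"
    then show "w \<in> cball x r0" using that dist_triangle[of x w y] r by simp
  qed
  define c where "c k = complex_of_real (inverse (real (Suc k)))" for k
  have nc: "norm (c k) = inverse (real (Suc k))" for k by (simp add: c_def norm_inverse del: of_nat_Suc)
  have c0: "c k \<noteq> 0" for k by (simp add: c_def del: of_nat_Suc)
  define q where "q k z = (f (z + c k *s v) - f z) / c k" for k z
  have clim: "(\<lambda>k. norm (c k) * B) \<longlonglongrightarrow> 0" for B
    unfolding nc using tendsto_mult_left_zero[OF LIMSEQ_inverse_real_of_nat] by blast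
  have "\<forall>\<^sub>F k in sequentially. norm (c k) * norm v < r / 2"
    by (rule order_tendstoD(2)[OF clim]) (use r in simp)
  then have ev: "\<forall>\<^sub>F k in sequentially. norm (c k *s v) < r / 2" by (simp add: norm_vector_scalar_mult)
  have "slice_hol (dd v f) (ball x r)"
  proof (rule slice_hol_uniform_limit[of _ q])
    show "\<forall>\<^sub>F k in sequentially. slice_hol (q k) (ball x r)"
      using ev
    proof eventually_elim
      case (elim k)
      show ?case unfolding q_def
      proof (intro slice_hol_divide slice_hol_diff slice_hol_const)
        show "slice_hol (\<lambda>z. f (z + c k *s v)) (ball x r)"
        proof (rule slice_hol_translate[OF f])
          fix z assume "z \<in> ball x r"
          then have "z + c k *s v \<in> cball x r0"
            using elim cb[of z] r by (auto simp: dist_norm subset_iff)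
          then show "z + c k *s v \<in> D" using r0 by blast
        qed
        show "slice_hol f (ball x r)" using r0 r by (intro slice_hol_subset[OF f]) auto
      qed (rule c0)
    qed
    show "uniform_limit (ball x r) q (dd v f) sequentially"
      unfolding uniform_limit_iff
    proof safe
      fix e :: real assume "e > 0"
      then have "\<forall>\<^sub>F k in sequentially. norm (c k) * (8 * M * (norm v / r)\<^sup>2) < e"
        by (intro order_tendstoD(2)[OF clim])
      then show "\<forall>\<^sub>F k in sequentially. \<forall>z\<in>ball x r. dist (q k z) (dd v f z) < e"
        using ev
      proof eventually_elim
        case (elim k)
        show ?case
        proof
          fix z assume z: "z \<in> ball x r"
          have zD: "cball z r \<subseteq> D" using cb[OF z] r0 by blast
          have "norm (f (z + c k *s v) - f z - dd (c k *s v) f z) \<le> 8 * M * (norm (c k *s v) / r)\<^sup>2"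
            by (rule dd_taylor[OF f zD r(1) _ _ D]) (use M cb[OF z] elim in auto)
          moreover have "c k * (q k z - dd v f z) = f (z + c k *s v) - f z - dd (c k *s v) f z"
          proof -
            have "z \<in> D" using zD r(1) by auto
            moreover have "c k * q k z = f (z + c k *s v) - f z" using c0[of k] by (simp add: q_def)
            ultimately show ?thesis using dd_scale[OF f D] by (simp add: right_diff_distrib)
          qed
          ultimately have "norm (c k * (q k z - dd v f z)) \<le> 8 * M * (norm (c k *s v) / r)\<^sup>2" by simp
          also have "\<dots> = norm (c k) * (norm (c k) * (8 * M * (norm v / r)\<^sup>2))"
            by (simp add: norm_vector_scalar_mult power2_eq_square)
          finally have "norm (c k) * norm (q k z - dd v f z) \<le> norm (c k) * (norm (c k) * (8 * M * (norm v / r)\<^sup>2))"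
            by (simp only: norm_mult)
          then have "norm (q k z - dd v f z) \<le> norm (c k) * (8 * M * (norm v / r)\<^sup>2)"
            by (rule mult_left_le_imp_le) (simp add: c0)
          with elim show "dist (q k z) (dd v f z) < e" by (simp add: dist_norm)
        qed
      qed
    qed
  qed simp
  then show "\<exists>r>0. slice_hol (dd v f) (ball x r)" using r by blast
qed

text \<open>Moving by \<open>c (v + w)\<close> is moving by \<open>c v\<close> and then by
  \<open>c w\<close>, the second leg starting at the displaced point \<open>z + c v\<close>. The
  Taylor errors are of order \<open>c^2\<close>, and continuity of \<open>dd w f\<close> brings the
  derivative back to \<open>z\<close>.\<close>

lemma dd_add:
  assumes f: "slice_hol f D" and D: "open D" and z: "z \<in> D"
  shows "dd (v + w) f z = dd v f z + dd w f z"
proof -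
  obtain r0 where "r0 > 0" and r0: "cball z r0 \<subseteq> D" using D z open_contains_cball by blast
  define r where "r = r0 / 2"
  have r: "r > 0" "r0 = 2 * r" using \<open>r0 > 0\<close> by (simp_all add: r_def)
  obtain M where M: "M > 0" "\<And>w. w \<in> cball z r0 \<Longrightarrow> norm (f w) \<le> M" using slice_hol_bounded_cball[OF f r0] by blast
  define c where "c k = complex_of_real (inverse (real (Suc k)))" for k
  have nc: "norm (c k) = inverse (real (Suc k))" for k by (simp add: c_def norm_inverse del: of_nat_Suc)
  have c0: "c k \<noteq> 0" for k by (simp add: c_def del: of_nat_Suc)
  have clim: "(\<lambda>k. norm (c k) * B) \<longlonglongrightarrow> 0" for B
    unfolding nc using tendsto_mult_left_zero[OF LIMSEQ_inverse_real_of_nat] by blast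
  have evs: "\<forall>\<^sub>F k in sequentially. norm (c k *s u) < r / 2" for u :: "complex ^ 'a"
    using order_tendstoD(2)[OF clim[of "norm u"], of "r/2"] r by (simp add: norm_vector_scalar_mult)
  have tay: "norm (f (y + c k *s u) - f y - c k * dd u f y) \<le> norm (c k) * (norm (c k) * (8 * M * (norm u / r)\<^sup>2))"
    if "y \<in> cball z r" "norm (c k *s u) < r / 2" for y k u
  proof -
    have cb: "cball y r \<subseteq> cball z r0"
    proof
      fix w assume "w \<in> cball y r"
      then show "w \<in> cball z r0" using that dist_triangle[of z w y] r by simp
    qed
    have yD: "cball y r \<subseteq> D" using cb r0 by blast
    have "norm (f (y + c k *s u) - f y - dd (c k *s u) f y) \<le> 8 * M * (norm (c k *s u) / r)\<^sup>2"
      by (rule dd_taylor[OF f yD r(1) _ _ D]) (use M cb that in auto)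
    also have "\<dots> = norm (c k) * (norm (c k) * (8 * M * (norm u / r)\<^sup>2))"
      by (simp add: norm_vector_scalar_mult power2_eq_square)
    finally show ?thesis using dd_scale[OF f D, of y "c k" u] yD r(1) by (metis centre_in_cball less_imp_le subsetD)
  qed
  define C where "C = 8 * M * (norm (v + w) / r)\<^sup>2 + 8 * M * (norm v / r)\<^sup>2 + 8 * M * (norm w / r)\<^sup>2"
  have "(\<lambda>k. dd (v + w) f z - dd v f z - dd w f (z + c k *s v)) \<longlonglongrightarrow> 0"
  proof (rule Lim_null_comparison[OF _ clim[of C]])
    show "\<forall>\<^sub>F k in sequentially. norm (dd (v + w) f z - dd v f z - dd w f (z + c k *s v)) \<le> norm (c k) * C"
      using evs[of v] evs[of w] evs[of "v + w"]
    proof eventually_elim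
      case (elim k)
      have zv: "z + c k *s v \<in> cball z r" using elim(1) r(1) by (simp add: dist_norm)
      have zz: "z \<in> cball z r" using r by simp
      have A: "norm (f (z + c k *s (v + w)) - f z - c k * dd (v + w) f z) \<le> norm (c k) * (norm (c k) * (8 * M * (norm (v + w) / r)\<^sup>2))"
        by (rule tay[OF zz elim(3)])
      have B: "norm (f (z + c k *s v) - f z - c k * dd v f z) \<le> norm (c k) * (norm (c k) * (8 * M * (norm v / r)\<^sup>2))"
        by (rule tay[OF zz elim(1)])
      have E: "norm (f (z + c k *s v + c k *s w) - f (z + c k *s v) - c k * dd w f (z + c k *s v)) \<le> norm (c k) * (norm (c k) * (8 * M * (norm w / r)\<^sup>2))"
        by (rule tay[OF zv elim(2)])
      have eq: "z + c k *s (v + w) = z + c k *s v + c k *s w" by (simp add: vector_add_ldistrib)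
      have "c k * (dd (v + w) f z - dd v f z - dd w f (z + c k *s v)) =
          - (f (z + c k *s (v + w)) - f z - c k * dd (v + w) f z) + (f (z + c k *s v) - f z - c k * dd v f z)
          + (f (z + c k *s v + c k *s w) - f (z + c k *s v) - c k * dd w f (z + c k *s v))"
        unfolding eq by (simp add: algebra_simps)
      also have "norm \<dots> \<le> norm (c k) * (norm (c k) * (8 * M * (norm (v + w) / r)\<^sup>2)) + norm (c k) * (norm (c k) * (8 * M * (norm v / r)\<^sup>2))
          + norm (c k) * (norm (c k) * (8 * M * (norm w / r)\<^sup>2))"
        by (intro norm_triangle_le add_mono) (use A B E in \<open>simp_all only: norm_minus_cancel\<close>)
      also have "\<dots> = norm (c k) * (norm (c k) * C)" by (simp add: C_def algebra_simps)
      finally have "norm (c k) * norm (dd (v + w) f z - dd v f z - dd w f (z + c k *s v)) \<le> norm (c k) * (norm (c k) * C)"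
        by (simp only: norm_mult)
      then show ?case by (rule mult_left_le_imp_le) (simp add: c0)
    qed
  qed
  moreover have "(\<lambda>k. dd (v + w) f z - dd v f z - dd w f (z + c k *s v)) \<longlonglongrightarrow> dd (v + w) f z - dd v f z - dd w f z"
  proof (intro tendsto_diff tendsto_const)
    have "isCont (dd w f) z"
      using slice_hol_cont[OF slice_hol_dd[OF f D]] D z continuous_on_eq_continuous_at by blast
    moreover have "(\<lambda>k. z + c k *s v) \<longlonglongrightarrow> z"
    proof (rule LIM_zero_cancel, rule tendsto_norm_zero_cancel)
      show "(\<lambda>k. norm (z + c k *s v - z)) \<longlonglongrightarrow> 0" using clim[of "norm v"] by (simp add: norm_vector_scalar_mult)
    qed
    ultimately show "(\<lambda>k. dd w f (z + c k *s v)) \<longlonglongrightarrow> dd w f z" by (rule isCont_tendsto_compose)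
  qed
  ultimately have "0 = dd (v + w) f z - dd v f z - dd w f z" by (rule LIMSEQ_unique)
  then show ?thesis by (simp add: algebra_simps)
qed

text \<open>The quadratic error bound is uniform over directions, and \<open>dd v f z\<close> is
  linear in \<open>v\<close>; together these are Frechet differentiability.\<close>

lemma slice_hol_has_derivative:
  assumes f: "slice_hol f D" and D: "open D" and z: "z \<in> D"
  shows "(f has_derivative (\<lambda>v. dd v f z)) (at z)"
proof -
  obtain r where "r > 0" and r: "cball z r \<subseteq> D" using D z open_contains_cball by blast
  obtain M where M: "M > 0" "\<And>w. w \<in> cball z r \<Longrightarrow> norm (f w) \<le> M" using slice_hol_bounded_cball[OF f r] by blast
  have bl: "bounded_linear (\<lambda>v. dd v f z)"
  proof (rule bounded_linear_intro)
    show "dd (x + y) f z = dd x f z + dd y f z" for x y by (rule dd_add[OF f D z])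
    show "dd (a *\<^sub>R x) f z = a *\<^sub>R dd x f z" for a x
      using dd_scale[OF f D z, of "of_real a" x] by (simp add: scalar_of_real scaleR_conv_of_real)
    show "norm (dd x f z) \<le> norm x * (M / r)" for x
      using dd_bound[OF f r \<open>r > 0\<close> M(2), of x] by (simp add: mult.commute)
  qed
  show ?thesis
  proof (rule has_derivativeI_sandwich[where e = "r/2" and H = "\<lambda>y. 8 * M / r\<^sup>2 * norm (y - z)", OF _ bl])
    show "0 < r / 2" using \<open>r > 0\<close> by simp
    show "((\<lambda>y. 8 * M / r\<^sup>2 * norm (y - z)) \<longlongrightarrow> 0) (at z within UNIV)"
      by (intro tendsto_eq_intros) auto
    fix y :: "complex ^ 'a" assume y: "y \<noteq> z" "dist y z < r / 2"
    have "norm (f (z + (y - z)) - f z - dd (y - z) f z) \<le> 8 * M * (norm (y - z) / r)\<^sup>2"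
      by (rule dd_taylor[OF f r \<open>r > 0\<close> M(2) _ D]) (use y in \<open>auto simp: dist_norm\<close>)
    moreover have "8 * M * (norm (y - z) / r)\<^sup>2 = (8 * M / r\<^sup>2 * norm (y - z)) * norm (y - z)"
      by (simp add: power_divide power2_eq_square)
    ultimately show "norm (f y - f z - dd (y - z) f z) / norm (y - z) \<le> 8 * M / r\<^sup>2 * norm (y - z)"
      using y by (simp add: pos_divide_le_eq)
  qed
qed

section \<open>Holomorphic maps and their limits\<close>

lemma holomorphic_map_on_imp_slice_hol:
  assumes "holomorphic_map_on f D"
  shows "slice_hol (\<lambda>z. f z $ i) D"
proof (rule complex_frechet_imp_slice_hol)
  fix z assume "z \<in> D"
  then obtain f' where f': "(f has_derivative f') (at z)" "\<And>c v. f' (c *s v) = c *s f' v"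
    using assms unfolding holomorphic_map_on_def by blast
  have "((\<lambda>z. f z $ i) has_derivative (\<lambda>v. f' v $ i)) (at z)"
    by (rule bounded_linear.has_derivative[OF bounded_linear_vec_nth f'(1)])
  then show "\<exists>f'. ((\<lambda>z. f z $ i) has_derivative f') (at z) \<and> (\<forall>c v. f' (c *s v) = c * f' v)"
    using f'(2) by (intro exI[of _ "\<lambda>v. f' v $ i"]) simp
qed

lemma has_derivative_componentwise_vec:
  fixes f :: "complex ^ 'n \<Rightarrow> complex ^ 'm"
  assumes "\<And>i. ((\<lambda>z. f z $ i) has_derivative (\<lambda>v. f' v $ i)) (at z)"
  shows "(f has_derivative f') (at z)"
proof -
  have eq: "x = (\<Sum>i\<in>UNIV. (x $ i) *s axis i 1)" for x :: "complex ^ 'm"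
    by (simp add: vec_eq_iff axis_def if_distrib cong: if_cong)
  have "((\<lambda>z. \<Sum>i\<in>UNIV. (f z $ i) *s axis i 1) has_derivative (\<lambda>v. \<Sum>i\<in>UNIV. (f' v $ i) *s (axis i 1 :: complex ^ 'm))) (at z)"
    by (intro has_derivative_sum bounded_linear.has_derivative[OF bounded_linear_scalar_left] assms)
  then show ?thesis unfolding eq[symmetric] .
qed

definition jac :: "(complex ^ 'n \<Rightarrow> complex ^ 'm) \<Rightarrow> complex ^ 'n \<Rightarrow> complex ^ 'n ^ 'm" where
  "jac f z = (\<chi> i j. dd (axis j 1) (\<lambda>z. f z $ i) z)"

lemma dd_eq_sum:
  assumes "slice_hol f D" "open D" "z \<in> D"
  shows "dd v f z = (\<Sum>j\<in>UNIV. v $ j * dd (axis j 1) f z)"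
proof -
  have lin: "linear (\<lambda>v. dd v f z)"
    using slice_hol_has_derivative[OF assms] has_derivative_linear by blast
  have "v = (\<Sum>j\<in>UNIV. (v $ j) *s axis j 1)"
    by (simp add: vec_eq_iff axis_def if_distrib cong: if_cong)
  then have "dd v f z = dd (\<Sum>j\<in>UNIV. (v $ j) *s axis j 1) f z" by simp
  also have "\<dots> = (\<Sum>j\<in>UNIV. dd ((v $ j) *s axis j 1) f z)"
    by (rule linear_sum[OF lin])
  also have "\<dots> = (\<Sum>j\<in>UNIV. v $ j * dd (axis j 1) f z)"
    by (simp add: dd_scale[OF assms])
  finally show ?thesis .
qed

lemma slice_hol_has_derivative_jac:
  assumes "\<And>i. slice_hol (\<lambda>z. f z $ i) D" "open D" "z \<in> D"
  shows "(f has_derivative (\<lambda>v. jac f z *v v)) (at z)"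
proof (rule has_derivative_componentwise_vec)
  fix i
  have "(jac f z *v v) $ i = dd v (\<lambda>z. f z $ i) z" for v
    by (simp add: dd_eq_sum[OF assms(1) assms(2,3), where v = v] matrix_vector_mult_def jac_def mult.commute)
  then show "((\<lambda>z. f z $ i) has_derivative (\<lambda>v. (jac f z *v v) $ i)) (at z)"
    using slice_hol_has_derivative[OF assms(1) assms(2,3), of i] by presburger
qed

lemma holomorphic_map_on_iff_slice_hol:
  assumes "open D"
  shows "holomorphic_map_on f D \<longleftrightarrow> (\<forall>i. slice_hol (\<lambda>z. f z $ i) D)"
proof
  assume "\<forall>i. slice_hol (\<lambda>z. f z $ i) D"
  then have "(f has_derivative (\<lambda>v. jac f z *v v)) (at z)" if "z \<in> D" for z
    using slice_hol_has_derivative_jac assms that by blast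
  then show "holomorphic_map_on f D"
    unfolding holomorphic_map_on_def by (metis vector_scalar_commute)
qed (auto intro: holomorphic_map_on_imp_slice_hol)

lemma has_derivative_jac:
  assumes "holomorphic_map_on f D" "open D" "z \<in> D"
  shows "(f has_derivative (\<lambda>v. jac f z *v v)) (at z)"
  using slice_hol_has_derivative_jac holomorphic_map_on_imp_slice_hol assms by blast

lemma holomorphic_map_on_continuous: "holomorphic_map_on f D \<Longrightarrow> continuous_on D f"
  unfolding holomorphic_map_on_def by (meson continuous_at_imp_continuous_on has_derivative_continuous)

lemma holomorphic_map_on_subset: "holomorphic_map_on f D \<Longrightarrow> E \<subseteq> D \<Longrightarrow> holomorphic_map_on f E"
  unfolding holomorphic_map_on_def by blast

lemma holomorphic_map_on_compose:
  assumes "holomorphic_map_on f D" "holomorphic_map_on g E" "f ` D \<subseteq> E"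
  shows "holomorphic_map_on (g \<circ> f) D"
  unfolding holomorphic_map_on_def
proof
  fix z assume z: "z \<in> D"
  obtain f' where f': "(f has_derivative f') (at z)" "\<forall>c v. f' (c *s v) = c *s f' v"
    using assms(1) z unfolding holomorphic_map_on_def by blast
  obtain g' where g': "(g has_derivative g') (at (f z))" "\<forall>c v. g' (c *s v) = c *s g' v"
    using assms(2,3) z unfolding holomorphic_map_on_def by blast
  show "\<exists>f'. (g \<circ> f has_derivative f') (at z) \<and> (\<forall>c v. f' (c *s v) = c *s f' v)"
    using diff_chain_at[OF f'(1) g'(1)] f'(2) g'(2) by (intro exI[of _ "g' \<circ> f'"]) simp
qed

lemma slice_hol_compose:
  fixes g :: "complex ^ 'm \<Rightarrow> complex" and f :: "complex ^ 'n \<Rightarrow> complex ^ 'm"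
  assumes "holomorphic_map_on f D" "slice_hol g E" "open E" "f ` D \<subseteq> E"
  shows "slice_hol (\<lambda>z. g (f z)) D"
proof (rule complex_frechet_imp_slice_hol)
  fix z assume z: "z \<in> D"
  obtain f' where f': "(f has_derivative f') (at z)" "\<forall>c v. f' (c *s v) = c *s f' v"
    using assms(1) z unfolding holomorphic_map_on_def by blast
  have fz: "f z \<in> E" using assms(4) z by blast
  have "((\<lambda>z. g (f z)) has_derivative (\<lambda>v. dd (f' v) g (f z))) (at z)"
    using has_derivative_compose[OF f'(1) slice_hol_has_derivative[OF assms(2,3) fz]] .
  then show "\<exists>f'. ((\<lambda>z. g (f z)) has_derivative f') (at z) \<and> (\<forall>c v. f' (c *s v) = c * f' v)"
    using f'(2) dd_scale[OF assms(2,3) fz] by (intro exI[of _ "\<lambda>v. dd (f' v) g (f z)"]) simp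
qed

lemma slice_hol_det_jac:
  fixes f :: "complex ^ 'n \<Rightarrow> complex ^ 'n"
  assumes "holomorphic_map_on f D" "open D"
  shows "slice_hol (\<lambda>z. det (jac f z)) D"
  unfolding det_def jac_def vec_lambda_beta
  by (intro slice_hol_sum slice_hol_mult slice_hol_const slice_hol_prod slice_hol_dd
      holomorphic_map_on_imp_slice_hol assms)

lemma jac_chain:
  fixes f g :: "complex ^ 'n \<Rightarrow> complex ^ 'n"
  assumes "holomorphic_map_on f A" "open A" "holomorphic_map_on g B" "open B"
    and "x \<in> A" "f x \<in> B" and inv: "\<And>y. y \<in> A \<Longrightarrow> f y \<in> B \<Longrightarrow> g (f y) = y"
  shows "jac g (f x) ** jac f x = mat 1"
proof -
  have fc: "continuous_on A f" by (rule holomorphic_map_on_continuous[OF assms(1)])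
  have op: "open (A \<inter> f -` B)" by (rule continuous_open_preimage[OF fc assms(2,4)])
  have "(g \<circ> f has_derivative (\<lambda>v. jac g (f x) *v v) \<circ> (\<lambda>v. jac f x *v v)) (at x)"
    by (rule diff_chain_at[OF has_derivative_jac[OF assms(1,2,5)] has_derivative_jac[OF assms(3,4,6)]])
  then have "(id has_derivative (\<lambda>v. jac g (f x) *v v) \<circ> (\<lambda>v. jac f x *v v)) (at x)"
    by (rule has_derivative_transform_within_open[OF _ op]) (use assms in auto)
  then have "(\<lambda>v. jac g (f x) *v v) \<circ> (\<lambda>v. jac f x *v v) = id"
    using has_derivative_unique has_derivative_id by (metis id_def)
  then have "(jac g (f x) ** jac f x) *v v = mat 1 *v v" for v
    by (simp add: fun_eq_iff matrix_vector_mul_assoc)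
  then show ?thesis by (metis matrix_eq)
qed

lemma norm_vec_le_sum: "norm (x :: complex ^ 'n) \<le> (\<Sum>i\<in>UNIV. norm (x $ i))"
  unfolding norm_vec_def by (rule L2_set_le_sum) simp

lemma slice_hol_lipschitz:
  assumes f: "slice_hol f D" and D: "open D" and cb: "cball x (2 * r) \<subseteq> D" and r: "r > 0"
    and M: "\<And>w. w \<in> cball x (2 * r) \<Longrightarrow> norm (f w) \<le> M"
    and y: "y \<in> ball x r" "z \<in> ball x r"
  shows "norm (f y - f z) \<le> M / r * norm (y - z)"
proof (rule differentiable_bound[of "ball x r" f "\<lambda>z v. dd v f z"])
  have cb': "cball w r \<subseteq> cball x (2 * r)" if "w \<in> ball x r" for w
  proof
    fix u assume "u \<in> cball w r"
    then show "u \<in> cball x (2 * r)" using that dist_triangle[of x u w] by simp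
  qed
  fix w assume w: "w \<in> ball x r"
  then have "w \<in> D" using cb r by (auto simp: subset_iff)
  then show "(f has_derivative (\<lambda>v. dd v f w)) (at w within ball x r)"
    using slice_hol_has_derivative[OF f D] has_derivative_at_withinI by blast
  show "onorm (\<lambda>v. dd v f w) \<le> M / r"
  proof (rule onorm_le)
    fix v
    have "norm (dd v f w) \<le> M * norm v / r"
      by (rule dd_bound[OF f subset_trans[OF cb'[OF w] cb] r]) (use M cb'[OF w] in auto)
    then show "norm (dd v f w) \<le> M / r * norm v" by simp
  qed
qed (use y in auto)

text \<open>Cauchy's estimate makes bounded families equicontinuous, as Montel's theorem requires.
  The factor \<open>CARD('m)\<close> comes from bounding the norm by the sum of the component
  moduli.\<close>

lemma holomorphic_map_lipschitz:
  fixes f :: "complex ^ 'n \<Rightarrow> complex ^ 'm"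
  assumes f: "holomorphic_map_on f D" and D: "open D" and cb: "cball x (2 * r) \<subseteq> D" and r: "r > 0"
    and M: "\<And>w. w \<in> cball x (2 * r) \<Longrightarrow> norm (f w) \<le> M"
    and y: "y \<in> ball x r" "z \<in> ball x r"
  shows "norm (f y - f z) \<le> real CARD('m) * (M / r) * norm (y - z)"
proof -
  have "norm (f y $ i - f z $ i) \<le> M / r * norm (y - z)" for i
  proof (rule slice_hol_lipschitz[OF holomorphic_map_on_imp_slice_hol[OF f] D cb r _ y])
    show "norm (f w $ i) \<le> M" if "w \<in> cball x (2 * r)" for w
      using Finite_Cartesian_Product.norm_nth_le[of "f w" i] M[OF that] by linarith
  qed
  then have "(\<Sum>i\<in>UNIV. norm ((f y - f z) $ i)) \<le> (\<Sum>i\<in>(UNIV :: 'm set). M / r * norm (y - z))"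
    by (intro sum_mono) simp
  then show ?thesis using norm_vec_le_sum[of "f y - f z"] by simp
qed

section \<open>Montel's theorem for maps with growing domains\<close>

lemma uniformly_Cauchy_on_compact:
  fixes F :: "nat \<Rightarrow> 'a::metric_space \<Rightarrow> 'b::metric_space"
  assumes K: "compact K"
    and loc: "\<And>x e. x \<in> K \<Longrightarrow> e > 0 \<Longrightarrow> \<exists>d>0. \<exists>N. \<forall>m\<ge>N. \<forall>n\<ge>N. \<forall>y\<in>ball x d. dist (F m y) (F n y) < e"
  shows "uniformly_Cauchy_on K F"
proof (rule uniformly_Cauchy_onI)
  fix e :: real assume "e > 0"
  from loc[OF _ this] obtain d N where dN: "\<And>x. x \<in> K \<Longrightarrow> d x > 0"
    "\<And>x m n y. x \<in> K \<Longrightarrow> m \<ge> N x \<Longrightarrow> n \<ge> N x \<Longrightarrow> y \<in> ball x (d x) \<Longrightarrow> dist (F m y) (F n y) < e"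
    by metis
  obtain T where T: "T \<subseteq> K" "finite T" "K \<subseteq> (\<Union>x\<in>T. ball x (d x))"
  proof (rule compactE_image[OF K, of K "\<lambda>x. ball x (d x)"])
    show "K \<subseteq> (\<Union>x\<in>K. ball x (d x))" using dN(1) by force
  qed auto
  have "dist (F m x) (F n x) < e" if "x \<in> K" "m \<ge> Max (N ` T)" "n \<ge> Max (N ` T)" for x m n
  proof -
    obtain t where t: "t \<in> T" "x \<in> ball t (d t)" using T(3) \<open>x \<in> K\<close> by blast
    then have "N t \<le> Max (N ` T)" using T(2) by simp
    then show ?thesis using dN(2)[of t m n x] t T(1) that by auto
  qed
  then show "\<exists>M. \<forall>x\<in>K. \<forall>m\<ge>M. \<forall>n\<ge>M. dist (F m x) (F n x) < e" by blast
qed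

lemma holomorphic_map_uniform_limit:
  fixes F :: "nat \<Rightarrow> complex ^ 'n \<Rightarrow> complex ^ 'm"
  assumes D: "open D" and A: "\<And>k. holomorphic_map_on (F k) (A k)"
    and ex: "\<And>K. compact K \<Longrightarrow> K \<subseteq> D \<Longrightarrow> \<forall>\<^sub>F k in sequentially. K \<subseteq> A k"
    and ul: "\<And>K. compact K \<Longrightarrow> K \<subseteq> D \<Longrightarrow> uniform_limit K F G sequentially"
  shows "holomorphic_map_on G D"
  unfolding holomorphic_map_on_iff_slice_hol[OF D]
proof (rule allI, rule slice_hol_local[OF D])
  fix i x assume "x \<in> D"
  then obtain r where r: "r > 0" "cball x r \<subseteq> D" using D open_contains_cball by blast
  have ev: "\<forall>\<^sub>F k in sequentially. cball x r \<subseteq> A k" by (rule ex[OF compact_cball r(2)])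
  have "slice_hol (\<lambda>z. G z $ i) (ball x r)"
  proof (rule slice_hol_uniform_limit[where f = "\<lambda>k z. F k z $ i"])
    show "\<forall>\<^sub>F k in sequentially. slice_hol (\<lambda>z. F k z $ i) (ball x r)"
      using ev
    proof eventually_elim
      case (elim k)
      have "ball x r \<subseteq> A k" using elim ball_subset_cball by blast
      then show ?case by (rule slice_hol_subset[OF holomorphic_map_on_imp_slice_hol[OF A]])
    qed
    have "uniform_limit (ball x r) F G sequentially"
      by (rule uniform_limit_on_subset[OF ul[OF compact_cball r(2)] ball_subset_cball])
    then show "uniform_limit (ball x r) (\<lambda>k z. F k z $ i) (\<lambda>z. G z $ i) sequentially"
      by (rule bounded_linear.uniform_limit[OF bounded_linear_vec_nth])
  qed simp
  then show "\<exists>r>0. slice_hol (\<lambda>z. G z $ i) (ball x r)" using r by blast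
qed

text \<open>A diagonal subsequence converges on a countable dense set, and a common Lipschitz
  constant near each point spreads this to a uniform Cauchy property there; finitely many such
  neighbourhoods cover a compact set.\<close>

theorem holomorphic_map_Montel:
  fixes F :: "nat \<Rightarrow> complex ^ 'n \<Rightarrow> complex ^ 'm"
  assumes D: "open D" and A: "\<And>k. holomorphic_map_on (F k) (A k)" "\<And>k. open (A k)"
    and ex: "\<And>K. compact K \<Longrightarrow> K \<subseteq> D \<Longrightarrow> \<forall>\<^sub>F k in sequentially. K \<subseteq> A k"
    and M: "\<And>k z. z \<in> A k \<Longrightarrow> norm (F k z) \<le> M"
  shows "\<exists>s G. strict_mono (s :: nat \<Rightarrow> nat) \<and> holomorphic_map_on G D \<and>
    (\<forall>K. compact K \<longrightarrow> K \<subseteq> D \<longrightarrow> uniform_limit K (F \<circ> s) G sequentially)"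
proof -
  \<comment> \<open>Extension by zero gives bounded maps on the whole space, to which the diagonal
    argument applies in spite of the varying domains; on a compact subset of \<open>D\<close> it
    agrees with \<open>F\<close> eventually.\<close>
  define F0 where "F0 k z = (if z \<in> A k then F k z else 0)" for k z
  define M' where "M' = max M 1"
  have M': "M' > 0" "\<And>k z. z \<in> A k \<Longrightarrow> norm (F k z) \<le> M'"
    using M by (simp_all add: M'_def le_max_iff_disj)
  have F0M: "norm (F0 k z) \<le> M'" for k z using M' by (simp add: F0_def)
  obtain S :: "(complex ^ 'n) set" where S: "countable S" "\<And>X. open X \<Longrightarrow> X \<noteq> {} \<Longrightarrow> \<exists>d\<in>S. d \<in> X"
    by (rule countable_dense_setE) blast
  obtain s where s: "strict_mono (s :: nat \<Rightarrow> nat)" "\<And>x. x \<in> S \<Longrightarrow> \<exists>l. (\<lambda>n. F0 (s n) x) \<longlonglongrightarrow> l"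
    by (rule function_convergent_subsequence[OF S(1), where f = F0, OF F0M]) blast
  have exs: "\<forall>\<^sub>F k in sequentially. K \<subseteq> A (s k)" if "compact K" "K \<subseteq> D" for K
    using eventually_subseq[OF s(1) ex[OF that]] .
  have cau: "uniformly_Cauchy_on K (F \<circ> s)" if K: "compact K" "K \<subseteq> D" for K
  proof (rule uniformly_Cauchy_on_compact[OF K(1)])
    fix x and e :: real assume x: "x \<in> K" and e: "e > 0"
    then obtain r0 where "r0 > 0" and r0: "cball x r0 \<subseteq> D" using D K open_contains_cball by blast
    define r where "r = r0 / 2"
    have r: "r > 0" "r0 = 2 * r" using \<open>r0 > 0\<close> by (simp_all add: r_def)
    obtain N where N: "\<And>k. k \<ge> N \<Longrightarrow> cball x (2 * r) \<subseteq> A (s k)"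
      using exs[OF compact_cball r0] r(2) by (auto simp: eventually_sequentially)
    define L where "L = real CARD('m) * (M' / r)"
    have L: "L > 0" using M' r by (simp add: L_def)
    have lip: "dist (F (s k) y) (F (s k) z) \<le> L * dist y z" if "k \<ge> N" "y \<in> ball x r" "z \<in> ball x r" for k y z
      unfolding dist_norm L_def
      by (rule holomorphic_map_lipschitz[OF A N[OF that(1)] r(1) _ that(2,3)]) (use M' N[OF that(1)] in auto)
    \<comment> \<open>Two points of \<open>ball x d\<close> differ by at most \<open>2 d\<close>, so
      each late map varies by at most \<open>e / 3\<close> between them; the last third is the
      convergence at \<open>c\<close>.\<close>
    define d where "d = min r (e / (6 * L))"
    have d: "d > 0" "d \<le> r" "L * (2 * d) \<le> e / 3"
    proof -
      show "d > 0" "d \<le> r" using r e L by (simp_all add: d_def)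
      have "L * (2 * d) \<le> L * (2 * (e / (6 * L)))" using L by (intro mult_left_mono) (auto simp: d_def)
      also have "\<dots> = e / 3" using L by (simp add: field_simps)
      finally show "L * (2 * d) \<le> e / 3" .
    qed
    obtain c where c: "c \<in> S" "c \<in> ball x d" using S(2)[of "ball x d"] d(1) by auto
    obtain l where l: "(\<lambda>n. F0 (s n) c) \<longlonglongrightarrow> l" using s(2)[OF c(1)] by blast
    obtain N' where N': "\<And>m n. m \<ge> N' \<Longrightarrow> n \<ge> N' \<Longrightarrow> dist (F0 (s m) c) (F0 (s n) c) < e / 3"
      using metric_CauchyD[OF LIMSEQ_imp_Cauchy[OF l], of "e/3"] e by auto
    have "dist ((F \<circ> s) m y) ((F \<circ> s) n y) < e" if mn: "m \<ge> max N N'" "n \<ge> max N N'" and y: "y \<in> ball x d" for m n y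
    proof -
      have yr: "y \<in> ball x r" "c \<in> ball x r" using y c d by auto
      have yc: "dist y c \<le> 2 * d" using y c dist_triangle2[of y c x] by (simp add: dist_commute)
      have b: "dist (F (s k) y) (F (s k) c) \<le> e / 3" if "k \<ge> N" for k
        using lip[OF that yr] mult_left_mono[OF yc, of L] L d(3) by linarith
      have cA: "c \<in> A (s k)" if "k \<ge> N" for k using N[OF that] yr r by auto
      have "dist (F (s m) c) (F (s n) c) < e / 3"
        using N'[of m n] mn cA by (simp add: F0_def)
      moreover have "dist (F (s m) y) (F (s m) c) \<le> e / 3" "dist (F (s n) y) (F (s n) c) \<le> e / 3"
        using b mn by auto
      ultimately show ?thesis
        using dist_triangle[of "F (s m) y" "F (s n) y" "F (s m) c"] dist_triangle[of "F (s m) c" "F (s n) y" "F (s n) c"]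
        by (simp add: dist_commute)
    qed
    then show "\<exists>d>0. \<exists>N. \<forall>m\<ge>N. \<forall>n\<ge>N. \<forall>y\<in>ball x d. dist ((F \<circ> s) m y) ((F \<circ> s) n y) < e"
      using d(1) by blast
  qed
  define G where "G x = lim (\<lambda>n. (F \<circ> s) n x)" for x
  have ul: "uniform_limit K (F \<circ> s) G sequentially" if "compact K" "K \<subseteq> D" for K
    using Cauchy_uniformly_convergent[OF cau[OF that]] unfolding uniformly_convergent_uniform_limit_iff G_def .
  have "holomorphic_map_on G D"
    by (rule holomorphic_map_uniform_limit[OF D, of "F \<circ> s" "A \<circ> s"]) (use A exs ul in auto)
  with s(1) ul show ?thesis by blast
qed

section \<open>Convergence of derivatives and of Jacobian determinants\<close>

text \<open>Cauchy's inequality is applied to \<open>f k - g\<close> on balls of radius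
  \<open>r\<close>, which is why the radius drops from \<open>2 r\<close> to
  \<open>r\<close>.\<close>

lemma uniform_limit_dd:
  assumes D: "open D" and A: "\<And>k. slice_hol (f k) (A k)" "\<And>k. open (A k)" and g: "slice_hol g D"
    and ex: "\<And>K. compact K \<Longrightarrow> K \<subseteq> D \<Longrightarrow> \<forall>\<^sub>F k in sequentially. K \<subseteq> A k"
    and ul: "\<And>K. compact K \<Longrightarrow> K \<subseteq> D \<Longrightarrow> uniform_limit K f g sequentially"
    and cb: "cball x (2 * r) \<subseteq> D" and r: "r > 0"
  shows "uniform_limit (cball x r) (\<lambda>k. dd v (f k)) (dd v g) sequentially"
  unfolding uniform_limit_iff
proof safe
  fix e :: real assume e: "e > 0"
  \<comment> \<open>The summand 2 keeps the denominator positive when \<open>v = 0\<close>.\<close>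
  define e' where "e' = e * r / (2 * norm v + 2)"
  have e': "e' > 0" using e r by (simp add: e'_def add_nonneg_pos)
  have "\<forall>\<^sub>F k in sequentially. cball x (2 * r) \<subseteq> A k" by (rule ex[OF compact_cball cb])
  moreover have "\<forall>\<^sub>F k in sequentially. \<forall>z\<in>cball x (2 * r). dist (f k z) (g z) < e'"
    using ul[OF compact_cball cb] e' unfolding uniform_limit_iff by blast
  ultimately show "\<forall>\<^sub>F k in sequentially. \<forall>z\<in>cball x r. dist (dd v (f k) z) (dd v g z) < e"
  proof eventually_elim
    case (elim k)
    show ?case
    proof
      fix z assume z: "z \<in> cball x r"
      have cz: "cball z r \<subseteq> cball x (2 * r)"
      proof
        fix u assume "u \<in> cball z r"
        then show "u \<in> cball x (2 * r)" using z dist_triangle[of x u z] by simp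
      qed
      have zz: "z \<in> cball x (2 * r)" using z r by simp
      let ?h = "\<lambda>w. f k w - g w"
      have sh: "slice_hol ?h (A k \<inter> D)"
        by (intro slice_hol_diff slice_hol_subset[OF A(1)] slice_hol_subset[OF g]) auto
      have "norm (dd v ?h z) \<le> e' * norm v / r"
        by (rule dd_bound[OF sh _ r]) (use elim cz cb in \<open>auto simp: dist_norm less_imp_le\<close>)
      also have "\<dots> = e * (norm v / (2 * norm v + 2))" using r by (simp add: e'_def)
      also have "\<dots> < e * 1"
      proof (rule mult_strict_left_mono[OF _ e])
        have "norm v < 2 * norm v + 2" using norm_ge_zero[of v] by linarith
        moreover have "2 * norm v + 2 > 0" using norm_ge_zero[of v] by linarith
        ultimately show "norm v / (2 * norm v + 2) < 1" by simp
      qed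
      finally have "norm (dd v ?h z) < e" by simp
      moreover have "dd v ?h z = dd v (f k) z - dd v g z"
      proof -
        have 1: "((\<lambda>\<zeta>. f k (z + \<zeta> *s v)) field_differentiable at 0)"
          using slice_holD[OF A(1)[of k], of z v] elim(1) zz A(2)[of k]
          by (intro holomorphic_on_imp_differentiable_at[OF _ open_slice[OF A(2)[of k]]]) auto
        have 2: "((\<lambda>\<zeta>. g (z + \<zeta> *s v)) field_differentiable at 0)"
          using slice_holD[OF g, of z v] zz cb
          by (intro holomorphic_on_imp_differentiable_at[OF _ open_slice[OF D]]) auto
        show ?thesis unfolding dd_def by (rule deriv_diff[OF 1 2])
      qed
      ultimately show "dist (dd v (f k) z) (dd v g z) < e" by (simp add: dist_norm)
    qed
  qed
qed

text \<open>The product rule for uniform limits asks for bounded limit functions, so boundedness is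
  carried along in the induction.\<close>

lemma uniform_limit_prod:
  fixes f :: "'i \<Rightarrow> nat \<Rightarrow> 'b \<Rightarrow> complex"
  assumes "finite I" "\<And>i. i \<in> I \<Longrightarrow> uniform_limit S (f i) (g i) sequentially" "\<And>i. i \<in> I \<Longrightarrow> bounded (g i ` S)"
  shows "uniform_limit S (\<lambda>k x. \<Prod>i\<in>I. f i k x) (\<lambda>x. \<Prod>i\<in>I. g i x) sequentially \<and> bounded ((\<lambda>x. \<Prod>i\<in>I. g i x) ` S)"
  using assms
proof (induction I rule: finite_induct)
  case empty
  show ?case by (auto intro!: uniform_limit_const finite_imp_bounded intro: finite_subset[of _ "{1}"])
next
  case (insert i I)
  then have IH: "uniform_limit S (\<lambda>k x. \<Prod>i\<in>I. f i k x) (\<lambda>x. \<Prod>i\<in>I. g i x) sequentially" "bounded ((\<lambda>x. \<Prod>i\<in>I. g i x) ` S)"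
    by auto
  obtain B C where "\<forall>x\<in>g i ` S. norm x \<le> B" "\<forall>x\<in>(\<lambda>x. \<Prod>i\<in>I. g i x) ` S. norm x \<le> C"
    using insert.prems(2)[of i] IH(2) by (auto simp: bounded_iff)
  then have "norm (g i x * (\<Prod>i\<in>I. g i x)) \<le> B * C" if "x \<in> S" for x
    unfolding norm_mult using that by (intro mult_mono) (auto intro: order_trans[OF norm_ge_zero])
  then have "bounded ((\<lambda>x. g i x * (\<Prod>i\<in>I. g i x)) ` S)" unfolding bounded_iff by blast
  moreover have "uniform_limit S (\<lambda>k x. f i k x * (\<Prod>i\<in>I. f i k x)) (\<lambda>x. g i x * (\<Prod>i\<in>I. g i x)) sequentially"
    by (rule uniform_lim_mult) (use insert.prems IH in auto)
  ultimately show ?case using insert.hyps by simp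
qed

lemma uniform_limit_sum_finite:
  fixes f :: "'i \<Rightarrow> nat \<Rightarrow> 'b \<Rightarrow> complex"
  assumes "\<And>i. i \<in> I \<Longrightarrow> uniform_limit S (f i) (g i) sequentially" "finite I"
  shows "uniform_limit S (\<lambda>k x. \<Sum>i\<in>I. f i k x) (\<lambda>x. \<Sum>i\<in>I. g i x) sequentially"
  using assms(2,1)
  by (induction I rule: finite_induct) (auto intro!: uniform_limit_intros)

lemma uniform_limit_det_jac:
  fixes F :: "nat \<Rightarrow> complex ^ 'n \<Rightarrow> complex ^ 'n"
  assumes D: "open D" and A: "\<And>k. holomorphic_map_on (F k) (A k)" "\<And>k. open (A k)"
    and G: "holomorphic_map_on G D"
    and ex: "\<And>K. compact K \<Longrightarrow> K \<subseteq> D \<Longrightarrow> \<forall>\<^sub>F k in sequentially. K \<subseteq> A k"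
    and ul: "\<And>K. compact K \<Longrightarrow> K \<subseteq> D \<Longrightarrow> uniform_limit K F G sequentially"
    and cb: "cball x (2 * r) \<subseteq> D" and r: "r > 0"
  shows "uniform_limit (cball x r) (\<lambda>k z. det (jac (F k) z)) (\<lambda>z. det (jac G z)) sequentially"
proof -
  have cb1: "cball x r \<subseteq> D" using cb r by (auto simp: subset_iff)
  have e: "uniform_limit (cball x r) (\<lambda>k z. dd v (\<lambda>z. F k z $ i) z) (\<lambda>z. dd v (\<lambda>z. G z $ i) z) sequentially" for v i
    by (rule uniform_limit_dd[OF D holomorphic_map_on_imp_slice_hol[OF A(1)] A(2) holomorphic_map_on_imp_slice_hol[OF G] ex _ cb r])
      (use ul in \<open>auto intro: bounded_linear.uniform_limit[OF bounded_linear_vec_nth]\<close>)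
  have b: "bounded ((\<lambda>z. dd v (\<lambda>z. G z $ i) z) ` cball x r)" for v i
    by (intro compact_imp_bounded compact_continuous_image compact_cball
        continuous_on_subset[OF slice_hol_cont[OF slice_hol_dd[OF holomorphic_map_on_imp_slice_hol[OF G] D]] cb1])
  show ?thesis
    unfolding det_def jac_def vec_lambda_beta
  proof (rule uniform_limit_sum_finite)
    fix p :: "'n \<Rightarrow> 'n"
    let ?P = "\<lambda>k x. \<Prod>i\<in>UNIV. dd (axis (p i) 1) (\<lambda>z. F k z $ i) x"
    have "uniform_limit (cball x r) ?P (\<lambda>x. \<Prod>i\<in>UNIV. dd (axis (p i) 1) (\<lambda>z. G z $ i) x) sequentially"
      by (rule conjunct1[OF uniform_limit_prod]) (use e b in auto)
    then show "uniform_limit (cball x r) (\<lambda>k x. of_int (sign p) * ?P k x) (\<lambda>x. of_int (sign p) * (\<Prod>i\<in>UNIV. dd (axis (p i) 1) (\<lambda>z. G z $ i) x)) sequentially"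
      by (rule bounded_linear.uniform_limit[OF bounded_linear_mult_right])
  qed (simp add: finite_permutations)
qed

section \<open>Injective holomorphic maps and their limits\<close>

text \<open>Sard's theorem is applied in \<open>real ^ 'n bit0\<close>, whose dimension is that of
  the real vector space \<open>complex ^ 'n\<close>, through a linear isometry. A derivative that is
  not injective has deficient real rank, and a negligible set has no interior.\<close>

lemma negligible_image_critical:
  fixes f :: "complex ^ 'n \<Rightarrow> complex ^ 'n"
  assumes der: "\<And>z. z \<in> S \<Longrightarrow> (f has_derivative f' z) (at z)"
    and crit: "\<And>z. z \<in> S \<Longrightarrow> \<not> inj (f' z)"
  shows "interior (f ` S) = {}"
proof -
  have "DIM(real ^ 'n bit0) = DIM(complex ^ 'n)" by simp
  then obtain T :: "real ^ 'n bit0 \<Rightarrow> complex ^ 'n" and R where TR: "linear T" "linear R"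
    "\<And>x. norm (T x) = norm x" "\<And>y. norm (R y) = norm y" "\<And>x. R (T x) = x" "\<And>y. T (R y) = y"
    by (rule isomorphisms_UNIV_UNIV) blast
  have blT: "bounded_linear T" and blR: "bounded_linear R" using TR(1,2) linear_conv_bounded_linear by blast+
  define h where "h = R \<circ> f \<circ> T"
  define h' where "h' x = R \<circ> f' (T x) \<circ> T" for x
  have der_h: "(h has_derivative h' x) (at x within R ` S)" if "x \<in> R ` S" for x
  proof -
    have "T x \<in> S" using that TR by auto
    have "(T has_derivative T) (at x)" using blT by (rule bounded_linear_imp_has_derivative)
    moreover have "(f has_derivative f' (T x)) (at (T x))" using der \<open>T x \<in> S\<close> by blast
    moreover have "(R has_derivative R) (at (f (T x)))" using blR by (rule bounded_linear_imp_has_derivative)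
    ultimately have "(h has_derivative h' x) (at x)" unfolding h_def h'_def
      using diff_chain_at[OF diff_chain_at] by (metis (no_types, lifting) comp_apply o_assoc)
    then show ?thesis by (rule has_derivative_at_withinI)
  qed
  have "negligible (h ` (R ` S))"
  proof (rule baby_Sard[OF _ der_h])
    fix x assume x: "x \<in> R ` S"
    have lin: "linear (h' x)" using der_h[OF x] has_derivative_linear by blast
    have "T x \<in> S" using x TR by auto
    from crit[OF this] obtain a b where ab: "f' (T x) a = f' (T x) b" "a \<noteq> b" by (auto simp: inj_def)
    have "h' x (R a) = h' x (R b)" "R a \<noteq> R b" using ab TR(6) by (simp_all add: h'_def) metis
    then have "\<not> inj (h' x)" by (auto simp: inj_def)
    then have "\<not> inj ((*v) (matrix (h' x)))" using matrix_works[of "h' x"] lin by (simp add: inj_def)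
    then show "rank (matrix (h' x)) < CARD('n bit0)" unfolding less_rank_noninjective .
  qed auto
  moreover have "h ` (R ` S) = R ` f ` S" using TR by (auto simp: h_def image_image)
  ultimately have neg: "negligible (R ` f ` S)" by simp
  show ?thesis
  proof (rule ccontr)
    assume ne: "interior (f ` S) \<noteq> {}"
    have "R ` interior (f ` S) = T -` interior (f ` S)" using TR by (auto simp: image_iff) metis
    then have "open (R ` interior (f ` S))"
      using open_vimage[OF open_interior linear_continuous_on[OF blT]] by metis
    moreover have "negligible (R ` interior (f ` S))"
      by (rule negligible_subset[OF neg]) (use interior_subset in blast)
    ultimately show False using open_not_negligible ne by blast
  qed
qed

lemma det_eq_0_imp_not_inj:
  fixes A :: "complex ^ 'n ^ 'n"
  assumes "det A = 0" shows "\<not> inj ((*v) A)"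
  using assms invertible_det_nz invertible_left_inverse matrix_left_invertible_injective by blast

lemma det_nonzero_left_inverse:
  fixes A :: "complex ^ 'n ^ 'n"
  assumes "det A \<noteq> 0" obtains B where "B ** A = mat 1"
  using assms invertible_det_nz invertible_left_inverse by blast

text \<open>Otherwise Sard's theorem would leave the image of \<open>U\<close> without interior,
  although it is open by invariance of domain.\<close>

lemma injective_imp_det_jac_nonzero_somewhere:
  fixes f :: "complex ^ 'n \<Rightarrow> complex ^ 'n"
  assumes "holomorphic_map_on f U" "open U" "U \<noteq> {}" "inj_on f U"
  shows "\<exists>z\<in>U. det (jac f z) \<noteq> 0"
proof (rule ccontr)
  assume c: "\<not> ?thesis"
  have "interior (f ` U) = {}"
  proof (rule negligible_image_critical)
    fix z assume "z \<in> U"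
    then show "(f has_derivative (*v) (jac f z)) (at z)" by (rule has_derivative_jac[OF assms(1,2)])
    show "\<not> inj ((*v) (jac f z))" using c \<open>z \<in> U\<close> det_eq_0_imp_not_inj by blast
  qed
  moreover have "open (f ` U)"
    by (rule invariance_of_domain[OF holomorphic_map_on_continuous[OF assms(1)] assms(2,4)])
  ultimately show False using assms(3) interior_open by blast
qed

lemma bounded_linear_matrix_vector: "bounded_linear ((*v) (A :: complex ^ 'n ^ 'm))"
proof -
  have "linear ((*v) A)"
    by (rule linearI) (simp_all add: matrix_vector_right_distrib matrix_vector_mult_def vec_eq_iff scaleR_sum_right sum.distrib algebra_simps)
  then show ?thesis by (simp add: linear_conv_bounded_linear)
qed

text \<open>Translating and rescaling the parameter reduces differentiability anywhere on a line to
  differentiability at 0 for a direction of one prescribed length. This is the form in which Rado's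
  theorem, stated on the unit disc, can be applied.\<close>

lemma slice_hol_small:
  fixes f :: "complex ^ 'n \<Rightarrow> complex"
  assumes "continuous_on D f"
    and d: "\<And>w. w \<in> D \<Longrightarrow> \<exists>r>0. \<forall>v. norm v = r \<longrightarrow> (\<lambda>\<zeta>. f (w + \<zeta> *s v)) field_differentiable at 0"
  shows "slice_hol f D"
proof (rule slice_holI[OF assms(1)])
  fix z v
  show "(\<lambda>\<zeta>. f (z + \<zeta> *s v)) holomorphic_on {\<zeta>. z + \<zeta> *s v \<in> D}"
  proof (cases "v = 0")
    case False
    show ?thesis unfolding holomorphic_on_def
    proof safe
      fix \<zeta>0 assume "z + \<zeta>0 *s v \<in> D"
      then obtain r where r: "r > 0" "\<And>u. norm u = r \<Longrightarrow> (\<lambda>\<zeta>. f (z + \<zeta>0 *s v + \<zeta> *s u)) field_differentiable at 0"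
        using d by blast
      define c where "c = complex_of_real (r / norm v)"
      have c: "c \<noteq> 0" using r False by (simp add: c_def)
      have "norm (c *s v) = r" using r False by (simp add: norm_vector_scalar_mult c_def norm_divide)
      from r(2)[OF this] obtain D' where D': "((\<lambda>\<zeta>. f (z + \<zeta>0 *s v + \<zeta> *s (c *s v))) has_field_derivative D') (at ((\<zeta>0 - \<zeta>0) / c))"
        by (auto simp: field_differentiable_def)
      have "((\<lambda>\<zeta>. (\<zeta> - \<zeta>0) / c) has_field_derivative (1 / c)) (at \<zeta>0)"
        by (auto intro!: derivative_eq_intros simp: c)
      from DERIV_chain2[where f = "\<lambda>\<zeta>. f (z + \<zeta>0 *s v + \<zeta> *s (c *s v))" and g = "\<lambda>\<zeta>. (\<zeta> - \<zeta>0) / c", OF D' this]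
      have "((\<lambda>\<zeta>. f (z + \<zeta>0 *s v + ((\<zeta> - \<zeta>0) / c) *s (c *s v))) has_field_derivative D' * (1 / c)) (at \<zeta>0)" .
      moreover have "z + \<zeta>0 *s v + ((\<zeta> - \<zeta>0) / c) *s (c *s v) = z + \<zeta> *s v" for \<zeta> :: complex
      proof -
        have "((\<zeta> - \<zeta>0) / c) * c = \<zeta> - \<zeta>0" using c by simp
        then show ?thesis by (simp only: vector_smult_assoc) (simp add: vec_eq_iff algebra_simps)
      qed
      ultimately have "((\<lambda>\<zeta>. f (z + \<zeta> *s v)) has_field_derivative D' * (1 / c)) (at \<zeta>0)" by (simp only:)
      then show "(\<lambda>\<zeta>. f (z + \<zeta> *s v)) field_differentiable at \<zeta>0 within {\<zeta>. z + \<zeta> *s v \<in> D}"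
        using field_differentiable_at_within field_differentiable_def by blast
    qed
  qed simp
qed

theorem holomorphic_inverse:
  fixes f :: "complex ^ 'n \<Rightarrow> complex ^ 'n"
  assumes f: "holomorphic_map_on f D" and D: "open D" and inj: "inj_on f D"
  shows "open (f ` D)" "holomorphic_map_on (inv_into D f) (f ` D)"
proof -
  define g where "g = inv_into D f"
  define W where "W = f ` D"
  have fc: "continuous_on D f" by (rule holomorphic_map_on_continuous[OF f])
  show oW: "open (f ` D)" by (rule invariance_of_domain[OF fc D inj])
  then have oW: "open W" by (simp add: W_def)
  have gf: "g (f z) = z" if "z \<in> D" for z using inj that by (simp add: g_def)
  have gW: "g w \<in> D" "f (g w) = w" if "w \<in> W" for w using that by (auto simp: W_def gf)
  have gc: "continuous_on W g" unfolding W_def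
    by (rule continuous_on_inverse_open[OF D fc _ gf]) auto
  define h where "h w = det (jac f (g w))" for w
  have hc: "continuous_on W h"
    unfolding h_def by (rule continuous_on_compose2[OF slice_hol_cont[OF slice_hol_det_jac[OF f D]] gc]) (use gW in auto)
  define V where "V = {w \<in> W. h w \<noteq> 0}"
  have "V = W \<inter> h -` (- {0})" by (auto simp: V_def)
  then have oV: "open V" using continuous_open_preimage[OF hc oW] by (simp add: open_Compl)
  have VW: "V \<subseteq> W" by (auto simp: V_def)
  \<comment> \<open>Off the zeros of \<open>h\<close> the continuous inverse is differentiable, with
    the inverse matrix as derivative.\<close>
  have gV: "holomorphic_map_on g V"
    unfolding holomorphic_map_on_def
  proof
    fix w assume w: "w \<in> V"
    then have wW: "w \<in> W" and nz: "det (jac f (g w)) \<noteq> 0" by (auto simp: V_def h_def)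
    obtain B where B: "B ** jac f (g w) = mat 1" using det_nonzero_left_inverse[OF nz] by blast
    have "(g has_derivative (*v) B) (at w)"
    proof (rule has_derivative_inverse_basic[where f = f and g = g, OF has_derivative_jac[OF f D gW(1)[OF wW]] bounded_linear_matrix_vector _ _ oW wW])
      show "(*v) B \<circ> (*v) (jac f (g w)) = id" by (simp add: fun_eq_iff matrix_vector_mul_assoc B)
      show "continuous (at w) g" using gc oW wW continuous_on_eq_continuous_at by blast
    qed (rule gW(2))
    then show "\<exists>f'. (g has_derivative f') (at w) \<and> (\<forall>c v. f' (c *s v) = c *s f' v)"
      by (metis vector_scalar_commute)
  qed
  have hV: "slice_hol h V" unfolding h_def
    by (rule slice_hol_compose[OF gV slice_hol_det_jac[OF f D] D]) (use gW VW in auto)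
  \<comment> \<open>The preimage of a small ball about \<open>w\<close> is open and nonempty, so it
    contains a noncritical point, whose image lies in \<open>V\<close>.\<close>
  have dense: "\<exists>w'\<in>V. dist w' w < e" if w: "w \<in> W" and e: "e > 0" for w e
  proof -
    define U where "U = D \<inter> f -` ball w e"
    have "open U" unfolding U_def by (rule continuous_open_preimage[OF fc D]) simp
    moreover have "g w \<in> U" using gW[OF w] e by (simp add: U_def)
    moreover have "U \<subseteq> D" by (auto simp: U_def)
    ultimately obtain z where z: "z \<in> U" "det (jac f z) \<noteq> 0"
      using injective_imp_det_jac_nonzero_somewhere[of f U] holomorphic_map_on_subset[OF f, of U] inj_on_subset[OF inj, of U]
      by blast
    then have "f z \<in> V" "dist (f z) w < e" by (auto simp: V_def h_def U_def W_def gf dist_commute)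
    then show ?thesis by blast
  qed
  have "slice_hol (\<lambda>z. g z $ i) W" for i
  proof (rule slice_hol_small)
    show "continuous_on W (\<lambda>z. g z $ i)" by (intro continuous_intros gc)
    fix w assume w: "w \<in> W"
    then obtain r0 where "r0 > 0" and r0: "cball w r0 \<subseteq> W" using oW open_contains_cball by blast
    \<comment> \<open>Half the radius: a shift of the base point by less than \<open>r\<close>,
      followed by a parameter in the unit disc along a vector of norm \<open>r\<close>, stays within
      \<open>cball w r0\<close>.\<close>
    define r where "r = r0 / 2"
    have r: "r > 0" "r0 = 2 * r" using \<open>r0 > 0\<close> by (simp_all add: r_def)
    show "\<exists>r>0. \<forall>v. norm v = r \<longrightarrow> (\<lambda>\<zeta>. g (w + \<zeta> *s v) $ i) field_differentiable at 0"
    proof (intro exI[of _ r] conjI allI impI r)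
      fix v :: "complex ^ 'n" assume v: "norm v = r"
      \<comment> \<open>A line through \<open>w\<close> might lie in the zero set of
        \<open>h\<close>, where Rado's theorem says nothing. Parallel lines through points
        \<open>q k\<close> of \<open>V\<close> are used instead, and uniform continuity of
        \<open>g\<close> carries the result to the limit.\<close>
      have "\<forall>k. \<exists>w'\<in>V. dist w' w < min r (inverse (real (Suc k)))"
        by (intro allI dense[OF w]) (use r(1) in simp)
      then obtain q where q: "\<And>k. q k \<in> V" "\<And>k. dist (q k) w < min r (inverse (real (Suc k)))" by metis
      have inW: "y + \<zeta> *s v \<in> cball w r0" if "dist y w < r" "\<zeta> \<in> cball 0 1" for y \<zeta>
      proof -
        have "norm (\<zeta> *s v) \<le> r" using that(2) v r by (simp add: norm_vector_scalar_mult mult_left_le_one_le)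
        then show ?thesis using norm_triangle_ineq[of "y - w" "\<zeta> *s v"] that(1) r(2)
          by (simp add: dist_norm norm_minus_commute algebra_simps)
      qed
      have qW: "q k + \<zeta> *s v \<in> W" if "\<zeta> \<in> cball 0 1" for k \<zeta>
        using inW[of "q k" \<zeta>] q(2)[of k] that r0 by auto
      have line: "continuous_on (cball 0 1) (\<lambda>\<zeta>. q k + \<zeta> *s v)" for k by (intro continuous_intros)
      have hol: "(\<lambda>\<zeta>. g (q k + \<zeta> *s v) $ i) holomorphic_on ball 0 (1/2)" for k
      proof (rule rado[OF _ _ refl, where h = "\<lambda>\<zeta>. h (q k + \<zeta> *s v)"])
        show "continuous_on (cball 0 1) (\<lambda>\<zeta>. h (q k + \<zeta> *s v))"
          by (rule continuous_on_compose2[OF hc line]) (use qW in auto)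
        show "continuous_on (cball 0 1) (\<lambda>\<zeta>. g (q k + \<zeta> *s v) $ i)"
          by (intro continuous_intros continuous_on_compose2[OF gc line]) (use qW in auto)
        show "(\<lambda>\<zeta>. h (q k + \<zeta> *s v)) holomorphic_on {\<zeta> \<in> ball 0 1. h (q k + \<zeta> *s v) \<noteq> 0}"
          by (rule slice_hol_slice[OF hV]) (use qW in \<open>auto simp: V_def\<close>)
        show "(\<lambda>\<zeta>. g (q k + \<zeta> *s v) $ i) holomorphic_on {\<zeta> \<in> ball 0 1. h (q k + \<zeta> *s v) \<noteq> 0}"
          by (rule slice_hol_slice[OF holomorphic_map_on_imp_slice_hol[OF gV]]) (use qW in \<open>auto simp: V_def\<close>)
        have "0 \<in> {\<zeta> \<in> ball 0 1. h (q k + \<zeta> *s v) \<noteq> 0}" using q(1)[of k] by (simp add: V_def)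
        then show "{\<zeta> \<in> ball 0 1. h (q k + \<zeta> *s v) \<noteq> 0} \<noteq> {}" by blast
      qed
      have uc: "uniformly_continuous_on (cball w r0) (\<lambda>z. g z $ i)"
        by (intro compact_uniformly_continuous continuous_intros continuous_on_subset[OF gc r0] compact_cball)
      have ul: "uniform_limit (ball 0 (1/2)) (\<lambda>k \<zeta>. g (q k + \<zeta> *s v) $ i) (\<lambda>\<zeta>. g (w + \<zeta> *s v) $ i) sequentially"
        unfolding uniform_limit_iff
      proof safe
        fix e :: real assume "e > 0"
        then obtain d where d: "d > 0" "\<And>x y. x \<in> cball w r0 \<Longrightarrow> y \<in> cball w r0 \<Longrightarrow> dist x y < d \<Longrightarrow> dist (g x $ i) (g y $ i) < e"
          using uc unfolding uniformly_continuous_on_def by metis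
        obtain N where N: "inverse (real (Suc N)) < d" using reals_Archimedean[OF d(1)] by blast
        show "\<forall>\<^sub>F k in sequentially. \<forall>\<zeta>\<in>ball 0 (1/2). dist (g (q k + \<zeta> *s v) $ i) (g (w + \<zeta> *s v) $ i) < e"
          unfolding eventually_sequentially
        proof (intro exI[of _ N] allI impI ballI d(2))
          fix k and \<zeta> :: complex assume k: "N \<le> k" and "\<zeta> \<in> ball 0 (1/2)"
          then have z: "\<zeta> \<in> cball 0 1" by simp
          show "q k + \<zeta> *s v \<in> cball w r0" using inW z q(2)[of k] by simp
          show "w + \<zeta> *s v \<in> cball w r0" using inW z r by simp
          have "inverse (real (Suc k)) \<le> inverse (real (Suc N))" using k by (intro le_imp_inverse_le) auto
          then have "dist (q k) w < d" using q(2)[of k] N by linarith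
          then show "dist (q k + \<zeta> *s v) (w + \<zeta> *s v) < d" by simp
        qed
      qed
      have "(\<lambda>\<zeta>. g (w + \<zeta> *s v) $ i) holomorphic_on ball 0 (1/2)"
      proof (rule holomorphic_uniform_sequence[OF _ hol])
        fix x :: complex assume "x \<in> ball 0 (1/2)"
        then obtain d where "d > 0" "cball x d \<subseteq> ball 0 (1/2)" using open_ball open_contains_cball by blast
        then show "\<exists>d>0. cball x d \<subseteq> ball 0 (1/2) \<and> uniform_limit (cball x d) (\<lambda>k \<zeta>. g (q k + \<zeta> *s v) $ i) (\<lambda>\<zeta>. g (w + \<zeta> *s v) $ i) sequentially"
          using uniform_limit_on_subset[OF ul] by blast
      qed simp
      then show "(\<lambda>\<zeta>. g (w + \<zeta> *s v) $ i) field_differentiable at 0"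
        by (rule holomorphic_on_imp_differentiable_at) auto
    qed
  qed
  then have "holomorphic_map_on g W" unfolding holomorphic_map_on_iff_slice_hol[OF oW] by blast
  then show "holomorphic_map_on (inv_into D f) (f ` D)" by (simp add: g_def W_def)
qed

text \<open>Besides excluding zeros of the Jacobian determinant of an injective holomorphic map, the
  product form survives passage to limits.\<close>

lemma det_jac_inverse:
  fixes f :: "complex ^ 'n \<Rightarrow> complex ^ 'n"
  assumes f: "holomorphic_map_on f D" and D: "open D" and inj: "inj_on f D" and z: "z \<in> D"
  shows "det (jac (inv_into D f) (f z)) * det (jac f z) = 1"
proof -
  have "jac (inv_into D f) (f z) ** jac f z = mat 1"
    by (rule jac_chain[OF f D holomorphic_inverse(2,1)[OF f D inj] z]) (use z inj in auto)
  then have "det (jac (inv_into D f) (f z) ** jac f z) = 1" by simp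
  then show ?thesis by (simp add: det_mul)
qed

section \<open>Nondegenerate limits of injective maps\<close>

text \<open>A connected ball that meets the open image without being contained in it meets its
  frontier, and the frontier lies in the image of the sphere, which is kept at distance
  \<open>\<delta>\<close> from \<open>y\<close>. This takes the place of a degree argument.\<close>

lemma ball_subset_image:
  fixes \<phi> :: "'a::euclidean_space \<Rightarrow> 'b::euclidean_space"
  assumes c: "continuous_on (cball w r) \<phi>" and op: "open (\<phi> ` ball w r)" and r: "r > 0"
    and sph: "\<And>x. x \<in> sphere w r \<Longrightarrow> \<delta> \<le> dist (\<phi> x) y" and w: "dist (\<phi> w) y < \<delta>"
  shows "ball y \<delta> \<subseteq> \<phi> ` ball w r"
proof (rule ccontr)
  assume "\<not> ball y \<delta> \<subseteq> \<phi> ` ball w r"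
  then have "ball y \<delta> - \<phi> ` ball w r \<noteq> {}" by blast
  moreover have "ball y \<delta> \<inter> \<phi> ` ball w r \<noteq> {}" using w r by (auto simp: dist_commute)
  ultimately have "ball y \<delta> \<inter> frontier (\<phi> ` ball w r) \<noteq> {}" by (intro connected_Int_frontier) auto
  then obtain u where u: "u \<in> ball y \<delta>" "u \<in> frontier (\<phi> ` ball w r)" by blast
  have "closure (\<phi> ` ball w r) \<subseteq> \<phi> ` cball w r"
    by (rule closure_minimal[OF image_mono[OF ball_subset_cball] compact_imp_closed[OF compact_continuous_image[OF c compact_cball]]])
  then obtain x where x: "x \<in> cball w r" "u = \<phi> x" using u(2) by (auto simp: frontier_def)
  have "u \<notin> \<phi> ` ball w r" using u(2) op by (simp add: frontier_def interior_open)
  then have "x \<in> sphere w r" using x by (metis imageI mem_ball mem_cball mem_sphere order_le_less)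
  from sph[OF this] show False using u(1) x(2) by (simp add: dist_commute)
qed

lemma uniform_limit_compose_tendsto:
  fixes f :: "nat \<Rightarrow> 'a::metric_space \<Rightarrow> 'b::metric_space"
  assumes ul: "uniform_limit (cball y r) f g sequentially" and r: "r > 0"
    and g: "isCont g y" and lim: "x \<longlonglongrightarrow> y"
  shows "(\<lambda>k. f k (x k)) \<longlonglongrightarrow> g y"
  unfolding tendsto_iff
proof safe
  fix e :: real assume e: "e > 0"
  have "(\<lambda>k. g (x k)) \<longlonglongrightarrow> g y" by (rule isCont_tendsto_compose[OF g lim])
  then have "\<forall>\<^sub>F k in sequentially. dist (g (x k)) (g y) < e / 2" by (rule tendstoD) (use e in simp)
  moreover have "\<forall>\<^sub>F k in sequentially. dist (x k) y < r" using lim r by (simp add: tendsto_iff)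
  moreover have "\<forall>\<^sub>F k in sequentially. \<forall>z\<in>cball y r. dist (f k z) (g z) < e / 2"
    using ul e unfolding uniform_limit_iff by (meson half_gt_zero)
  ultimately show "\<forall>\<^sub>F k in sequentially. dist (f k (x k)) (g y) < e"
  proof eventually_elim
    case (elim k)
    then have "dist (f k (x k)) (g (x k)) < e / 2" by (auto simp: dist_commute)
    then show ?case using elim(1) dist_triangle_half_l[of "f k (x k)" "g (x k)" e "g y"]
      by (metis dist_commute dist_triangle_half_l)
  qed
qed

text \<open>A left inverse of norm at most \<open>K\<close> gives \<open>|A v| >= |v| / K\<close>,
  which for \<open>v\<close> nonzero beats an error of at most \<open>|v| / (2 K)\<close> in the
  linear approximation.\<close>

lemma det_jac_nonzero_imp_isolated_value:
  fixes f :: "complex ^ 'n \<Rightarrow> complex ^ 'n"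
  assumes f: "(f has_derivative (*v) A) (at w)" and A: "det A \<noteq> 0"
  shows "\<exists>d>0. \<forall>x. 0 < dist x w \<and> dist x w < d \<longrightarrow> f x \<noteq> f w"
proof -
  obtain B where B: "B ** A = mat 1" using det_nonzero_left_inverse[OF A] by blast
  obtain K where K: "K > 0" "\<And>x. norm (B *v x) \<le> norm x * K"
    using bounded_linear.pos_bounded[OF bounded_linear_matrix_vector[of B]] by blast
  have low: "norm v \<le> norm (A *v v) * K" for v
    using K(2)[of "A *v v"] by (simp add: matrix_vector_mul_assoc B)
  have "\<exists>d>0. \<forall>y. norm (y - w) < d \<longrightarrow> norm (f y - f w - A *v (y - w)) \<le> (1 / (2 * K)) * norm (y - w)"
  proof -
    have "\<forall>e>0. \<exists>d>0. \<forall>y. norm (y - w) < d \<longrightarrow> norm (f y - f w - A *v (y - w)) \<le> e * norm (y - w)"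
      using f unfolding has_derivative_at_alt by blast
    then show ?thesis by (elim allE[of _ "1 / (2 * K)"] impE) (use K(1) in simp_all)
  qed
  then obtain d where d: "d > 0" "\<And>y. norm (y - w) < d \<Longrightarrow> norm (f y - f w - A *v (y - w)) \<le> (1 / (2 * K)) * norm (y - w)"
    by blast
  have "f x \<noteq> f w" if x: "0 < dist x w" "dist x w < d" for x
  proof
    assume "f x = f w"
    then have "norm (A *v (x - w)) \<le> (1 / (2 * K)) * norm (x - w)"
      using d(2)[of x] x by (simp add: dist_norm)
    then have "norm (A *v (x - w)) * K \<le> ((1 / (2 * K)) * norm (x - w)) * K"
      using K(1) by (intro mult_right_mono) auto
    moreover have "((1 / (2 * K)) * norm (x - w)) * K = norm (x - w) / 2" using K(1) by simp
    ultimately have "norm (x - w) \<le> norm (x - w) / 2" using low[of "x - w"] by linarith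
    then show False using x by (simp add: dist_norm)
  qed
  then show ?thesis using d(1) by blast
qed

text \<open>By Hurwitz' theorem on complex lines, the Jacobian determinant of a limit of injective maps vanishes
  identically once it vanishes somewhere; where it does not vanish, the image of a small sphere stays away from
  the image of its centre, so that the open image of the ball under a late member of the sequence contains it.\<close>

lemma injective_limit_image_subset:
  fixes F :: "nat \<Rightarrow> complex ^ 'n \<Rightarrow> complex ^ 'n"
  assumes D: "open D" "connected D" and A: "\<And>k. holomorphic_map_on (F k) (A k)" "\<And>k. open (A k)"
    and inj: "\<And>k. inj_on (F k) (A k)" and im: "\<And>k. F k ` A k \<subseteq> W"
    and G: "holomorphic_map_on G D"
    and ex: "\<And>K. compact K \<Longrightarrow> K \<subseteq> D \<Longrightarrow> \<forall>\<^sub>F k in sequentially. K \<subseteq> A k"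
    and ul: "\<And>K. compact K \<Longrightarrow> K \<subseteq> D \<Longrightarrow> uniform_limit K F G sequentially"
    and p: "p \<in> D" "det (jac G p) \<noteq> 0"
  shows "G ` D \<subseteq> W"
proof -
  let ?Z = "{z \<in> D. det (jac G z) = 0}"
  have Jc: "continuous_on D (\<lambda>z. det (jac G z))" by (rule slice_hol_cont[OF slice_hol_det_jac[OF G D(1)]])
  have "openin (top_of_set D) ?Z"
  proof (subst openin_open_eq[OF D(1)], intro conjI)
    show "open ?Z" unfolding open_contains_ball
    proof
      fix z assume z: "z \<in> ?Z"
      then obtain r0 where "r0 > 0" and r0: "cball z r0 \<subseteq> D" using D open_contains_cball by blast
      define r where "r = r0 / 2"
      have r: "r > 0" "r0 = 2 * r" using \<open>r0 > 0\<close> by (simp_all add: r_def)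
      have cb: "cball z (2 * r) \<subseteq> D" "cball z r \<subseteq> D" using r0 r by auto
      have ulJ: "uniform_limit (cball z r) (\<lambda>k z. det (jac (F k) z)) (\<lambda>z. det (jac G z)) sequentially"
        by (rule uniform_limit_det_jac[OF D(1) A G ex ul cb(1) r(1)])
      obtain N where N: "\<And>k. k \<ge> N \<Longrightarrow> cball z r \<subseteq> A k"
        using ex[OF compact_cball cb(2)] by (auto simp: eventually_sequentially)
      have "w \<in> ?Z" if w: "w \<in> ball z r" for w
      proof (cases "w = z")
        case False
        define v where "v = w - z"
        have v: "v \<noteq> 0" "norm v < r" using False w by (auto simp: v_def dist_norm norm_minus_commute)
        \<comment> \<open>The radius exceeds 1, so both \<open>z\<close> and \<open>w\<close> lie on
          the slice, at the parameters 0 and 1.\<close>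
        let ?S = "ball (0::complex) (r / norm v)"
        have inS: "z + \<zeta> *s v \<in> cball z r" if "\<zeta> \<in> ?S" for \<zeta>
          by (rule slice_in_cball[OF subset_refl v(1)]) (use that in auto)
        have const: "(\<lambda>\<zeta>. det (jac G (z + \<zeta> *s v))) constant_on ?S"
        proof (rule ccontr)
          assume nc: "\<not> (\<lambda>\<zeta>. det (jac G (z + \<zeta> *s v))) constant_on ?S"
          have "det (jac G (z + 0 *s v)) \<noteq> 0"
          proof (rule Hurwitz_no_zeros[where \<F> = "\<lambda>k \<zeta>. det (jac (F (k + N)) (z + \<zeta> *s v))", OF _ _ _ _ _ nc])
            show "(\<lambda>\<zeta>. det (jac (F (k + N)) (z + \<zeta> *s v))) holomorphic_on ?S" for k
              by (rule slice_hol_slice[OF slice_hol_det_jac[OF A]]) (use inS N[of "k + N"] in auto)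
            show "(\<lambda>\<zeta>. det (jac G (z + \<zeta> *s v))) holomorphic_on ?S"
              by (rule slice_hol_slice[OF slice_hol_det_jac[OF G D(1)]]) (use inS cb in auto)
            fix K assume K: "compact K" "K \<subseteq> ?S"
            show "uniform_limit K (\<lambda>k \<zeta>. det (jac (F (k + N)) (z + \<zeta> *s v))) (\<lambda>\<zeta>. det (jac G (z + \<zeta> *s v))) sequentially"
              unfolding uniform_limit_iff
            proof safe
              fix e :: real assume "e > 0"
              then obtain M where M: "\<And>k x. k \<ge> M \<Longrightarrow> x \<in> cball z r \<Longrightarrow> dist (det (jac (F k) x)) (det (jac G x)) < e"
                using ulJ unfolding uniform_limit_iff eventually_sequentially by metis
              show "\<forall>\<^sub>F k in sequentially. \<forall>\<zeta>\<in>K. dist (det (jac (F (k + N)) (z + \<zeta> *s v))) (det (jac G (z + \<zeta> *s v))) < e"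
                unfolding eventually_sequentially by (rule exI[of _ M]) (use M inS K(2) in auto)
            qed
          next
            fix k \<zeta> assume "\<zeta> \<in> ?S"
            then have "z + \<zeta> *s v \<in> A (k + N)" using inS N[of "k + N"] by auto
            from det_jac_inverse[OF A inj this] show "det (jac (F (k + N)) (z + \<zeta> *s v)) \<noteq> 0" by auto
          next
            show "0 \<in> ?S" using v r by simp
          qed auto
          then show False using z by simp
        qed
        have "0 \<in> ?S" "1 \<in> ?S" using v r by simp_all
        with const have "det (jac G (z + 1 *s v)) = det (jac G (z + 0 *s v))" unfolding constant_on_def by metis
        then show ?thesis using z w cb r by (auto simp: v_def subset_iff)
      qed (use z in simp)
      then show "\<exists>e>0. ball z e \<subseteq> ?Z" using r(1) by blast
    qed
  qed auto
  moreover have "closedin (top_of_set D) ?Z"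
    using continuous_closedin_preimage_constant[OF Jc, of 0] by simp
  ultimately have "?Z = {} \<or> ?Z = D" using D(2) connected_clopen by blast
  then have nz: "det (jac G z) \<noteq> 0" if "z \<in> D" for z using p that by blast
  show ?thesis
  proof
    fix y assume "y \<in> G ` D"
    then obtain w where w: "w \<in> D" "y = G w" by blast
    obtain d where d: "d > 0" "\<And>x. 0 < dist x w \<Longrightarrow> dist x w < d \<Longrightarrow> G x \<noteq> G w"
      using det_jac_nonzero_imp_isolated_value[OF has_derivative_jac[OF G D(1) w(1)] nz[OF w(1)]] by blast
    obtain r0 where r0: "r0 > 0" "cball w r0 \<subseteq> D" using D w open_contains_cball by blast
    \<comment> \<open>\<open>r < d\<close>, so \<open>G\<close> omits the value \<open>y\<close> on
      the sphere of radius \<open>r\<close>, and its distance to \<open>y\<close> has a positive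
      minimum there.\<close>
    define r where "r = min r0 (d / 2)"
    have r: "r > 0" "cball w r \<subseteq> D" "r < d" using r0 d(1) by (auto simp: r_def subset_iff)
    have Gc: "continuous_on (cball w r) G"
      using continuous_on_subset[OF holomorphic_map_on_continuous[OF G] r(2)] .
    have "sphere w r \<noteq> {}" using r(1) by simp
    moreover have "continuous_on (sphere w r) (\<lambda>x. dist (G x) y)"
      by (intro continuous_intros continuous_on_subset[OF Gc]) auto
    ultimately obtain x0 where x0: "x0 \<in> sphere w r" "\<And>x. x \<in> sphere w r \<Longrightarrow> dist (G x0) y \<le> dist (G x) y"
      using continuous_attains_inf[OF compact_sphere] by metis
    define c where "c = dist (G x0) y"
    have "G x0 \<noteq> G w" by (rule d(2)) (use x0(1) r in \<open>auto simp: dist_commute\<close>)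
    then have c: "c > 0" using w by (simp add: c_def)
    \<comment> \<open>An approximation within \<open>c / 2\<close> leaves the image of the sphere at
      distance at least \<open>c / 2\<close> from \<open>y\<close> and the image of the centre
      closer than that.\<close>
    have "\<forall>\<^sub>F k in sequentially. \<forall>x\<in>cball w r. dist (F k x) (G x) < c / 2"
      using ul[OF compact_cball r(2)] c unfolding uniform_limit_iff by (meson half_gt_zero)
    moreover have "\<forall>\<^sub>F k in sequentially. cball w r \<subseteq> A k" by (rule ex[OF compact_cball r(2)])
    ultimately have "\<forall>\<^sub>F k in sequentially. (\<forall>x\<in>cball w r. dist (F k x) (G x) < c / 2) \<and> cball w r \<subseteq> A k"
      by (rule eventually_conj)
    from eventually_happens'[OF sequentially_bot this]
    obtain k where k: "\<And>x. x \<in> cball w r \<Longrightarrow> dist (F k x) (G x) < c / 2" "cball w r \<subseteq> A k"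
      by blast
    have "ball y (c / 2) \<subseteq> F k ` ball w r"
    proof (rule ball_subset_image)
      show "continuous_on (cball w r) (F k)"
        by (rule continuous_on_subset[OF holomorphic_map_on_continuous[OF A(1)] k(2)])
      then have "continuous_on (ball w r) (F k)" by (rule continuous_on_subset) auto
      then show "open (F k ` ball w r)"
        by (rule invariance_of_domain[OF _ open_ball inj_on_subset[OF inj subset_trans[OF ball_subset_cball k(2)]]])
      fix x assume x: "x \<in> sphere w r"
      then have "dist (F k x) (G x) < c / 2" by (intro k(1)) auto
      moreover have "c \<le> dist (G x) y" using x0(2)[OF x] by (simp add: c_def)
      ultimately show "c / 2 \<le> dist (F k x) y"
        using dist_triangle[of "G x" y "F k x"] by (simp add: dist_commute)
    next
      show "dist (F k w) y < c / 2" using k(1)[of w] r(1) w(2) by simp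
    qed (rule r(1))
    then have "y \<in> F k ` ball w r" using c by auto
    then show "y \<in> W" using im[of k] k(2) ball_subset_cball[of w r] by blast
  qed
qed

text \<open>The inverses \<open>H k\<close> take values in the bounded set \<open>\<Omega>\<close>
  on domains exhausting \<open>W\<close>, so Montel's theorem applies on both sides. As
  \<open>q\<close> is interior to \<open>W\<close>, the relations between \<open>F k\<close> and
  \<open>H k\<close> can be evaluated in the limit at the moving points
  \<open>F k p\<close>.\<close>

theorem biholomorphic_limit:
  fixes \<Omega> W :: "(complex ^ 'n) set" and F :: "nat \<Rightarrow> complex ^ 'n \<Rightarrow> complex ^ 'n"
  assumes \<Omega>: "complex_domain \<Omega>" "bounded \<Omega>" and W: "complex_domain W" "bounded W"
    and F: "\<And>k. holomorphic_map_on (F k) (A k)" and A: "\<And>k. open (A k)" "\<And>k. A k \<subseteq> \<Omega>"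
    and inj: "\<And>k. inj_on (F k) (A k)" and im: "\<And>k. F k ` A k \<subseteq> W"
    and ex\<Omega>: "\<And>K. compact K \<Longrightarrow> K \<subseteq> \<Omega> \<Longrightarrow> \<forall>\<^sub>F k in sequentially. K \<subseteq> A k"
    and exW: "\<And>K. compact K \<Longrightarrow> K \<subseteq> W \<Longrightarrow> \<forall>\<^sub>F k in sequentially. K \<subseteq> F k ` A k"
    and p: "p \<in> \<Omega>" and lim: "(\<lambda>k. F k p) \<longlonglongrightarrow> q" and q: "q \<in> W"
  shows "biholomorphic \<Omega> W"
proof -
  have o\<Omega>: "open \<Omega>" "connected \<Omega>" and oW: "open W" "connected W" using \<Omega> W by (auto simp: complex_domain_def)
  obtain M1 where M1: "\<And>z. z \<in> W \<Longrightarrow> norm z \<le> M1" using W(2) by (auto simp: bounded_iff)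
  obtain M2 where M2: "\<And>z. z \<in> \<Omega> \<Longrightarrow> norm z \<le> M2" using \<Omega>(2) by (auto simp: bounded_iff)
  define B where "B k = F k ` A k" for k
  define H where "H k = inv_into (A k) (F k)" for k
  have HB: "holomorphic_map_on (H k) (B k)" "open (B k)" for k
    using holomorphic_inverse[OF F A(1) inj] by (auto simp: H_def B_def)
  have HF: "H k (F k z) = z" if "z \<in> A k" for k z using that inj by (simp add: H_def)
  have FH: "F k (H k w) = w" "H k w \<in> A k" if "w \<in> B k" for k w using that by (auto simp: B_def HF)
  have "\<exists>s G. strict_mono (s :: nat \<Rightarrow> nat) \<and> holomorphic_map_on G \<Omega> \<and>
    (\<forall>K. compact K \<longrightarrow> K \<subseteq> \<Omega> \<longrightarrow> uniform_limit K (F \<circ> s) G sequentially)"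
    by (rule holomorphic_map_Montel[OF o\<Omega>(1) F A(1) ex\<Omega>, of M1]) (use M1 im in auto)
  then obtain s G where s: "strict_mono (s :: nat \<Rightarrow> nat)" and G: "holomorphic_map_on G \<Omega>"
    and ulG: "\<And>K. compact K \<Longrightarrow> K \<subseteq> \<Omega> \<Longrightarrow> uniform_limit K (F \<circ> s) G sequentially"
    by blast
  have exW': "\<forall>\<^sub>F k in sequentially. K \<subseteq> B (s k)" if "compact K" "K \<subseteq> W" for K
    using eventually_subseq[OF s exW[OF that]] by (simp add: B_def)
  have "\<exists>t E. strict_mono (t :: nat \<Rightarrow> nat) \<and> holomorphic_map_on E W \<and>
    (\<forall>K. compact K \<longrightarrow> K \<subseteq> W \<longrightarrow> uniform_limit K ((H \<circ> s) \<circ> t) E sequentially)"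
  proof (rule holomorphic_map_Montel[OF oW(1), of _ "B \<circ> s" M2])
    fix k z assume "z \<in> (B \<circ> s) k"
    then have "H (s k) z \<in> \<Omega>" using FH(2)[of z "s k"] A(2)[of "s k"] by auto
    then show "norm ((H \<circ> s) k z) \<le> M2" using M2 by simp
  qed (use HB exW' in auto)
  then obtain t E where t: "strict_mono (t :: nat \<Rightarrow> nat)" and E: "holomorphic_map_on E W"
    and ulE: "\<And>K. compact K \<Longrightarrow> K \<subseteq> W \<Longrightarrow> uniform_limit K ((H \<circ> s) \<circ> t) E sequentially" by blast
  define u where "u = s \<circ> t"
  have u: "strict_mono u" using s t by (simp add: u_def strict_mono_o)
  have ulG: "uniform_limit K (\<lambda>k. F (u k)) G sequentially" if "compact K" "K \<subseteq> \<Omega>" for K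
    using filterlim_compose[OF ulG[OF that] filterlim_subseq[OF t]] by (simp add: o_def u_def)
  have ulE: "uniform_limit K (\<lambda>k. H (u k)) E sequentially" if "compact K" "K \<subseteq> W" for K
    using ulE[OF that] by (simp add: o_def u_def)
  have exA: "\<forall>\<^sub>F k in sequentially. K \<subseteq> A (u k)" if "compact K" "K \<subseteq> \<Omega>" for K
    using eventually_subseq[OF u ex\<Omega>[OF that]] .
  have exB: "\<forall>\<^sub>F k in sequentially. K \<subseteq> B (u k)" if "compact K" "K \<subseteq> W" for K
    using eventually_subseq[OF u exW[OF that]] by (simp add: B_def)
  have lim: "(\<lambda>k. F (u k) p) \<longlonglongrightarrow> q" using LIMSEQ_subseq_LIMSEQ[OF lim u] by (simp add: o_def)
  \<comment> \<open>Convergence at moving arguments is needed because \<open>H (u k)\<close> is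
    evaluated at \<open>F (u k) z\<close>, and conversely.\<close>
  have comp_tendsto: "(\<lambda>k. f k (x k)) \<longlonglongrightarrow> g y"
    if X: "open X" "\<And>K. compact K \<Longrightarrow> K \<subseteq> X \<Longrightarrow> uniform_limit K f g sequentially" "continuous_on X g" "y \<in> X" "x \<longlonglongrightarrow> y"
    for f :: "nat \<Rightarrow> complex ^ 'n \<Rightarrow> complex ^ 'n" and g x y X
  proof -
    obtain r where r: "r > 0" "cball y r \<subseteq> X" using X(1,4) open_contains_cball by blast
    have "isCont g y" using X continuous_on_eq_continuous_at by blast
    then show ?thesis using uniform_limit_compose_tendsto[OF X(2)[OF compact_cball r(2)] r(1) _ X(5)] by blast
  qed
  have comp_det: "(\<lambda>k. det (jac (f k) (x k))) \<longlonglongrightarrow> det (jac g y)"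
    if X: "open X" "\<And>K. compact K \<Longrightarrow> K \<subseteq> X \<Longrightarrow> uniform_limit K f g sequentially" "holomorphic_map_on g X" "y \<in> X" "x \<longlonglongrightarrow> y"
      and C: "\<And>k. holomorphic_map_on (f k) (C k)" "\<And>k. open (C k)" "\<And>K. compact K \<Longrightarrow> K \<subseteq> X \<Longrightarrow> \<forall>\<^sub>F k in sequentially. K \<subseteq> C k"
    for f :: "nat \<Rightarrow> complex ^ 'n \<Rightarrow> complex ^ 'n" and g x y X C
  proof -
    obtain r0 where r0: "r0 > 0" "cball y r0 \<subseteq> X" using X(1,4) open_contains_cball by blast
    have cb: "cball y (2 * (r0 / 2)) \<subseteq> X" using r0 by simp
    have "uniform_limit (cball y (r0/2)) (\<lambda>k z. det (jac (f k) z)) (\<lambda>z. det (jac g z)) sequentially"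
      by (rule uniform_limit_det_jac[OF X(1) C(1,2) X(3) C(3) X(2) cb]) (use r0 in auto)
    moreover have "isCont (\<lambda>z. det (jac g z)) y"
      using slice_hol_cont[OF slice_hol_det_jac[OF X(3,1)]] X(1,4) continuous_on_eq_continuous_at by blast
    ultimately show ?thesis by (intro uniform_limit_compose_tendsto[where y = y and r = "r0/2" and g = "\<lambda>z. det (jac g z)"]) (use r0(1) X(5) in auto)
  qed
  have Gc: "continuous_on \<Omega> G" and Ec: "continuous_on W E"
    using G E holomorphic_map_on_continuous by blast+
  have pA: "\<forall>\<^sub>F k in sequentially. p \<in> A (u k)" using exA[of "{p}"] p by simp
  have Gp: "G p = q"
    by (rule LIMSEQ_unique[OF comp_tendsto[OF o\<Omega>(1) ulG Gc p tendsto_const] lim])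
  \<comment> \<open>The product equals 1 for every late \<open>k\<close>, so neither limit
    degenerates at its base point, and both images stay inside the open domains.\<close>
  have "(\<lambda>k. det (jac (H (u k)) (F (u k) p)) * det (jac (F (u k)) p)) \<longlonglongrightarrow> det (jac E q) * det (jac G p)"
    by (intro tendsto_mult comp_det[OF oW(1) ulE E q lim HB exB] comp_det[OF o\<Omega>(1) ulG G p tendsto_const F A(1) exA])
  moreover have "\<forall>\<^sub>F k in sequentially. det (jac (H (u k)) (F (u k) p)) * det (jac (F (u k)) p) = 1"
    using pA by eventually_elim (auto simp: H_def intro: det_jac_inverse[OF F A(1) inj])
  ultimately have "det (jac E q) * det (jac G p) = 1"
    by (rule LIMSEQ_unique[OF _ tendsto_eventually])
  then have nz: "det (jac E q) \<noteq> 0" "det (jac G p) \<noteq> 0" by auto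
  have GW: "G ` \<Omega> \<subseteq> W"
    by (rule injective_limit_image_subset[OF o\<Omega> F A(1) inj im G exA ulG p nz(2)])
  have injH: "inj_on (H k) (B k)" for k by (metis FH(1) inj_onI)
  have imH: "H k ` B k \<subseteq> \<Omega>" for k using FH(2) A(2) by blast
  have EW: "E ` W \<subseteq> \<Omega>"
    by (rule injective_limit_image_subset[OF oW HB injH imH E exB ulE q nz(1)])
  have EG: "E (G z) = z" if z: "z \<in> \<Omega>" for z
  proof -
    have l: "(\<lambda>k. F (u k) z) \<longlonglongrightarrow> G z" by (rule comp_tendsto[OF o\<Omega>(1) ulG Gc z tendsto_const])
    have "(\<lambda>k. H (u k) (F (u k) z)) \<longlonglongrightarrow> E (G z)"
      by (rule comp_tendsto[OF oW(1) ulE Ec _ l]) (use GW z in auto)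
    moreover have "\<forall>\<^sub>F k in sequentially. z \<in> A (u k)" using exA[of "{z}"] z by simp
    then have "\<forall>\<^sub>F k in sequentially. H (u k) (F (u k) z) = z" by eventually_elim (rule HF)
    ultimately show ?thesis by (rule LIMSEQ_unique[OF _ tendsto_eventually])
  qed
  have GE: "G (E z) = z" if z: "z \<in> W" for z
  proof -
    have l: "(\<lambda>k. H (u k) z) \<longlonglongrightarrow> E z" by (rule comp_tendsto[OF oW(1) ulE Ec z tendsto_const])
    have "(\<lambda>k. F (u k) (H (u k) z)) \<longlonglongrightarrow> G (E z)"
      by (rule comp_tendsto[OF o\<Omega>(1) ulG Gc _ l]) (use EW z in auto)
    moreover have "\<forall>\<^sub>F k in sequentially. z \<in> B (u k)" using exB[of "{z}"] z by simp
    then have "\<forall>\<^sub>F k in sequentially. F (u k) (H (u k) z) = z" by eventually_elim (rule FH(1))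
    ultimately show ?thesis by (rule LIMSEQ_unique[OF _ tendsto_eventually])
  qed
  show ?thesis unfolding biholomorphic_def using G E GW EW EG GE by blast
qed

section \<open>Geometry near a strictly pseudoconvex boundary point\<close>

definition hip :: "complex ^ 'n \<Rightarrow> complex ^ 'n \<Rightarrow> complex" where
  "hip x y = (\<Sum>i\<in>UNIV. x $ i * cnj (y $ i))"

lemma hip_add_left: "hip (x + y) z = hip x z + hip y z"
  by (simp add: hip_def algebra_simps sum.distrib)

lemma hip_diff_left: "hip (x - y) z = hip x z - hip y z"
  by (simp add: hip_def algebra_simps sum_subtractf)

lemma hip_scale_left: "hip (c *s x) y = c * hip x y"
  by (simp add: hip_def sum_distrib_left algebra_simps)

lemma hip_scale_right: "hip x (c *s y) = cnj c * hip x y"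
  by (simp add: hip_def sum_distrib_left algebra_simps)

lemma hip_zero [simp]: "hip 0 y = 0" "hip x 0 = 0"
  by (simp_all add: hip_def)

lemma inner_eq_Re_hip: "inner x y = Re (hip x y)"
  by (simp add: hip_def inner_vec_def inner_complex_def)

lemma hip_self: "hip x x = of_real ((norm x)\<^sup>2)"
  by (simp add: hip_def norm_vec_def L2_set_def sum_nonneg complex_norm_square flip: complex_norm_square)

lemma norm_hip_le: "norm (hip x y) \<le> norm x * norm y"
proof -
  have "norm (hip x y) \<le> (\<Sum>i\<in>UNIV. \<bar>norm (x $ i)\<bar> * \<bar>norm (y $ i)\<bar>)"
    unfolding hip_def by (rule order_trans[OF norm_sum]) (simp add: norm_mult)
  also have "\<dots> \<le> norm x * norm y"
    unfolding norm_vec_def by (rule L2_set_mult_ineq)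
  finally show ?thesis .
qed

lemma norm_add_scale_square:
  "(norm (x + c *s y))\<^sup>2 = (norm x)\<^sup>2 + 2 * Re (cnj c * hip x y) + (cmod c)\<^sup>2 * (norm y)\<^sup>2"
proof -
  have "(norm (x + c *s y))\<^sup>2 = (norm x)\<^sup>2 + 2 * inner x (c *s y) + (norm (c *s y))\<^sup>2"
    unfolding power2_norm_eq_inner by (simp add: inner_add_left inner_add_right inner_commute)
  then show ?thesis by (simp add: inner_eq_Re_hip hip_scale_right norm_vector_scalar_mult power_mult_distrib)
qed

lemma slice_hol_nth: "slice_hol (\<lambda>z. z $ i) D"
  by (rule complex_frechet_imp_slice_hol, rule exI[of _ "\<lambda>z. z $ i"])
    (simp add: bounded_linear_imp_has_derivative[OF bounded_linear_vec_nth])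

lemma slice_hol_hip:
  assumes "\<And>i. slice_hol (\<lambda>z. f z $ i) D" shows "slice_hol (\<lambda>z. hip (f z) n) D"
  unfolding hip_def by (intro slice_hol_sum slice_hol_mult slice_hol_const assms)

section \<open>Stretches along a normal and projective maps of a ball\<close>

text \<open>For nonzero \<open>n\<close>, the complex linear map with eigenvalue \<open>b\<close> on
  the line of \<open>n\<close> and \<open>a\<close> on its Hermitian orthogonal complement.\<close>

definition normal_stretch :: "real \<Rightarrow> real \<Rightarrow> complex ^ 'n \<Rightarrow> complex ^ 'n \<Rightarrow> complex ^ 'n" where
  "normal_stretch a b n x = of_real a *s x + (of_real ((b - a) / (norm n)\<^sup>2) * hip x n) *s n"

lemma norm_normal_stretch:
  assumes "n \<noteq> 0"
  shows "(norm (normal_stretch a b n x))\<^sup>2 = a\<^sup>2 * (norm x)\<^sup>2 + (b\<^sup>2 - a\<^sup>2) * (cmod (hip x n))\<^sup>2 / (norm n)\<^sup>2"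
proof -
  let ?N = "(norm n)\<^sup>2" let ?h = "hip x n"
  have N: "?N \<noteq> 0" using assms by simp
  have "(norm (normal_stretch a b n x))\<^sup>2 = a\<^sup>2 * (norm x)\<^sup>2
      + 2 * Re (cnj (of_real ((b - a) / ?N) * ?h) * (of_real a * ?h)) + (cmod (of_real ((b - a) / ?N) * ?h))\<^sup>2 * ?N"
    unfolding normal_stretch_def norm_add_scale_square by (simp add: hip_scale_left norm_vector_scalar_mult power_mult_distrib)
  also have "cnj (of_real ((b - a) / ?N) * ?h) * (of_real a * ?h) = of_real (a * ((b - a) / ?N) * (cmod ?h)\<^sup>2)"
    by (simp add: complex_norm_square algebra_simps del: of_real_power)
  also have "(cmod (of_real ((b - a) / ?N) * ?h))\<^sup>2 * ?N = ((b - a)\<^sup>2 / ?N) * (cmod ?h)\<^sup>2"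
    unfolding norm_mult norm_of_real power_mult_distrib power2_abs power_divide using N by (simp add: power2_eq_square)
  also have "a\<^sup>2 * (norm x)\<^sup>2 + 2 * Re (of_real (a * ((b - a) / ?N) * (cmod ?h)\<^sup>2)) + ((b - a)\<^sup>2 / ?N) * (cmod ?h)\<^sup>2
      = a\<^sup>2 * (norm x)\<^sup>2 + (b\<^sup>2 - a\<^sup>2) * (cmod ?h)\<^sup>2 / ?N"
    unfolding Re_complex_of_real using N by (simp add: field_simps power2_eq_square)
  finally show ?thesis .
qed

lemma hip_normal_stretch:
  assumes "n \<noteq> 0" shows "hip (normal_stretch a b n x) n = of_real b * hip x n"
proof -
  have "of_real ((norm n)\<^sup>2) \<noteq> (0 :: complex)" using assms by simp
  then show ?thesis unfolding normal_stretch_def hip_add_left hip_scale_left hip_self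
    by (simp add: field_simps)
qed

lemma normal_stretch_inverse:
  assumes "n \<noteq> 0" "a \<noteq> 0" "b \<noteq> 0"
  shows "normal_stretch a b n (normal_stretch (1/a) (1/b) n y) = y"
proof -
  have N: "of_real ((norm n)\<^sup>2) \<noteq> (0 :: complex)" using assms by simp
  have "normal_stretch a b n (normal_stretch (1/a) (1/b) n y) =
      y + (of_real a * (of_real ((1/b - 1/a) / (norm n)\<^sup>2) * hip y n) + of_real ((b - a) / (norm n)\<^sup>2) * (of_real (1/b) * hip y n)) *s n"
    unfolding normal_stretch_def[of a b] hip_normal_stretch[OF assms(1)]
    using assms(2) by (simp add: normal_stretch_def vec_eq_iff algebra_simps)
  also have "of_real a * (of_real ((1/b - 1/a) / (norm n)\<^sup>2) * hip y n) + of_real ((b - a) / (norm n)\<^sup>2) * (of_real (1/b) * hip y n)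
      = of_real (a * ((1/b - 1/a) / (norm n)\<^sup>2) + ((b - a) / (norm n)\<^sup>2) * (1/b)) * hip y n"
    by (simp only: of_real_add of_real_mult ring_distribs mult.assoc)
  also have "a * ((1/b - 1/a) / (norm n)\<^sup>2) + ((b - a) / (norm n)\<^sup>2) * (1/b) = 0"
    using assms by (simp add: field_simps)
  finally show ?thesis by simp
qed

lemma normal_stretch_diff: "normal_stretch a b n (x - y) = normal_stretch a b n x - normal_stretch a b n y"
  unfolding normal_stretch_def hip_diff_left right_diff_distrib by (simp only: vec_eq_iff) (simp only: vector_minus_component vector_add_component vector_smult_component left_diff_distrib right_diff_distrib, simp)

lemma normal_stretch_scale: "normal_stretch a b n (c *s x) = c *s normal_stretch a b n x"
  by (simp add: normal_stretch_def hip_scale_left vec_eq_iff algebra_simps)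

text \<open>The projective transformation below carries the ball \<open>2 Re \<langle>x,n\<rangle> + c |x|\<^sup>2 < t\<close> onto the unit ball and fixes the origin,
  because \<open>|t - \<langle>x,n\<rangle>|\<^sup>2 - |A x|\<^sup>2 = t (t - 2 Re \<langle>x,n\<rangle> - c |x|\<^sup>2)\<close> for \<open>A\<close> the stretch by
  \<open>sqrt (c t)\<close> across \<open>n\<close> and \<open>sqrt (c t + |n|\<^sup>2)\<close> along \<open>n\<close>.\<close>

lemma ball_automorphism:
  fixes n :: "complex ^ 'n"
  assumes n: "n \<noteq> 0" and t: "t > 0" and c: "c > 0"
  shows "\<exists>\<alpha> :: complex ^ 'n \<Rightarrow> complex ^ 'n. holomorphic_map_on \<alpha> {x. hip x n \<noteq> of_real t} \<and>
    inj_on \<alpha> {x. hip x n \<noteq> of_real t} \<and> \<alpha> 0 = 0 \<and>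
    (\<forall>x. 2 * Re (hip x n) + c * (norm x)\<^sup>2 < t \<longrightarrow> hip x n \<noteq> of_real t \<and> norm (\<alpha> x) < 1) \<and>
    (\<forall>y. norm y < 1 \<longrightarrow> (\<exists>x. hip x n \<noteq> of_real t \<and> \<alpha> x = y \<and> norm x \<le> sqrt (t / c) / (1 - norm y) \<and>
       (\<forall>e\<ge>0. (c + e) * (norm y)\<^sup>2 < c \<longrightarrow> 2 * Re (hip x n) + (c + e) * (norm x)\<^sup>2 < t)))"
proof -
  define a where "a = sqrt (c * t)"
  define b where "b = sqrt (c * t + (norm n)\<^sup>2)"
  have ct: "c * t > 0" using c t by simp
  have a: "a > 0" "a\<^sup>2 = c * t" using ct by (simp_all add: a_def)
  have b: "b > 0" "b\<^sup>2 = c * t + (norm n)\<^sup>2" using ct by (simp_all add: b_def add_pos_nonneg)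
  have bn: "norm n \<le> b" unfolding b_def by (rule real_le_rsqrt) (use ct in simp)
  define A where "A = normal_stretch a b n"
  define \<alpha> where "\<alpha> x = (1 / (of_real t - hip x n)) *s A x" for x
  have nA: "(norm (A x))\<^sup>2 = c * t * (norm x)\<^sup>2 + (cmod (hip x n))\<^sup>2" for x
    unfolding A_def norm_normal_stretch[OF n] using n a b by simp
  have key: "(cmod (of_real t - hip x n))\<^sup>2 - (norm (A x))\<^sup>2 = t * (t - 2 * Re (hip x n) - c * (norm x)\<^sup>2)" for x
    unfolding nA cmod_power2 by (simp add: power2_eq_square algebra_simps)
  have A0: "x = 0" if "A x = 0" for x using nA[of x] that ct by (auto simp: add_nonneg_eq_0_iff)
  have n\<alpha>: "norm (\<alpha> x) * cmod (of_real t - hip x n) = norm (A x)" if "hip x n \<noteq> of_real t" for x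
    using that by (simp add: \<alpha>_def norm_vector_scalar_mult norm_divide)
  have oD: "open {x. hip x n \<noteq> of_real t}"
  proof -
    have "continuous_on UNIV (\<lambda>x. hip x n)" by (intro slice_hol_cont slice_hol_hip slice_hol_nth)
    then have "open ((\<lambda>x. hip x n) -` (- {of_real t}))" by (intro open_vimage) auto
    then show ?thesis by (simp add: vimage_def)
  qed
  have inE: "hip x n \<noteq> of_real t \<and> norm (\<alpha> x) < 1" if "2 * Re (hip x n) + c * (norm x)\<^sup>2 < t" for x
    proof
      have pos: "(cmod (of_real t - hip x n))\<^sup>2 - (norm (A x))\<^sup>2 > 0" unfolding key using that t by simp
      then show ne: "hip x n \<noteq> of_real t" using zero_le_power2[of "norm (A x)"] by auto
      have "norm (A x) < cmod (of_real t - hip x n)"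
        by (rule power2_less_imp_less) (use pos in simp_all)
      then show "norm (\<alpha> x) < 1" using n\<alpha>[OF ne] ne
        by (metis mult_less_cancel_right1 mult.commute norm_ge_zero not_less zero_less_norm_iff right_minus_eq mult_1 mult_le_cancel_right)
    qed
  have sur: "\<exists>x. hip x n \<noteq> of_real t \<and> \<alpha> x = y \<and> norm x \<le> sqrt (t / c) / (1 - norm y) \<and>
       (\<forall>e\<ge>0. (c + e) * (norm y)\<^sup>2 < c \<longrightarrow> 2 * Re (hip x n) + (c + e) * (norm x)\<^sup>2 < t)" if y: "norm y < 1" for y :: "complex ^ 'n"
  proof -
    \<comment> \<open>Taking the product with \<open>n\<close> in \<open>\<alpha> x = y\<close>
      forces \<open>hip x n = t m / (1 + m)\<close>, hence \<open>t - hip x n = t / (1 + m)\<close>;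
      then \<open>x\<close> is found by inverting the stretch.\<close>
    define m where "m = hip y n / of_real b"
    have "cmod m \<le> norm y"
    proof -
      have "norm y * norm n \<le> norm y * b" using bn by (intro mult_left_mono) auto
      then have "cmod (hip y n) \<le> norm y * b" using norm_hip_le[of y n] by linarith
      then show ?thesis using b(1) by (simp add: m_def norm_divide field_simps)
    qed
    then have m1: "1 - norm y \<le> cmod (1 + m)" using norm_diff_ineq[of 1 m] by simp
    then have m0: "1 + m \<noteq> 0" using y by auto
    define x where "x = (of_real t / (1 + m)) *s normal_stretch (1/a) (1/b) n y"
    have Ax: "A x = (of_real t / (1 + m)) *s y"
      unfolding x_def A_def normal_stretch_scale using normal_stretch_inverse[OF n] a(1) b(1) by simp
    have hx: "hip x n = of_real t / (1 + m) * m"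
      unfolding x_def hip_scale_left hip_normal_stretch[OF n] m_def by simp
    have th: "of_real t - hip x n = of_real t / (1 + m)" unfolding hx using m0 by (simp add: field_simps)
    have th0: "of_real t - hip x n \<noteq> 0" unfolding th using t m0 by simp
    have \<alpha>x: "\<alpha> x = y" unfolding \<alpha>_def Ax th using t m0 by (simp add: vector_smult_assoc)
    have nAx: "norm (A x) = cmod (of_real t - hip x n) * norm y" unfolding Ax th by (simp add: norm_vector_scalar_mult)
    have "(a * norm x)\<^sup>2 \<le> (norm (A x))\<^sup>2" unfolding nA power_mult_distrib a(2) by simp
    then have axA: "a * norm x \<le> norm (A x)" by (rule power2_le_imp_le) simp
    have bound: "norm x \<le> sqrt (t / c) / (1 - norm y)"
    proof -
      have "norm (A x) \<le> t / (1 - norm y)"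
      proof -
        have "norm (A x) = t / cmod (1 + m) * norm y" unfolding nAx th using t by (simp add: norm_divide)
        also have "\<dots> \<le> t / cmod (1 + m) * 1" using y t by (intro mult_left_mono) auto
        also have "\<dots> \<le> t / (1 - norm y)" using m1 y t by (simp add: frac_le)
        finally show ?thesis .
      qed
      then have "norm x * a \<le> t / (1 - norm y)" using axA by (simp add: mult.commute[of a])
      then have "norm x \<le> (t / (1 - norm y)) / a" by (simp only: pos_le_divide_eq[OF a(1)])
      also have "\<dots> = (t / a) / (1 - norm y)" by simp
      also have "t / a = sqrt (t / c)"
      proof -
        have "t / c = t\<^sup>2 / (c * t)" using t by (simp add: power2_eq_square)
        then show ?thesis using t by (simp add: a_def real_sqrt_divide)
      qed
      finally show ?thesis .
    qed
    \<comment> \<open>The identity \<open>key\<close> is combined with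
      \<open>c t |x|^2 <= |t - hip x n|^2 |y|^2\<close>: points \<open>y\<close> well inside the
      unit ball come from the smaller ball in which \<open>c\<close> is replaced by
      \<open>c + e\<close>.\<close>
    have "2 * Re (hip x n) + (c + e) * (norm x)\<^sup>2 < t" if e: "e \<ge> 0" "(c + e) * (norm y)\<^sup>2 < c" for e
    proof -
      let ?d = "(cmod (of_real t - hip x n))\<^sup>2"
      have d: "?d > 0" using th0 by simp
      have 1: "t * (t - 2 * Re (hip x n) - c * (norm x)\<^sup>2) = ?d * (1 - (norm y)\<^sup>2)"
        using key[of x] unfolding nAx by (simp add: power_mult_distrib algebra_simps)
      have 2: "c * t * (norm x)\<^sup>2 \<le> ?d * (norm y)\<^sup>2"
        using nA[of x] unfolding nAx by (simp add: power_mult_distrib)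
      have 3: "e * (c * t * (norm x)\<^sup>2) \<le> e * (?d * (norm y)\<^sup>2)" using 2 e by (intro mult_left_mono) auto
      have "?d * ((c + e) * (norm y)\<^sup>2) < ?d * c" using d e(2) by (intro mult_strict_left_mono) auto
      then have "0 < c * (?d * (1 - (norm y)\<^sup>2)) - e * (?d * (norm y)\<^sup>2)" by (simp add: algebra_simps)
      also have "\<dots> \<le> c * (t * (t - 2 * Re (hip x n) - c * (norm x)\<^sup>2)) - e * (c * t * (norm x)\<^sup>2)"
        using 3 unfolding 1 by simp
      also have "\<dots> = c * t * (t - 2 * Re (hip x n) - (c + e) * (norm x)\<^sup>2)" by (simp add: algebra_simps)
      finally have "0 < t - 2 * Re (hip x n) - (c + e) * (norm x)\<^sup>2" using ct by (simp add: zero_less_mult_iff)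
      then show ?thesis by simp
    qed
    then show "\<exists>x. hip x n \<noteq> of_real t \<and> \<alpha> x = y \<and> norm x \<le> sqrt (t / c) / (1 - norm y) \<and>
       (\<forall>e\<ge>0. (c + e) * (norm y)\<^sup>2 < c \<longrightarrow> 2 * Re (hip x n) + (c + e) * (norm x)\<^sup>2 < t)"
      using th0 \<alpha>x bound by (intro exI[of _ x]) auto
  qed
  show ?thesis
  proof (intro exI[of _ \<alpha>] conjI)
    show "holomorphic_map_on \<alpha> {x. hip x n \<noteq> of_real t}"
      unfolding holomorphic_map_on_iff_slice_hol[OF oD] \<alpha>_def A_def normal_stretch_def vector_component vector_add_component vector_smult_component
      by (intro allI slice_hol_mult slice_hol_add slice_hol_const slice_hol_divide slice_hol_diff slice_hol_hip slice_hol_nth) auto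
    show "\<alpha> 0 = 0" by (simp add: \<alpha>_def A_def normal_stretch_def)
    show "inj_on \<alpha> {x. hip x n \<noteq> of_real t}"
    proof (rule inj_onI, unfold mem_Collect_eq)
      fix x y assume x: "hip x n \<noteq> of_real t" and y: "hip y n \<noteq> of_real t" and eq: "\<alpha> x = \<alpha> y"
      \<comment> \<open>The product with \<open>n\<close> of the image determines
        \<open>hip z n\<close>, so equal images have equal denominators and only the injective
        linear map \<open>A\<close> remains.\<close>
      have h\<alpha>: "hip (\<alpha> z) n = of_real b * (hip z n / (of_real t - hip z n))" for z
        by (simp add: \<alpha>_def A_def hip_scale_left hip_normal_stretch[OF n])
      have "hip x n / (of_real t - hip x n) = hip y n / (of_real t - hip y n)"
      proof -
        have "of_real b * (hip x n / (of_real t - hip x n)) = of_real b * (hip y n / (of_real t - hip y n))"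
          unfolding h\<alpha>[symmetric] eq ..
        then show ?thesis using b(1) unfolding mult_cancel_left of_real_eq_0_iff by linarith
      qed
      then have "hip x n = hip y n" using x y t by (simp add: frac_eq_eq algebra_simps)
      moreover from this have "A x = A y" using eq x by (simp add: \<alpha>_def vec_eq_iff)
      then have "A (x - y) = 0" by (simp add: A_def normal_stretch_diff)
      then show "x = y" using A0 by fastforce
    qed
    show "\<forall>x. 2 * Re (hip x n) + c * (norm x)\<^sup>2 < t \<longrightarrow> hip x n \<noteq> of_real t \<and> norm (\<alpha> x) < 1"
      using inE by blast
    show "\<forall>y. norm y < 1 \<longrightarrow> (\<exists>x. hip x n \<noteq> of_real t \<and> \<alpha> x = y \<and> norm x \<le> sqrt (t / c) / (1 - norm y) \<and>
       (\<forall>e\<ge>0. (c + e) * (norm y)\<^sup>2 < c \<longrightarrow> 2 * Re (hip x n) + (c + e) * (norm x)\<^sup>2 < t))"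
      using sur by simp
  qed
qed

section \<open>Quadratic shears and straightened coordinates\<close>

definition bil :: "complex ^ 'n ^ 'n \<Rightarrow> complex ^ 'n \<Rightarrow> complex ^ 'n \<Rightarrow> complex" where
  "bil N x y = (\<Sum>i\<in>UNIV. x $ i * (N *v y) $ i)"

lemma bil_diff_left: "bil N (x - y) z = bil N x z - bil N y z"
  by (simp add: bil_def algebra_simps sum_subtractf)

lemma bil_diff_right: "bil N x (y - z) = bil N x y - bil N x z"
  by (simp add: bil_def algebra_simps sum_subtractf matrix_vector_mult_diff_distrib)

lemma bil_bound:
  obtains C where "C > 0" "\<And>x y. norm (bil N x y) \<le> C * norm x * norm y"
proof -
  obtain K where K: "K > 0" "\<And>x. norm (N *v x) \<le> norm x * K"
    using bounded_linear.pos_bounded[OF bounded_linear_matrix_vector[of N]] by blast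
  have "norm (bil N x y) \<le> real CARD('a) * K * norm x * norm y" for x y
  proof -
    have "norm (bil N x y) \<le> (\<Sum>i\<in>(UNIV :: 'a set). norm x * (norm y * K))"
      unfolding bil_def
    proof (rule order_trans[OF norm_sum], rule sum_mono)
      fix i
      have "norm (x $ i * (N *v y) $ i) \<le> norm x * norm (N *v y)"
        unfolding norm_mult by (intro mult_mono Finite_Cartesian_Product.norm_nth_le) auto
      also have "\<dots> \<le> norm x * (norm y * K)" using K(2) by (intro mult_left_mono) auto
      finally show "norm (x $ i * (N *v y) $ i) \<le> norm x * (norm y * K)" .
    qed
    then show ?thesis by (simp add: mult_ac)
  qed
  then show thesis using that[of "real CARD('a) * K"] K(1) by simp
qed

text \<open>The quadratic term is chosen so that \<open>2 Re \<langle>shear N n x, n\<rangle>\<close> is the pluriharmonic part of a second order expansion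
  with gradient \<open>n\<close>.\<close>

definition shear :: "complex ^ 'n ^ 'n \<Rightarrow> complex ^ 'n \<Rightarrow> complex ^ 'n \<Rightarrow> complex ^ 'n" where
  "shear N n x = x + (bil N x x / of_real (2 * (norm n)\<^sup>2)) *s n"

lemma shear_zero [simp]: "shear N n 0 = 0"
  by (simp add: shear_def bil_def)

lemma hip_shear: "n \<noteq> 0 \<Longrightarrow> hip (shear N n x) n = hip x n + bil N x x / 2"
  unfolding shear_def hip_add_left hip_scale_left hip_self by simp

lemma holomorphic_shear: "holomorphic_map_on (shear N n) UNIV"
  unfolding holomorphic_map_on_iff_slice_hol[OF open_UNIV] shear_def bil_def matrix_vector_mult_def
    vector_add_component vector_smult_component vec_lambda_beta divide_inverse
  by (intro allI slice_hol_mult slice_hol_add slice_hol_const slice_hol_sum slice_hol_nth)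

text \<open>Polarising the quadratic term gives a Lipschitz constant proportional to the distance
  from 0. The lower bound \<open>\<nu>\<close> makes it the same for all gradients near that at
  \<open>q\<close>.\<close>

lemma shear_near_id:
  assumes C: "C > 0" "\<And>x y. norm (bil N x y) \<le> C * norm x * norm y" and \<nu>: "\<nu> > 0" "\<nu> \<le> norm n"
  shows "norm (shear N n x - shear N n y - (x - y)) \<le> C / (2 * \<nu>) * (norm x + norm y) * norm (x - y)"
proof -
  have n: "norm n > 0" using \<nu> by linarith
  have "shear N n x - shear N n y - (x - y) = ((bil N x x - bil N y y) / of_real (2 * (norm n)\<^sup>2)) *s n"
    by (simp only: shear_def vec_eq_iff) (simp add: diff_divide_distrib algebra_simps)
  also have "norm \<dots> = norm (bil N x x - bil N y y) / (2 * norm n)"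
    using n by (simp add: norm_vector_scalar_mult norm_divide norm_mult norm_power power2_eq_square)
  also have "\<dots> \<le> norm (bil N x x - bil N y y) / (2 * \<nu>)"
    using \<nu> n by (intro divide_left_mono) auto
  also have "norm (bil N x x - bil N y y) \<le> C * (norm x + norm y) * norm (x - y)"
  proof -
    have "bil N x x - bil N y y = bil N x (x - y) + bil N (x - y) y"
      by (simp add: bil_diff_left bil_diff_right)
    also have "norm \<dots> \<le> C * norm x * norm (x - y) + C * norm (x - y) * norm y"
      by (intro norm_triangle_mono C)
    finally show ?thesis by (simp add: algebra_simps)
  qed
  finally show ?thesis using \<nu> by (simp add: divide_right_mono)
qed

text \<open>In the coordinates \<open>x\<close> centred at \<open>z\<close> with \<open>w = z + Mi x\<close>, the Levi form at \<open>q\<close> is normalised to \<open>|x|\<^sup>2\<close>; only the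
  gradient \<open>n z\<close> depends on the centre, the variation of the second order terms with \<open>z\<close> being absorbed in the error.\<close>

locale strict_boundary_point =
  fixes D :: "(complex ^ 'n) set" and q :: "complex ^ 'n" and \<rho> :: "complex ^ 'n \<Rightarrow> real"
    and M Mi N :: "complex ^ 'n ^ 'n" and n :: "complex ^ 'n \<Rightarrow> complex ^ 'n" and R :: real
  assumes R: "R > 0" and D_iff: "\<And>w. w \<in> ball q R \<Longrightarrow> w \<in> D \<longleftrightarrow> \<rho> w < 0"
    and \<rho>_cont: "continuous_on (ball q R) \<rho>" and \<rho>_q: "\<rho> q = 0"
    and inv: "Mi ** M = mat 1" "M ** Mi = mat 1"
    and n_cont: "isCont n q" and n_q: "n q \<noteq> 0"
    and expansion: "\<And>e. e > 0 \<Longrightarrow> \<exists>d>0. \<forall>z\<in>ball q d. \<forall>x. norm x < d \<longrightarrow>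
      \<bar>\<rho> (z + Mi *v x) - \<rho> z - 2 * Re (hip x (n z)) - Re (bil N x x) - (norm x)\<^sup>2\<bar> \<le> e * (norm x)\<^sup>2"
begin

text \<open>The shear absorbs the pluriharmonic quadratic term, and replacing \<open>|x|\<close> by
  the norm of the sheared vector costs only a small multiple of its square. The radius is
  independent of the centre \<open>z\<close> because \<open>n z\<close> stays away from 0.\<close>

lemma straightening:
  assumes e: "e > 0"
  shows "\<exists>d>0. \<forall>z\<in>ball q d. n z \<noteq> 0 \<and> inj_on (shear N (n z)) (ball 0 d) \<and>
    (\<forall>x\<in>ball 0 d. norm x / 2 \<le> norm (shear N (n z) x) \<and>
      \<bar>\<rho> (z + Mi *v x) - \<rho> z - 2 * Re (hip (shear N (n z) x) (n z)) - (norm (shear N (n z) x))\<^sup>2\<bar> \<le> e * (norm (shear N (n z) x))\<^sup>2) \<and>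
    (\<forall>d'. 0 < d' \<and> d' < d \<longrightarrow> ball 0 (d' / 2) \<subseteq> shear N (n z) ` ball 0 d')"
proof -
  obtain C where C: "C > 0" "\<And>x y. norm (bil N x y) \<le> C * norm x * norm y" by (rule bil_bound[of N]) blast
  define \<nu> where "\<nu> = norm (n q) / 2"
  have \<nu>: "\<nu> > 0" using n_q by (simp add: \<nu>_def)
  define \<kappa> where "\<kappa> = C / (2 * \<nu>)"
  have \<kappa>: "\<kappa> > 0" using C \<nu> by (simp add: \<kappa>_def)
  obtain d1 where d1: "d1 > 0" "\<And>z x. z \<in> ball q d1 \<Longrightarrow> norm x < d1 \<Longrightarrow>
      \<bar>\<rho> (z + Mi *v x) - \<rho> z - 2 * Re (hip x (n z)) - Re (bil N x x) - (norm x)\<^sup>2\<bar> \<le> e / 8 * (norm x)\<^sup>2"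
    using expansion[of "e / 8"] e by auto
  have "\<forall>\<^sub>F z in nhds q. dist (n z) (n q) < \<nu>"
    using n_cont \<nu> tendstoD unfolding isCont_def tendsto_at_iff_tendsto_nhds by blast
  then obtain d2 where d2: "d2 > 0" "\<And>z. dist z q < d2 \<Longrightarrow> dist (n z) (n q) < \<nu>"
    unfolding eventually_nhds_metric by blast
  \<comment> \<open>\<open>\<kappa> * d <= 1/4\<close> makes the shear injective with distortion at
    most \<open>|x| / 4\<close>; \<open>\<kappa> * d <= e / 24\<close> bounds the change of the
    squared norm, at most \<open>3 * \<kappa> * d * |x|^2\<close>, by
    \<open>e / 8 * |x|^2\<close>.\<close>
  define d where "d = Min {d1, d2, 1 / (4 * \<kappa>), e / (24 * \<kappa>)}"
  have d: "d > 0" "d \<le> d1" "d \<le> d2" "d \<le> 1 / (4 * \<kappa>)" "d \<le> e / (24 * \<kappa>)"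
    using d1 d2 \<kappa> e by (auto simp: d_def)
  have kd: "\<kappa> * d \<le> 1 / 4" "\<kappa> * d \<le> e / 24" using d(4,5) \<kappa> by (simp_all add: field_simps)
  show ?thesis
  proof (intro exI[of _ d] conjI ballI allI impI d(1))
    fix z assume z: "z \<in> ball q d"
    have "dist (n z) (n q) < \<nu>" using d2(2)[of z] z d(3) by (simp add: dist_commute)
    then have nz: "\<nu> \<le> norm (n z)" using norm_triangle_ineq3[of "n z" "n q"] \<nu> by (simp add: dist_norm \<nu>_def)
    then show n0: "n z \<noteq> 0" using \<nu> by auto
    let ?S = "shear N (n z)"
    have near: "norm (?S x - ?S y - (x - y)) \<le> \<kappa> * (norm x + norm y) * norm (x - y)" for x y
      unfolding \<kappa>_def by (rule shear_near_id[OF C \<nu> nz])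
    have near0: "norm (?S x - x) \<le> \<kappa> * norm x * norm x" for x using near[of x 0] by simp
    have small: "norm (?S x - x) \<le> norm x / 4" if "norm x < d" for x
    proof -
      have "\<kappa> * norm x \<le> \<kappa> * d" using that \<kappa> by (intro mult_left_mono) auto
      then have "\<kappa> * norm x * norm x \<le> 1 / 4 * norm x" using kd(1) by (intro mult_right_mono) auto
      then show ?thesis using near0[of x] by linarith
    qed
    show injS: "inj_on ?S (ball 0 d)"
    proof (rule inj_onI)
      fix x y assume x: "x \<in> ball 0 d" and y: "y \<in> ball 0 d" and eq: "?S x = ?S y"
      have "\<kappa> * (norm x + norm y) \<le> \<kappa> * (d + d)" using x y \<kappa> by (intro mult_left_mono) auto
      also have "\<dots> = 2 * (\<kappa> * d)" by simp
      also have "\<dots> \<le> 1 / 2" using kd(1) by simp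
      finally have "\<kappa> * (norm x + norm y) * norm (x - y) \<le> 1 / 2 * norm (x - y)" by (intro mult_right_mono) auto
      moreover have "norm (x - y) \<le> \<kappa> * (norm x + norm y) * norm (x - y)"
        using near[of x y] eq by (simp add: norm_minus_commute)
      ultimately have "norm (x - y) \<le> 0" by linarith
      then show "x = y" by simp
    qed
    show lower: "norm x / 2 \<le> norm (?S x)" if "x \<in> ball 0 d" for x
    proof -
      have "norm (x - ?S x) \<le> norm x / 4" using small[of x] that by (simp add: norm_minus_commute)
      moreover have "norm x - norm (x - ?S x) \<le> norm (?S x)" using norm_triangle_ineq2[of x "x - ?S x"] by simp
      ultimately show ?thesis using norm_ge_zero[of "?S x"] by linarith
    qed
    show "\<bar>\<rho> (z + Mi *v x) - \<rho> z - 2 * Re (hip (?S x) (n z)) - (norm (?S x))\<^sup>2\<bar> \<le> e * (norm (?S x))\<^sup>2" if x: "x \<in> ball 0 d" for x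
    proof -
      have 1: "\<bar>\<rho> (z + Mi *v x) - \<rho> z - 2 * Re (hip x (n z)) - Re (bil N x x) - (norm x)\<^sup>2\<bar> \<le> e / 8 * (norm x)\<^sup>2"
        by (rule d1(2)) (use z x d(2) in auto)
      have 2: "2 * Re (hip (?S x) (n z)) = 2 * Re (hip x (n z)) + Re (bil N x x)"
        using hip_shear[OF n0] by simp
      have a: "\<bar>norm (?S x) - norm x\<bar> \<le> \<kappa> * norm x * norm x"
        using near0[of x] norm_triangle_ineq3[of "?S x" x] by linarith
      have b: "norm (?S x) \<le> 2 * norm x"
      proof -
        have "norm (?S x - x) \<le> norm x / 4" using small[of x] x by simp
        then show ?thesis using norm_triangle_ineq2[of "?S x" x] norm_ge_zero[of x] by linarith
      qed
      have "(norm (?S x))\<^sup>2 - (norm x)\<^sup>2 = (norm (?S x) - norm x) * (norm (?S x) + norm x)"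
        by (simp add: power2_eq_square algebra_simps)
      then have "\<bar>(norm (?S x))\<^sup>2 - (norm x)\<^sup>2\<bar> = \<bar>norm (?S x) - norm x\<bar> * (norm (?S x) + norm x)"
        by (simp add: abs_mult)
      also have "\<dots> \<le> (\<kappa> * norm x * norm x) * (3 * norm x)"
        using a b by (intro mult_mono) auto
      also have "\<dots> = (3 * (\<kappa> * norm x)) * (norm x)\<^sup>2" by (simp add: power2_eq_square)
      also have "\<dots> \<le> (3 * (\<kappa> * d)) * (norm x)\<^sup>2"
        using x \<kappa> by (intro mult_right_mono mult_left_mono) auto
      also have "\<dots> \<le> e / 8 * (norm x)\<^sup>2" using kd(2) by (intro mult_right_mono) auto
      finally have 3: "\<bar>(norm (?S x))\<^sup>2 - (norm x)\<^sup>2\<bar> \<le> e / 8 * (norm x)\<^sup>2" .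
      \<comment> \<open>The two errors \<open>e / 8 * |x|^2\<close> add up to at most
        \<open>e\<close> times the new squared norm, since \<open>|x|^2\<close> is at most four
        times the latter.\<close>
      have "norm x \<le> 2 * norm (?S x)" using lower[OF x] by simp
      then have "(norm x)\<^sup>2 \<le> (2 * norm (?S x))\<^sup>2" by (rule power_mono) simp
      then have "e / 4 * (norm x)\<^sup>2 \<le> e / 4 * (4 * (norm (?S x))\<^sup>2)" using e by (intro mult_left_mono) (auto simp: power_mult_distrib)
      then have 4: "e / 8 * (norm x)\<^sup>2 + e / 8 * (norm x)\<^sup>2 \<le> e * (norm (?S x))\<^sup>2" by simp
      show ?thesis using 1 3 4 unfolding 2 by linarith
    qed
    fix d' assume d': "0 < d' \<and> d' < d"
    show "ball 0 (d' / 2) \<subseteq> ?S ` ball 0 d'"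
    proof (rule ball_subset_image)
      have cont: "continuous_on A ?S" for A
        using holomorphic_map_on_continuous[OF holomorphic_shear] continuous_on_subset by blast
      show "continuous_on (cball 0 d') ?S" by (rule cont)
      show "open (?S ` ball 0 d')"
        by (rule invariance_of_domain[OF cont open_ball inj_on_subset[OF injS]]) (use d' in auto)
      fix x :: "complex ^ 'n" assume "x \<in> sphere 0 d'"
      then show "d' / 2 \<le> dist (?S x) 0" using lower[of x] d' by simp
    qed (use d' in auto)
  qed
qed

lemma coordinate_bound: obtains K where "K > 0" "\<And>x. norm (M *v x) \<le> K * norm x" "\<And>x. norm (Mi *v x) \<le> K * norm x"
proof -
  obtain K1 where K1: "K1 > 0" "\<And>x. norm (M *v x) \<le> norm x * K1"
    using bounded_linear.pos_bounded[OF bounded_linear_matrix_vector[of M]] by blast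
  obtain K2 where K2: "K2 > 0" "\<And>x. norm (Mi *v x) \<le> norm x * K2"
    using bounded_linear.pos_bounded[OF bounded_linear_matrix_vector[of Mi]] by blast
  have "norm (M *v x) \<le> max K1 K2 * norm x" for x
    using K1(2)[of x] mult_right_mono[of K1 "max K1 K2" "norm x"] by (simp add: mult.commute)
  moreover have "norm (Mi *v x) \<le> max K1 K2 * norm x" for x
    using K2(2)[of x] mult_right_mono[of K2 "max K1 K2" "norm x"] by (simp add: mult.commute)
  ultimately show thesis using that[of "max K1 K2"] K1(1) by simp
qed

lemma holomorphic_coordinates: "holomorphic_map_on (\<lambda>w. shear N m (M *v (w - z))) A"
proof -
  have "holomorphic_map_on (\<lambda>w. M *v (w - z)) UNIV"
    unfolding holomorphic_map_on_def
  proof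
    fix w
    have "((\<lambda>w. w - z) has_derivative (\<lambda>v. v)) (at w)" by (auto intro!: derivative_eq_intros)
    from bounded_linear.has_derivative[OF bounded_linear_matrix_vector this]
    show "\<exists>f'. ((\<lambda>w. M *v (w - z)) has_derivative f') (at w) \<and> (\<forall>c v. f' (c *s v) = c *s f' v)"
      by (metis vector_scalar_commute)
  qed
  then have "holomorphic_map_on (shear N m \<circ> (\<lambda>w. M *v (w - z))) UNIV"
    by (rule holomorphic_map_on_compose[OF _ holomorphic_shear]) simp
  then show ?thesis unfolding o_def by (rule holomorphic_map_on_subset) simp
qed

text \<open>The function is the Levi polynomial at \<open>q\<close> in straightened coordinates.
  With \<open>s\<close> the norm of the sheared vector, the expansion for \<open>e = 1/2\<close>
  gives \<open>2 Re \<psi> <= \<rho> - s^2 / 2\<close>, and \<open>\<rho> <= 0\<close> on the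
  closure of \<open>D\<close> near \<open>q\<close>.\<close>

lemma local_peak_function:
  "\<exists>d>0. \<exists>\<psi>. slice_hol \<psi> UNIV \<and> \<psi> q = 0 \<and>
    (\<forall>w\<in>closure D \<inter> ball q d. Re (\<psi> w) \<le> 0 \<and> (Re (\<psi> w) = 0 \<longrightarrow> w = q))"
proof -
  obtain d0 where d0: "d0 > 0" "\<And>x. x \<in> ball 0 d0 \<Longrightarrow> norm x / 2 \<le> norm (shear N (n q) x)"
    "\<And>x. x \<in> ball 0 d0 \<Longrightarrow> \<bar>\<rho> (q + Mi *v x) - \<rho> q - 2 * Re (hip (shear N (n q) x) (n q)) - (norm (shear N (n q) x))\<^sup>2\<bar> \<le> 1/2 * (norm (shear N (n q) x))\<^sup>2"
    using straightening[of "1/2"] by (auto; metis centre_in_ball)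
  obtain K where K: "K > 0" "\<And>x. norm (M *v x) \<le> K * norm x" by (rule coordinate_bound) blast
  define d where "d = min R (d0 / K)"
  have d: "d > 0" using R K d0 by (simp add: d_def)
  define \<psi> where "\<psi> w = hip (shear N (n q) (M *v (w - q))) (n q)" for w
  have "slice_hol \<psi> UNIV" unfolding \<psi>_def
    by (intro slice_hol_hip holomorphic_map_on_imp_slice_hol[OF holomorphic_coordinates])
  moreover have "\<psi> q = 0" by (simp add: \<psi>_def)
  moreover have "Re (\<psi> w) \<le> 0 \<and> (Re (\<psi> w) = 0 \<longrightarrow> w = q)" if w: "w \<in> closure D \<inter> ball q d" for w
  proof -
    have wR: "w \<in> ball q R" using w by (auto simp: d_def)
    have "\<rho> w \<le> 0"
    proof (rule ccontr)
      assume "\<not> \<rho> w \<le> 0"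
      then have "w \<in> ball q R \<inter> \<rho> -` {0<..}" using wR by simp
      moreover have "open (ball q R \<inter> \<rho> -` {0<..})" by (rule continuous_open_preimage[OF \<rho>_cont]) auto
      moreover have "D \<inter> (ball q R \<inter> \<rho> -` {0<..}) = {}" using D_iff by fastforce
      ultimately show False using w open_Int_closure_eq_empty by blast
    qed
    define x where "x = M *v (w - q)"
    have x: "x \<in> ball 0 d0"
    proof -
      have "norm x \<le> K * norm (w - q)" unfolding x_def by (rule K(2))
      also have "\<dots> < K * (d0 / K)" using w K(1) by (intro mult_strict_left_mono) (auto simp: d_def dist_norm norm_minus_commute)
      finally show ?thesis using K(1) by simp
    qed
    have wx: "q + Mi *v x = w" by (simp add: x_def matrix_vector_mul_assoc inv)
    define s where "s = norm (shear N (n q) x)"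
    have "\<bar>\<rho> w - 2 * Re (\<psi> w) - s\<^sup>2\<bar> \<le> 1/2 * s\<^sup>2"
      using d0(3)[OF x] unfolding wx \<rho>_q by (simp add: \<psi>_def s_def flip: x_def)
    then have le: "2 * Re (\<psi> w) \<le> - (1/2 * s\<^sup>2)" using \<open>\<rho> w \<le> 0\<close> by linarith
    have "w = q" if "Re (\<psi> w) = 0"
    proof -
      have "s\<^sup>2 \<le> 0" using le that by simp
      then have "norm x / 2 \<le> 0" using d0(2)[OF x] by (simp add: s_def)
      then have "x = 0" by simp
      then show "w = q" using wx by simp
    qed
    moreover have "Re (\<psi> w) \<le> 0" using le zero_le_power2[of s] by linarith
    ultimately show ?thesis by blast
  qed
  ultimately show ?thesis using d by blast
qed

text \<open>With \<open>t = - \<rho> z\<close>, the domain near \<open>z\<close> in sheared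
  coordinates lies in the ball \<open>2 Re <s,n> + (1 - e) |s|^2 < t\<close>, whose projective map
  gives \<open>\<phi>\<close>, and contains the ball with \<open>1 + e\<close>. Confining
  \<open>z\<close> to \<open>d1\<close> makes \<open>t\<close> so small that these balls fit into
  the region where the coordinates are controlled.\<close>

lemma local_squeezing:
  assumes \<eta>: "0 < \<eta>" "\<eta> < 1"
  shows "\<exists>d>0. \<exists>d1>0. d1 \<le> d \<and> (\<forall>z\<in>D \<inter> ball q d1. \<exists>\<phi> :: complex ^ 'n \<Rightarrow> complex ^ 'n. holomorphic_map_on \<phi> (D \<inter> ball q d) \<and> inj_on \<phi> (D \<inter> ball q d) \<and>
    \<phi> ` (D \<inter> ball q d) \<subseteq> ball 0 1 \<and> \<phi> z = 0 \<and> ball 0 (1 - \<eta>) \<subseteq> \<phi> ` (D \<inter> ball q d))"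
proof -
  \<comment> \<open>For this \<open>e\<close> one has \<open>(1 + e) * (1 - \<eta>) < 1 - e\<close>,
    the condition for \<open>ball 0 (1 - \<eta>)\<close> to come from the inner ball.\<close>
  define e where "e = \<eta> / 2"
  define c where "c = 1 - e"
  have e: "0 < e" and c: "0 < c" "c + 2 * e = 1 + e" using \<eta> by (auto simp: e_def c_def)
  obtain d0 where d0: "d0 > 0" and st: "\<forall>z\<in>ball q d0. n z \<noteq> 0 \<and> inj_on (shear N (n z)) (ball 0 d0) \<and>
    (\<forall>x\<in>ball 0 d0. norm x / 2 \<le> norm (shear N (n z) x) \<and>
      \<bar>\<rho> (z + Mi *v x) - \<rho> z - 2 * Re (hip (shear N (n z) x) (n z)) - (norm (shear N (n z) x))\<^sup>2\<bar> \<le> e * (norm (shear N (n z) x))\<^sup>2) \<and>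
    (\<forall>d'. 0 < d' \<and> d' < d0 \<longrightarrow> ball 0 (d' / 2) \<subseteq> shear N (n z) ` ball 0 d')"
    using straightening[OF e] by blast
  obtain K where K: "K > 0" "\<And>x. norm (M *v x) \<le> K * norm x" "\<And>x. norm (Mi *v x) \<le> K * norm x"
    by (rule coordinate_bound) blast
  \<comment> \<open>The coordinate of a point of \<open>ball q d\<close> relative to a centre within
    \<open>d / 2\<close> of \<open>q\<close> has norm below \<open>2 * K * d <= d0\<close>.\<close>
  define d where "d = Min {R, d0, d0 / (2 * K)}"
  have d: "d > 0" "d \<le> R" "d \<le> d0" "d \<le> d0 / (2 * K)" using R d0 K by (auto simp: d_def)
  define d2 where "d2 = min (d0 / 2) (d / (2 * K))"
  have d2: "0 < d2" "d2 < d0" "d2 \<le> d / (2 * K)" using d0 d K by (auto simp: d2_def)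
  \<comment> \<open>For \<open>t < \<tau>\<close> and \<open>|y| < 1 - \<eta>\<close> the projective
    preimage of \<open>y\<close> has norm at most \<open>d2 / 4\<close>, hence lies in the image of
    \<open>ball 0 d2\<close> under the shear.\<close>
  define \<tau> where "\<tau> = c * (\<eta> * d2 / 4)\<^sup>2"
  have \<tau>: "\<tau> > 0" using c \<eta> d2 by (simp add: \<tau>_def)
  have "isCont \<rho> q" using \<rho>_cont R continuous_on_eq_continuous_at by (metis centre_in_ball open_ball)
  then have "\<forall>\<^sub>F z in nhds q. dist (\<rho> z) (\<rho> q) < \<tau>"
    using \<tau> tendstoD unfolding isCont_def tendsto_at_iff_tendsto_nhds by blast
  then obtain d3 where d3: "d3 > 0" "\<And>z. dist z q < d3 \<Longrightarrow> dist (\<rho> z) (\<rho> q) < \<tau>"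
    unfolding eventually_nhds_metric by blast
  define d1 where "d1 = min d3 (d / 2)"
  have d1: "d1 > 0" "d1 \<le> d3" "d1 \<le> d / 2" "d1 \<le> d" using d3 d by (auto simp: d1_def)
  show ?thesis
  proof (rule exI[of _ d], rule conjI[OF d(1)], rule exI[of _ d1], intro conjI ballI d1(1,4))
    fix z assume z: "z \<in> D \<inter> ball q d1"
    then have zd: "z \<in> ball q d0" "z \<in> ball q R" "dist z q < d1" "dist z q < d / 2" using d d1 by (auto simp: dist_commute)
    define t where "t = - \<rho> z"
    have t: "0 < t" "t < \<tau>" using D_iff[OF zd(2)] z d3(2)[of z] zd(3) d1(2) by (auto simp: t_def \<rho>_q)
    have nz: "n z \<noteq> 0" and injS: "inj_on (shear N (n z)) (ball 0 d0)"
      and exp: "\<And>x. x \<in> ball 0 d0 \<Longrightarrow> \<bar>\<rho> (z + Mi *v x) + t - 2 * Re (hip (shear N (n z) x) (n z)) - (norm (shear N (n z) x))\<^sup>2\<bar> \<le> e * (norm (shear N (n z) x))\<^sup>2"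
      and surjS: "\<And>d'. 0 < d' \<Longrightarrow> d' < d0 \<Longrightarrow> ball 0 (d' / 2) \<subseteq> shear N (n z) ` ball 0 d'"
      using st zd(1) by (auto simp: t_def)
    obtain \<alpha> :: "complex ^ 'n \<Rightarrow> complex ^ 'n" where \<alpha>: "holomorphic_map_on \<alpha> {x. hip x (n z) \<noteq> of_real t}"
        "inj_on \<alpha> {x. hip x (n z) \<noteq> of_real t}" "\<alpha> 0 = 0"
        "\<forall>x. 2 * Re (hip x (n z)) + c * (norm x)\<^sup>2 < t \<longrightarrow> hip x (n z) \<noteq> of_real t \<and> norm (\<alpha> x) < 1"
        "\<forall>y. norm y < 1 \<longrightarrow> (\<exists>x. hip x (n z) \<noteq> of_real t \<and> \<alpha> x = y \<and> norm x \<le> sqrt (t / c) / (1 - norm y) \<and>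
         (\<forall>e\<ge>0. (c + e) * (norm y)\<^sup>2 < c \<longrightarrow> 2 * Re (hip x (n z)) + (c + e) * (norm x)\<^sup>2 < t))"
      using ball_automorphism[OF nz t(1) c(1)] by (elim exE conjE) (rule that)
    define X where "X w = M *v (w - z)" for w
    have wX: "z + Mi *v X w = w" for w by (simp add: X_def matrix_vector_mul_assoc inv)
    have Xx: "X (z + Mi *v x) = x" for x by (simp add: X_def matrix_vector_mul_assoc inv)
    have Xb: "X w \<in> ball 0 d0" if "w \<in> ball q d" for w
    proof -
      have "norm (w - z) < 2 * d" using that zd(4) dist_triangle[of w z q] d by (simp add: dist_norm norm_minus_commute)
      then have "K * norm (w - z) < K * (2 * (d0 / (2 * K)))" using d(4) K(1) by (intro mult_strict_left_mono) auto
      then show ?thesis using K(2)[of "w - z"] K(1) by (simp add: X_def)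
    qed
    define S where "S w = shear N (n z) (X w)" for w
    have inE: "2 * Re (hip (S w) (n z)) + c * (norm (S w))\<^sup>2 < t" if w: "w \<in> D \<inter> ball q d" for w
    proof -
      have "\<rho> w < 0" using D_iff[of w] w d(2) by auto
      then show ?thesis using exp[OF Xb[of w]] w unfolding wX S_def[symmetric] by (simp add: c_def algebra_simps abs_le_iff)
    qed
    have holS: "holomorphic_map_on S (D \<inter> ball q d)" unfolding S_def X_def by (rule holomorphic_coordinates)
    have SimE: "S ` (D \<inter> ball q d) \<subseteq> {x. hip x (n z) \<noteq> of_real t}" using \<alpha>(4) inE by blast
    show "\<exists>\<phi> :: complex ^ 'n \<Rightarrow> complex ^ 'n. holomorphic_map_on \<phi> (D \<inter> ball q d) \<and> inj_on \<phi> (D \<inter> ball q d) \<and>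
      \<phi> ` (D \<inter> ball q d) \<subseteq> ball 0 1 \<and> \<phi> z = 0 \<and> ball 0 (1 - \<eta>) \<subseteq> \<phi> ` (D \<inter> ball q d)"
    proof (intro exI[of _ "\<alpha> \<circ> S"] conjI)
      show "holomorphic_map_on (\<alpha> \<circ> S) (D \<inter> ball q d)"
        by (rule holomorphic_map_on_compose[OF holS \<alpha>(1) SimE])
      have "inj_on S (D \<inter> ball q d)"
      proof (rule inj_onI)
        fix v w assume v: "v \<in> D \<inter> ball q d" and w: "w \<in> D \<inter> ball q d" and "S v = S w"
        then have "X v = X w" using inj_onD[OF injS] Xb by (simp add: S_def)
        then show "v = w" using wX by metis
      qed
      then show "inj_on (\<alpha> \<circ> S) (D \<inter> ball q d)"
        by (rule comp_inj_on[OF _ inj_on_subset[OF \<alpha>(2) SimE]])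
      show "(\<alpha> \<circ> S) ` (D \<inter> ball q d) \<subseteq> ball 0 1" using \<alpha>(4) inE by auto
      show "(\<alpha> \<circ> S) z = 0" using \<alpha>(3) by (simp add: S_def X_def)
      show "ball 0 (1 - \<eta>) \<subseteq> (\<alpha> \<circ> S) ` (D \<inter> ball q d)"
      proof
        fix y :: "complex ^ 'n" assume "y \<in> ball 0 (1 - \<eta>)"
        then have y: "norm y < 1 - \<eta>" by simp
        then obtain \<zeta> where \<zeta>: "\<alpha> \<zeta> = y" "norm \<zeta> \<le> sqrt (t / c) / (1 - norm y)"
          "\<And>e. e \<ge> 0 \<Longrightarrow> (c + e) * (norm y)\<^sup>2 < c \<Longrightarrow> 2 * Re (hip \<zeta> (n z)) + (c + e) * (norm \<zeta>)\<^sup>2 < t"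
          using \<alpha>(5)[rule_format, of y] \<eta> by auto
        have "(norm y)\<^sup>2 \<le> norm y" using y \<eta> by (simp add: power2_eq_square mult_left_le_one_le)
        then have "(1 + e) * (norm y)\<^sup>2 \<le> (1 + e) * (1 - \<eta>)" using y e by (intro mult_left_mono) auto
        also have "\<dots> < c" using \<eta> by (simp add: c_def e_def field_simps)
        finally have E: "2 * Re (hip \<zeta> (n z)) + (1 + e) * (norm \<zeta>)\<^sup>2 < t" using \<zeta>(3)[of "2 * e"] e c(2) by simp
        have "sqrt (t / c) \<le> \<eta> * d2 / 4"
        proof (rule real_le_lsqrt)
          show "t / c \<le> (\<eta> * d2 / 4)\<^sup>2" using t c by (simp add: \<tau>_def field_simps)
        qed (use \<eta> d2 in auto)
        moreover have "sqrt (t / c) / (1 - norm y) \<le> sqrt (t / c) / \<eta>" using y \<eta> t c by (intro divide_left_mono) auto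
        moreover have "sqrt (t / c) / \<eta> \<le> d2 / 4" using calculation(1) \<eta> by (simp add: field_simps)
        ultimately have "norm \<zeta> < d2 / 2" using \<zeta>(2) d2(1) by linarith
        then have "\<zeta> \<in> shear N (n z) ` ball 0 d2" using surjS[OF d2(1,2)] by auto
        then obtain x where x: "norm x < d2" "\<zeta> = shear N (n z) x" by auto
        define w where "w = z + Mi *v x"
        have "norm (Mi *v x) \<le> K * norm x" by (rule K(3))
        also have "\<dots> < K * (d / (2 * K))" using x d2 K(1) by (intro mult_strict_left_mono) auto
        finally have "norm (Mi *v x) < d / 2" using K(1) by simp
        then have wd: "w \<in> ball q d" using zd(4) norm_triangle_ineq[of "z - q" "Mi *v x"]
          by (simp add: w_def dist_norm norm_minus_commute algebra_simps)
        have Sw: "S w = \<zeta>" by (simp add: S_def w_def Xx x)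
        have "\<rho> w + t - 2 * Re (hip \<zeta> (n z)) - (norm \<zeta>)\<^sup>2 \<le> e * (norm \<zeta>)\<^sup>2"
          using exp[of x] x d2(2) by (simp add: w_def)
        then have "\<rho> w < 0" using E by (simp add: algebra_simps)
        then have "w \<in> D \<inter> ball q d" using D_iff[of w] wd d(2) by auto
        then show "y \<in> (\<alpha> \<circ> S) ` (D \<inter> ball q d)" using Sw \<zeta>(1) by (metis comp_apply imageI)
      qed
    qed
  qed
qed

end

section \<open>Normal form of the defining function\<close>

lemma complex_scalar_decomp: "c *s x = Re c *\<^sub>R x + Im c *\<^sub>R (\<i> *s (x :: complex ^ 'n))"
  by (simp add: vec_eq_iff complex_eq_iff)

lemma vec_axis_expansion: "(v :: complex ^ 'n) = (\<Sum>j\<in>UNIV. (v $ j) *s axis j 1)"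
  by (simp add: vec_eq_iff axis_def if_distrib cong: if_cong)

lemma conj_linear_axis_expansion:
  fixes l :: "complex ^ 'n \<Rightarrow> complex"
  assumes add: "\<And>x y. l (x + y) = l x + l y" and scale: "\<And>c x. l (c *s x) = \<sigma> c * l x"
    and \<sigma>: "\<sigma> 0 = 0"
  shows "l v = (\<Sum>j\<in>UNIV. \<sigma> (v $ j) * l (axis j 1))"
proof -
  have 0: "l 0 = 0" using scale[of 0 0] \<sigma> by simp
  have "l (\<Sum>j\<in>I. (v $ j) *s axis j 1) = (\<Sum>j\<in>I. \<sigma> (v $ j) * l (axis j 1))" if "finite I" for I
    using that by (induction I rule: finite_induct) (simp_all add: 0 add scale)
  from this[of UNIV] have "l (\<Sum>j\<in>UNIV. (v $ j) *s axis j 1) = (\<Sum>j\<in>UNIV. \<sigma> (v $ j) * l (axis j 1))" by simp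
  then show ?thesis unfolding vec_axis_expansion[of v, symmetric] .
qed

lemmas complex_linear_axis_expansion = conj_linear_axis_expansion[where \<sigma> = "\<lambda>c. c", simplified]

text \<open>If \<open>\<beta>\<close> is the Hessian of a real function, \<open>sesq \<beta>\<close> is its Levi form; the complex bilinear remainder \<open>csym \<beta>\<close> can be
  removed by a quadratic holomorphic change of coordinates.\<close>

definition sesq :: "(complex ^ 'n \<Rightarrow> complex ^ 'n \<Rightarrow> real) \<Rightarrow> complex ^ 'n \<Rightarrow> complex ^ 'n \<Rightarrow> complex" where
  "sesq \<beta> x y = Complex ((\<beta> x y + \<beta> (\<i> *s x) (\<i> *s y)) / 4) ((\<beta> x (\<i> *s y) - \<beta> (\<i> *s x) y) / 4)"

definition csym :: "(complex ^ 'n \<Rightarrow> complex ^ 'n \<Rightarrow> real) \<Rightarrow> complex ^ 'n \<Rightarrow> complex ^ 'n \<Rightarrow> complex" where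
  "csym \<beta> x y = Complex ((\<beta> x y - \<beta> (\<i> *s x) (\<i> *s y)) / 4) (- (\<beta> (\<i> *s x) y + \<beta> x (\<i> *s y)) / 4)"

lemma scalar_i_i: "\<i> *s (\<i> *s x) = - (x :: complex ^ 'n)"
  by (simp add: vec_eq_iff)

lemma scalar_i_add: "\<i> *s (x + y) = \<i> *s x + \<i> *s (y :: complex ^ 'n)"
  by (simp add: vec_eq_iff algebra_simps)

lemma scalar_i_scaleR: "\<i> *s (r *\<^sub>R x) = r *\<^sub>R (\<i> *s (x :: complex ^ 'n))"
  by (simp add: vec_eq_iff)

context
  fixes \<beta> :: "complex ^ 'n \<Rightarrow> complex ^ 'n \<Rightarrow> real"
  assumes \<beta>: "bilinear \<beta>"
begin

lemmas bil_rules = bilinear_ladd[OF \<beta>] bilinear_radd[OF \<beta>] bilinear_lmul[OF \<beta>] bilinear_rmul[OF \<beta>]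
  bilinear_lneg[OF \<beta>] bilinear_rneg[OF \<beta>] bilinear_lsub[OF \<beta>] bilinear_rsub[OF \<beta>]

lemma sesq_add: "sesq \<beta> (x + y) z = sesq \<beta> x z + sesq \<beta> y z" "sesq \<beta> z (x + y) = sesq \<beta> z x + sesq \<beta> z y"
  by (simp_all add: sesq_def complex_eq_iff scalar_i_add bil_rules field_simps)

lemma csym_add: "csym \<beta> (x + y) z = csym \<beta> x z + csym \<beta> y z" "csym \<beta> z (x + y) = csym \<beta> z x + csym \<beta> z y"
  by (simp_all add: csym_def complex_eq_iff scalar_i_add bil_rules field_simps)

lemma sesq_scale: "sesq \<beta> (c *s x) y = c * sesq \<beta> x y" "sesq \<beta> x (c *s y) = cnj c * sesq \<beta> x y"
  unfolding complex_scalar_decomp[of c]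
  by (simp_all add: sesq_def complex_eq_iff scalar_i_add scalar_i_scaleR scalar_i_i bil_rules field_simps)

lemma csym_scale: "csym \<beta> (c *s x) y = c * csym \<beta> x y" "csym \<beta> x (c *s y) = c * csym \<beta> x y"
  unfolding complex_scalar_decomp[of c]
  by (simp_all add: csym_def complex_eq_iff scalar_i_add scalar_i_scaleR scalar_i_i bil_rules field_simps)

lemma quadratic_decomp: "\<beta> x x = 2 * Re (csym \<beta> x x) + 2 * Re (sesq \<beta> x x)"
  by (simp add: csym_def sesq_def field_simps)

lemma sesq_axis_expansion: "sesq \<beta> v v = (\<Sum>j\<in>UNIV. \<Sum>k\<in>UNIV. sesq \<beta> (axis j 1) (axis k 1) * v $ j * cnj (v $ k))"
proof -
  have "sesq \<beta> v v = (\<Sum>j\<in>UNIV. v $ j * sesq \<beta> (axis j 1) v)"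
    by (rule complex_linear_axis_expansion) (simp_all add: sesq_add sesq_scale)
  also have "\<dots> = (\<Sum>j\<in>UNIV. v $ j * (\<Sum>k\<in>UNIV. cnj (v $ k) * sesq \<beta> (axis j 1) (axis k 1)))"
    by (intro sum.cong arg_cong2[of _ _ _ _ "(*)"] refl conj_linear_axis_expansion) (simp_all add: sesq_add sesq_scale)
  finally show ?thesis by (simp add: sum_distrib_left mult_ac)
qed

lemma csym_matrix:
  "csym \<beta> (A *v x) (A *v x) = bil (\<chi> i j. csym \<beta> (A *v axis i 1) (A *v axis j 1)) x x"
proof -
  have Aadd: "A *v (x + y) = A *v x + A *v y" for x y by (simp add: matrix_vector_right_distrib)
  have Asc: "A *v (c *s x) = c *s (A *v x)" for c x by (simp add: vector_scalar_commute)
  have "csym \<beta> (A *v x) (A *v x) = (\<Sum>i\<in>UNIV. x $ i * csym \<beta> (A *v axis i 1) (A *v x))"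
    by (rule complex_linear_axis_expansion) (simp_all add: csym_add csym_scale Aadd Asc)
  also have "\<dots> = (\<Sum>i\<in>UNIV. x $ i * (\<Sum>j\<in>UNIV. x $ j * csym \<beta> (A *v axis i 1) (A *v axis j 1)))"
    by (intro sum.cong arg_cong2[of _ _ _ _ "(*)"] refl complex_linear_axis_expansion) (simp_all add: csym_add csym_scale Aadd Asc)
  finally show ?thesis by (simp add: bil_def matrix_vector_mult_def mult.commute)
qed

lemma sesq_hermitian:
  assumes s: "\<And>x y. \<beta> x y = \<beta> y x" shows "sesq \<beta> y x = cnj (sesq \<beta> x y)"
  by (simp add: sesq_def complex_eq_iff s[of y x] s[of y "\<i> *s x"] s[of "\<i> *s y" x] s[of "\<i> *s y" "\<i> *s x"] minus_divide_left)

end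

text \<open>Gram-Schmidt, one index at a time: fewer than \<open>CARD('n)\<close> vectors do not
  span, so a vector outside their span stays nonzero after its projections are subtracted. Indexing
  by \<open>'n\<close> lets the family serve as matrix columns.\<close>

lemma hermitian_orthonormal_family:
  fixes G :: "complex ^ 'n \<Rightarrow> complex ^ 'n \<Rightarrow> complex"
  assumes add: "\<And>x y z. G (x + y) z = G x z + G y z" and scale: "\<And>c x y. G (c *s x) y = c * G x y"
    and herm: "\<And>x y. G y x = cnj (G x y)" and pos: "\<And>x. x \<noteq> 0 \<Longrightarrow> Re (G x x) > 0"
  shows "finite I \<Longrightarrow> \<exists>b. \<forall>i\<in>I. \<forall>j\<in>I. G (b i) (b j) = (if i = (j :: 'n) then 1 else 0)"
proof (induction I rule: finite_induct)
  case (insert k I)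
  then obtain b where b: "\<And>i j. i \<in> I \<Longrightarrow> j \<in> I \<Longrightarrow> G (b i) (b j) = (if i = j then 1 else 0)" by blast
  have scale2: "G x (c *s y) = cnj c * G x y" for c x y
    unfolding herm[of x "c *s y"] scale complex_cnj_mult herm[of x y] by simp
  have G0: "G 0 y = 0" for y using scale[of 0 0 y] by simp
  have diff: "G (x - y) z = G x z - G y z" for x y z using add[of "x - y" y z] by simp
  have Gsum: "G (\<Sum>i\<in>J. f i) y = (\<Sum>i\<in>J. G (f i) y)" for f :: "'n \<Rightarrow> complex ^ 'n" and J y
    by (induction J rule: infinite_finite_induct) (simp_all add: G0 add)
  have "vec.span (b ` I) \<noteq> UNIV"
  proof
    assume "vec.span (b ` I) = UNIV"
    then have "vec.dim (UNIV :: (complex ^ 'n) set) \<le> card (b ` I)"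
      by (intro vec.dim_le_card) (use insert.hyps in auto)
    also have "\<dots> \<le> card I" by (rule card_image_le) (rule insert.hyps)
    also have "\<dots> < CARD('n)" using insert.hyps by (intro psubset_card_mono) auto
    finally show False unfolding vec_dim_card by simp
  qed
  then obtain v where v: "v \<notin> vec.span (b ` I)" by blast
  define u where "u = v - (\<Sum>i\<in>I. G v (b i) *s b i)"
  have "(\<Sum>i\<in>I. G v (b i) *s b i) \<in> vec.span (b ` I)"
    by (intro vec.span_sum vec.span_scale vec.span_base) auto
  then have u0: "u \<noteq> 0" using v by (auto simp: u_def)
  have ub: "G u (b j) = 0" if "j \<in> I" for j
  proof -
    have "(\<Sum>i\<in>I. G (G v (b i) *s b i) (b j)) = (\<Sum>i\<in>I. if i = j then G v (b i) else 0)"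
      by (rule sum.cong) (use that b in \<open>auto simp: scale\<close>)
    then show ?thesis using that insert.hyps by (simp add: u_def diff Gsum)
  qed
  define r where "r = Re (G u u)"
  have r: "r > 0" using pos[OF u0] by (simp add: r_def)
  have "Im (G u u) = 0" using herm[of u u] by (simp add: complex_eq_iff)
  then have Gu: "G u u = of_real r" by (simp add: r_def complex_eq_iff)
  define w where "w = of_real (1 / sqrt r) *s u"
  have ww: "G w w = 1"
  proof -
    have "G w w = of_real (1 / sqrt r * (1 / sqrt r) * r)"
      unfolding w_def scale scale2 Gu by (simp only: complex_cnj_complex_of_real of_real_mult mult.assoc)
    also have "1 / sqrt r * (1 / sqrt r) * r = 1" using r by simp
    finally show ?thesis by simp
  qed
  have wb: "G w (b j) = 0" "G (b j) w = 0" if "j \<in> I" for j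
    using ub[OF that] herm[of "b j" w] by (simp_all add: w_def scale scale2 herm[of u "b j"])
  have "\<forall>i\<in>insert k I. \<forall>j\<in>insert k I. G ((b(k := w)) i) ((b(k := w)) j) = (if i = j then 1 else 0)"
    using b ww wb insert.hyps by auto
  then show ?case by blast
qed simp

text \<open>The columns of \<open>Mi\<close> form an orthonormal basis for \<open>G\<close>; the
  resulting identity makes the kernel of \<open>Mi\<close> trivial, hence \<open>Mi\<close>
  invertible.\<close>

lemma hermitian_normalisation:
  fixes G :: "complex ^ 'n \<Rightarrow> complex ^ 'n \<Rightarrow> complex"
  assumes add: "\<And>x y z. G (x + y) z = G x z + G y z" and scale: "\<And>c x y. G (c *s x) y = c * G x y"
    and herm: "\<And>x y. G y x = cnj (G x y)" and pos: "\<And>x. x \<noteq> 0 \<Longrightarrow> Re (G x x) > 0"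
  shows "\<exists>M Mi :: complex ^ 'n ^ 'n. Mi ** M = mat 1 \<and> M ** Mi = mat 1 \<and> (\<forall>x. G (Mi *v x) (Mi *v x) = of_real ((norm x)\<^sup>2))"
proof -
  obtain b where b: "\<And>i j :: 'n. G (b i) (b j) = (if i = j then 1 else 0)"
    using hermitian_orthonormal_family[OF add scale herm pos, of UNIV] by auto
  define Mi :: "complex ^ 'n ^ 'n" where "Mi = (\<chi> a i. b i $ a)"
  have Mib: "Mi *v axis i 1 = b i" for i
    by (simp add: Mi_def vec_eq_iff matrix_vector_mult_def axis_def if_distrib cong: if_cong)
  have Madd: "Mi *v (x + y) = Mi *v x + Mi *v y" for x y by (simp add: matrix_vector_right_distrib)
  have Msc: "Mi *v (c *s x) = c *s (Mi *v x)" for c x by (simp add: vector_scalar_commute)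
  have add2: "G z (x + y) = G z x + G z y" for x y z
    unfolding herm[of z "x + y"] add complex_cnj_add herm[of z x] herm[of z y] by simp
  have scale2: "G x (c *s y) = cnj c * G x y" for c x y
    unfolding herm[of x "c *s y"] scale complex_cnj_mult herm[of x y] by simp
  have norm: "G (Mi *v x) (Mi *v x) = of_real ((norm x)\<^sup>2)" for x
  proof -
    have "G (Mi *v x) (Mi *v x) = (\<Sum>i\<in>UNIV. x $ i * G (Mi *v axis i 1) (Mi *v x))"
      by (rule complex_linear_axis_expansion) (simp_all add: add scale Madd Msc)
    also have "\<dots> = (\<Sum>i\<in>UNIV. x $ i * (\<Sum>j\<in>UNIV. cnj (x $ j) * G (Mi *v axis i 1) (Mi *v axis j 1)))"
      by (intro sum.cong arg_cong2[of _ _ _ _ "(*)"] refl conj_linear_axis_expansion) (simp_all add: add2 scale2 Madd Msc)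
    also have "\<dots> = hip x x" unfolding Mib b hip_def by (simp add: if_distrib cong: if_cong)
    finally show ?thesis by (simp only: hip_self)
  qed
  have "\<exists>M. M ** Mi = mat 1"
    unfolding matrix_left_invertible_ker
  proof (intro allI impI)
    fix x assume "Mi *v x = 0"
    then have "of_real ((norm x)\<^sup>2) = G 0 0" using norm[of x] by simp
    also have "G 0 0 = 0" using scale[of 0 0 0] by simp
    finally show "x = 0" by simp
  qed
  then obtain M where "M ** Mi = mat 1" by blast
  then show ?thesis using norm matrix_left_right_inverse by blast
qed

text \<open>The set where \<open>f <= 0\<close> is compact and \<open>g\<close> has a positive
  minimum there, so a large multiple of \<open>g\<close> outweighs the minimum of
  \<open>f\<close>.\<close>

lemma compact_positive_combination:
  fixes f g :: "'a::topological_space \<Rightarrow> real"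
  assumes S: "compact S" and f: "continuous_on S f" and g: "continuous_on S g"
    and g0: "\<And>v. v \<in> S \<Longrightarrow> g v \<ge> 0" and fg: "\<And>v. v \<in> S \<Longrightarrow> g v = 0 \<Longrightarrow> f v > 0"
  shows "\<exists>c\<ge>0. \<forall>v\<in>S. f v + c * g v > 0"
proof -
  define K where "K = S \<inter> f -` {..0}"
  have K: "compact K"
  proof -
    obtain C where "closed C" "C \<inter> S = f -` {..0} \<inter> S"
      using f[unfolded continuous_on_closed_invariant] closed_atMost by blast
    then show ?thesis using compact_Int_closed[OF S, of C] by (simp add: K_def Int_commute)
  qed
  show ?thesis
  proof (cases "K = {}")
    case True
    then show ?thesis by (intro exI[of _ 0]) (auto simp: K_def not_le[symmetric])
  next
    case False
    have KS: "K \<subseteq> S" by (auto simp: K_def)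
    obtain x where x: "x \<in> K" "\<And>y. y \<in> K \<Longrightarrow> g x \<le> g y"
      using continuous_attains_inf[OF K False continuous_on_subset[OF g KS]] by blast
    obtain y where y: "y \<in> K" "\<And>z. z \<in> K \<Longrightarrow> f y \<le> f z"
      using continuous_attains_inf[OF K False continuous_on_subset[OF f KS]] by blast
    have gx: "g x > 0" using x(1) g0[of x] fg[of x] by (force simp: K_def)
    \<comment> \<open>Chosen so that \<open>f + c * g >= 1\<close> wherever
      \<open>f <= 0\<close>.\<close>
    define c where "c = (1 - f y) / g x"
    have c: "c > 0" using y(1) gx by (simp add: c_def K_def)
    have "f v + c * g v > 0" if v: "v \<in> S" for v
    proof (cases "v \<in> K")
      case True
      have "c * g x \<le> c * g v" using x(2)[OF True] c by simp
      moreover have "c * g x = 1 - f y" using gx by (simp add: c_def)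
      ultimately show ?thesis using y(2)[OF True] by linarith
    next
      case False
      then have "f v > 0" using v by (auto simp: K_def)
      moreover have "c * g v \<ge> 0" using c g0[OF v] by simp
      ultimately show ?thesis by linarith
    qed
    then show ?thesis using c by (intro exI[of _ c]) auto
  qed
qed

lemma second_order_Taylor:
  fixes \<phi> :: "real \<Rightarrow> real"
  assumes 1: "\<And>s. 0 \<le> s \<Longrightarrow> s \<le> 1 \<Longrightarrow> (\<phi> has_real_derivative \<phi>' s) (at s)"
    and 2: "\<And>s. 0 \<le> s \<Longrightarrow> s \<le> 1 \<Longrightarrow> (\<phi>' has_real_derivative \<phi>'' s) (at s)"
    and b: "\<And>s. 0 \<le> s \<Longrightarrow> s \<le> 1 \<Longrightarrow> \<bar>\<phi>'' s - 2 * k\<bar> \<le> 2 * e"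
  shows "\<bar>\<phi> 1 - \<phi> 0 - \<phi>' 0 - k\<bar> \<le> e"
proof -
  define diff where "diff m = (if m = 0 then \<phi> else if m = 1 then \<phi>' else \<phi>'')" for m :: nat
  have "\<exists>t::real. 0 < t \<and> t < 1 \<and> \<phi> 1 = (\<Sum>m<2. diff m 0 / fact m * 1 ^ m) + diff 2 t / fact 2 * 1 ^ 2"
  proof (rule Maclaurin)
    show "\<forall>m t. m < 2 \<and> 0 \<le> t \<and> t \<le> 1 \<longrightarrow> (diff m has_real_derivative diff (Suc m) t) (at t)"
    proof (intro allI impI)
      fix m :: nat and t :: real assume mt: "m < 2 \<and> 0 \<le> t \<and> t \<le> 1"
      then have "m = 0 \<or> m = 1" by auto
      then show "(diff m has_real_derivative diff (Suc m) t) (at t)" using mt 1 2 by (auto simp: diff_def)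
    qed
  qed (auto simp: diff_def)
  then obtain t where t: "0 < t" "t < 1" "\<phi> 1 = \<phi> 0 + \<phi>' 0 + \<phi>'' t / 2" by (auto simp: diff_def numeral_2_eq_2)
  then show ?thesis using b[of t] by (simp add: abs_le_iff)
qed

lemma isCont_imp_tendsto_nhds: "isCont f x \<Longrightarrow> (f \<longlongrightarrow> f x) (nhds x)"
  by (simp add: isCont_def tendsto_at_iff_tendsto_nhds)

section \<open>Levi form and complex gradient through real derivatives\<close>

lemma wirtinger_of_real:
  assumes "(r has_derivative r') (at z)"
  shows "wirtinger j (\<lambda>z. complex_of_real (r z)) z = Complex (r' (axis j 1) / 2) (- r' (axis j \<i>) / 2)"
    "wirtinger_bar j (\<lambda>z. complex_of_real (r z)) z = Complex (r' (axis j 1) / 2) (r' (axis j \<i>) / 2)"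
proof -
  have "((\<lambda>z. complex_of_real (r z)) has_derivative (\<lambda>v. of_real (r' v))) (at z)"
    by (rule bounded_linear.has_derivative[OF bounded_linear_of_real assms])
  then have fd: "frechet_derivative (\<lambda>z. complex_of_real (r z)) (at z) = (\<lambda>v. of_real (r' v))"
    by (rule frechet_derivative_at[symmetric])
  show "wirtinger j (\<lambda>z. complex_of_real (r z)) z = Complex (r' (axis j 1) / 2) (- r' (axis j \<i>) / 2)"
    "wirtinger_bar j (\<lambda>z. complex_of_real (r z)) z = Complex (r' (axis j 1) / 2) (r' (axis j \<i>) / 2)"
    by (simp_all add: wirtinger_def wirtinger_bar_def fd complex_eq_iff)
qed

lemma scalar_i_axis: "\<i> *s axis j 1 = (axis j \<i> :: complex ^ 'n)"
  by (simp add: vec_eq_iff axis_def)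

lemma bilinear_blinfun: "bilinear (\<lambda>h k. blinfun_apply (blinfun_apply B h) k)"
  unfolding bilinear_def
proof (intro conjI allI)
  show "linear (\<lambda>k. blinfun_apply (blinfun_apply B h) k)" for h
    by (rule bounded_linear.linear[OF blinfun.bounded_linear_right])
  show "linear (\<lambda>h. blinfun_apply (blinfun_apply B h) k)" for k
    by (rule linearI) (simp_all add: blinfun.add_right blinfun.scaleR_right blinfun.add_left blinfun.scaleR_left)
qed

text \<open>Both sides expand over the coordinate axes, so coefficients are compared. The inner
  Wirtinger derivative must be known on a neighbourhood of \<open>p\<close> before the outer one is
  taken, hence the open set \<open>U\<close>.\<close>

lemma levi_form_eq_sesq:
  fixes r :: "complex ^ 'n \<Rightarrow> real" and r' :: "complex ^ 'n \<Rightarrow> (complex ^ 'n) \<Rightarrow>\<^sub>L real"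
  assumes U: "open U" "p \<in> U" and r': "\<And>z. z \<in> U \<Longrightarrow> (r has_derivative blinfun_apply (r' z)) (at z)"
    and r'': "(r' has_derivative blinfun_apply B) (at p)"
  shows "levi_form r p v = Re (sesq (\<lambda>h k. blinfun_apply (blinfun_apply B h) k) v v)"
proof -
  let ?\<beta> = "\<lambda>h k. blinfun_apply (blinfun_apply B h) k"
  have bilb: "bilinear ?\<beta>" by (rule bilinear_blinfun)
  have ev: "((\<lambda>z. blinfun_apply (r' z) k) has_derivative (\<lambda>h. ?\<beta> h k)) (at p)" for k
    by (rule bounded_linear.has_derivative[OF blinfun.bounded_linear_left r''])
  have "wirtinger j (wirtinger_bar k (\<lambda>z. complex_of_real (r z))) p = sesq ?\<beta> (axis j 1) (axis k 1)" for j k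
  proof -
    have "((\<lambda>z. of_real (blinfun_apply (r' z) (axis k 1)) / 2 + \<i> * (of_real (blinfun_apply (r' z) (axis k \<i>)) / 2)) has_derivative
        (\<lambda>h. of_real (?\<beta> h (axis k 1)) / 2 + \<i> * (of_real (?\<beta> h (axis k \<i>)) / 2))) (at p)"
      by (intro has_derivative_add has_derivative_mult_right bounded_linear.has_derivative[OF bounded_linear_divide] bounded_linear.has_derivative[OF bounded_linear_of_real] ev)
    then have "(wirtinger_bar k (\<lambda>z. complex_of_real (r z)) has_derivative
        (\<lambda>h. of_real (?\<beta> h (axis k 1)) / 2 + \<i> * (of_real (?\<beta> h (axis k \<i>)) / 2))) (at p)"
      by (rule has_derivative_transform_within_open[OF _ U])
        (simp add: wirtinger_of_real(2)[OF r'] complex_eq_iff)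
    then have fd: "frechet_derivative (wirtinger_bar k (\<lambda>z. complex_of_real (r z))) (at p) =
        (\<lambda>h. of_real (?\<beta> h (axis k 1)) / 2 + \<i> * (of_real (?\<beta> h (axis k \<i>)) / 2))"
      by (rule frechet_derivative_at[symmetric])
    show ?thesis
      unfolding wirtinger_def fd by (simp add: sesq_def scalar_i_axis complex_eq_iff field_simps)
  qed
  then show ?thesis unfolding levi_form_def sesq_axis_expansion[OF bilb] by simp
qed

text \<open>The complex linear form with \<open>f = 2 Re (clin f)\<close>, for real linear \<open>f\<close>.\<close>

definition clin :: "(complex ^ 'n \<Rightarrow> real) \<Rightarrow> complex ^ 'n \<Rightarrow> complex" where
  "clin f v = Complex (f v / 2) (- f (\<i> *s v) / 2)"

lemma clin_linear:
  assumes "linear f"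
  shows "clin f (x + y) = clin f x + clin f y" "clin f (c *s x) = c * clin f x"
proof -
  show "clin f (x + y) = clin f x + clin f y"
    by (simp add: clin_def complex_eq_iff scalar_i_add linear_add[OF assms] field_simps)
  show "clin f (c *s x) = c * clin f x"
    unfolding complex_scalar_decomp[of c x]
    by (simp add: clin_def complex_eq_iff scalar_i_add scalar_i_scaleR scalar_i_i linear_add[OF assms] linear_scale[OF assms] linear_neg[OF assms] linear_diff[OF assms] field_simps)
qed

lemma complex_tangent_eq_clin:
  assumes "(r has_derivative r') (at p)"
  shows "v \<in> complex_tangent r p \<longleftrightarrow> clin r' v = 0"
proof -
  have lin: "linear r'" using assms has_derivative_linear by blast
  have "clin r' v = (\<Sum>j\<in>UNIV. v $ j * clin r' (axis j 1))"
    by (rule complex_linear_axis_expansion) (simp_all add: clin_linear[OF lin])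
  then show ?thesis
    by (simp add: complex_tangent_def wirtinger_of_real(1)[OF assms] clin_def scalar_i_axis mult.commute)
qed

text \<open>Adding a multiple of \<open>r^2\<close> to \<open>r\<close> extends positivity from the
  complex tangent space to all vectors: the Levi form of \<open>r^2\<close> at \<open>q\<close> is
  nonnegative and vanishes only on that space. As \<open>\<rho> = r (1 + 2 c r)\<close>, the domain
  near \<open>q\<close> is unchanged.\<close>

theorem strict_boundary_point_exists:
  assumes D: "open D" "strictly_pseudoconvex D" and q: "q \<in> frontier D"
  shows "\<exists>\<rho> M Mi N n R. strict_boundary_point D q \<rho> M Mi N n R"
proof -
  obtain U r where def: "C2_defining_near D q U r"
    and levi: "\<And>v. v \<in> complex_tangent r q \<Longrightarrow> v \<noteq> 0 \<Longrightarrow> levi_form r q v > 0"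
    using D(2) q unfolding strictly_pseudoconvex_def by metis
  then have U: "open U" "q \<in> U" and DU: "D \<inter> U = {z \<in> U. r z < 0}" and C2: "C2_on r U"
    and nz: "\<And>z. z \<in> U \<Longrightarrow> frechet_derivative r (at z) \<noteq> (\<lambda>_. 0)" unfolding C2_defining_near_def by blast+
  obtain r' r'' where r': "\<And>z. z \<in> U \<Longrightarrow> (r has_derivative blinfun_apply (r' z)) (at z)"
    and r'': "\<And>z. z \<in> U \<Longrightarrow> (r' has_derivative blinfun_apply (r'' z)) (at z)" and cr'': "continuous_on U r''"
    using C2 unfolding C2_on_def by metis
  have c_r: "isCont r z" and c_r': "isCont r' z" and c_r'': "isCont r'' z" if "z \<in> U" for z
    using has_derivative_continuous[OF r'[OF that]] has_derivative_continuous[OF r''[OF that]]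
      cr'' U(1) that continuous_on_eq_continuous_at by blast+
  have rq: "r q = 0"
  proof -
    have "q \<notin> D" "q \<in> closure D" using q D(1) by (auto simp: frontier_def interior_open)
    then have "r q \<ge> 0" using DU U(2) by force
    moreover have "r q \<le> 0"
    proof (rule ccontr)
      assume "\<not> r q \<le> 0"
      have "open (U \<inter> r -` {0<..})"
        by (rule continuous_open_preimage[OF _ U(1)]) (auto intro: continuous_at_imp_continuous_on c_r)
      moreover have "q \<in> U \<inter> r -` {0<..}" using U(2) \<open>\<not> r q \<le> 0\<close> by simp
      moreover have "r x < 0" if "x \<in> D" "x \<in> U" for x using DU that by blast
      then have "D \<inter> (U \<inter> r -` {0<..}) = {}" by force
      ultimately show False using \<open>q \<in> closure D\<close> open_Int_closure_eq_empty by blast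
    qed
    ultimately show ?thesis by simp
  qed
  define b where "b h k = blinfun_apply (blinfun_apply (r'' q) h) k" for h k
  define g where "g h = blinfun_apply (r' q) h" for h
  have bb: "bilinear b" unfolding b_def by (rule bilinear_blinfun)
  have lg: "linear g" unfolding g_def by (rule bounded_linear.linear[OF blinfun.bounded_linear_right])
  have cb: "continuous_on A (\<lambda>v. b (f v) (h v))" if "continuous_on A f" "continuous_on A h" for A and f h :: "complex ^ 'a \<Rightarrow> complex ^ 'a"
    unfolding b_def using that by (intro continuous_intros)
  have cg: "continuous_on A (\<lambda>v. g (f v))" if "continuous_on A f" for A and f :: "complex ^ 'a \<Rightarrow> complex ^ 'a"
    unfolding g_def using that by (intro continuous_intros)
  have levi_b: "levi_form r q v = Re (sesq b v v)" for v
    unfolding b_def by (rule levi_form_eq_sesq[OF U r' r''[OF U(2)]])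
  define lev where "lev v = (b v v + b (\<i> *s v) (\<i> *s v)) / 4" for v
  \<comment> \<open>Four times the squared modulus of \<open>clin g v\<close>, hence zero only on
    complex tangent vectors.\<close>
  define gg where "gg v = (g v)\<^sup>2 + (g (\<i> *s v))\<^sup>2" for v
  have "\<exists>c\<ge>0. \<forall>v\<in>sphere 0 1. lev v + c * gg v > 0"
  proof (rule compact_positive_combination[OF compact_sphere])
    show "continuous_on (sphere 0 1) lev" unfolding lev_def by (intro continuous_intros cb) auto
    show "continuous_on (sphere 0 1) gg" unfolding gg_def by (intro continuous_intros cg)
    show "gg v \<ge> 0" for v by (simp add: gg_def)
    fix v assume v: "v \<in> sphere 0 1" "gg v = 0"
    then have "g v = 0" "g (\<i> *s v) = 0" by (auto simp: gg_def add_nonneg_eq_0_iff)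
    then have "clin g v = 0" by (simp add: clin_def complex_eq_iff)
    then have "v \<in> complex_tangent r q"
      using complex_tangent_eq_clin[OF r'[OF U(2)]] by (simp add: g_def[abs_def])
    moreover have "v \<noteq> 0" using v by auto
    ultimately have "levi_form r q v > 0" by (rule levi)
    then show "lev v > 0" by (simp add: levi_b sesq_def lev_def)
  qed
  then obtain c where c: "c \<ge> 0" "\<And>v. norm v = 1 \<Longrightarrow> lev v + c * gg v > 0" by auto
  \<comment> \<open>The Hessian of \<open>\<rho>\<close> at \<open>q\<close>, symmetrised so that
    \<open>sesq \<beta>\<close> is Hermitian. The Taylor expansion involves only the diagonal values
    \<open>\<beta> h h\<close>, which symmetrising does not change.\<close>
  define \<beta> where "\<beta> h k = (b h k + b k h) / 2 + 4 * c * (g h * g k)" for h k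
  have b\<beta>: "bilinear \<beta>"
  proof -
    have "linear (\<lambda>k. \<beta> h k)" for h
      by (rule linearI) (simp_all add: \<beta>_def bilinear_ladd[OF bb] bilinear_radd[OF bb] bilinear_lmul[OF bb] bilinear_rmul[OF bb]
          linear_add[OF lg] linear_scale[OF lg] field_simps)
    moreover have "linear (\<lambda>h. \<beta> h k)" for k
      by (rule linearI) (simp_all add: \<beta>_def bilinear_ladd[OF bb] bilinear_radd[OF bb] bilinear_lmul[OF bb] bilinear_rmul[OF bb]
          linear_add[OF lg] linear_scale[OF lg] field_simps)
    ultimately show ?thesis unfolding bilinear_def by blast
  qed
  have sym: "\<beta> h k = \<beta> k h" for h k by (simp add: \<beta>_def)
  have pos: "Re (sesq \<beta> v v) > 0" if "v \<noteq> 0" for v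
  proof -
    define w where "w = (1 / norm v) *\<^sub>R v"
    have w: "norm w = 1" "v = of_real (norm v) *s w" using that by (simp_all add: w_def scalar_of_real)
    have "Re (sesq \<beta> w w) = lev w + c * gg w"
      by (simp add: sesq_def \<beta>_def lev_def gg_def power2_eq_square field_simps)
    then have "Re (sesq \<beta> w w) > 0" using c(2)[OF w(1)] by simp
    moreover have "sesq \<beta> v v = of_real ((norm v)\<^sup>2) * sesq \<beta> w w"
      by (subst (1 2) w(2)) (simp add: sesq_scale[OF b\<beta>] power2_eq_square)
    ultimately show ?thesis using that by simp
  qed
  obtain M Mi :: "complex ^ 'a ^ 'a" where M: "Mi ** M = mat 1" "M ** Mi = mat 1"
    and norm: "\<And>x. sesq \<beta> (Mi *v x) (Mi *v x) = of_real ((norm x)\<^sup>2)"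
    using hermitian_normalisation[of "sesq \<beta>", OF sesq_add(1)[OF b\<beta>] sesq_scale(1)[OF b\<beta>] sesq_hermitian[OF b\<beta> sym] pos] by blast
  define N where "N = (\<chi> i j. csym \<beta> (Mi *v axis i 1) (Mi *v axis j 1))"
  have H: "\<beta> (Mi *v x) (Mi *v x) / 2 = Re (bil N x x) + (norm x)\<^sup>2" for x
    using quadratic_decomp[OF b\<beta>, of "Mi *v x"] norm[of x] csym_matrix[OF b\<beta>, of Mi x] by (simp add: N_def)
  define \<rho> where "\<rho> z = r z + 2 * c * (r z)\<^sup>2" for z
  define \<rho>' where "\<rho>' z h = (1 + 4 * c * r z) * blinfun_apply (r' z) h" for z h
  \<comment> \<open>The complex gradient of \<open>\<rho>\<close> at \<open>z\<close> in the
    coordinates \<open>x\<close>, conjugated because \<open>hip\<close> is conjugate linear in its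
    second argument.\<close>
  define n where "n z = (\<chi> i. cnj (clin (\<rho>' z) (Mi *v axis i 1)))" for z
  have l\<rho>': "linear (\<rho>' z)" for z
    unfolding \<rho>'_def by (rule linearI) (simp_all add: blinfun.add_right blinfun.scaleR_right algebra_simps)
  have hn: "2 * Re (hip x (n z)) = \<rho>' z (Mi *v x)" for x z
  proof -
    have "clin (\<rho>' z) (Mi *v x) = (\<Sum>j\<in>UNIV. x $ j * clin (\<rho>' z) (Mi *v axis j 1))"
      by (rule complex_linear_axis_expansion[of "\<lambda>x. clin (\<rho>' z) (Mi *v x)"])
        (simp_all add: matrix_vector_right_distrib vector_scalar_commute clin_linear[OF l\<rho>'])
    then have "hip x (n z) = clin (\<rho>' z) (Mi *v x)" by (simp add: hip_def n_def)
    then show ?thesis by (simp add: clin_def)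
  qed
  have n_cont: "isCont n q"
  proof -
    have c: "isCont (\<lambda>z. \<rho>' z h) q" for h
      unfolding \<rho>'_def by (intro continuous_intros c_r c_r' U(2))
    have "n z $ i = of_real (\<rho>' z (Mi *v axis i 1) / 2) + \<i> * of_real (\<rho>' z (\<i> *s (Mi *v axis i 1)) / 2)" for z i
      by (simp add: n_def clin_def complex_eq_iff)
    then have "isCont (\<lambda>z. n z $ i) q" for i
      by (simp only:) (intro continuous_intros c, simp_all)
    then show ?thesis unfolding continuous_at by (rule vec_tendstoI)
  qed
  have n_q: "n q \<noteq> 0"
  proof
    assume "n q = 0"
    then have "\<rho>' q (Mi *v (M *v h)) = 0" for h using hn[of "M *v h" q] by simp
    then have "blinfun_apply (r' q) h = 0" for h by (simp add: \<rho>'_def rq matrix_vector_mul_assoc M)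
    then have "frechet_derivative r (at q) = (\<lambda>_. 0)" using frechet_derivative_at[OF r'[OF U(2)]] by (simp add: fun_eq_iff)
    then show False using nz[OF U(2)] by blast
  qed
  \<comment> \<open>On this ball \<open>\<rho>\<close> and \<open>r\<close> have the same
    sign.\<close>
  obtain R where R: "R > 0" "ball q R \<subseteq> U" "\<And>z. z \<in> ball q R \<Longrightarrow> 1 + 2 * c * r z > 0"
  proof -
    have "isCont (\<lambda>z. 1 + 2 * c * r z) q" by (intro continuous_intros c_r U(2))
    from isCont_imp_tendsto_nhds[OF this] have "\<forall>\<^sub>F z in nhds q. 1 + 2 * c * r z > 0"
      by (rule order_tendstoD(1)) (simp add: rq)
    moreover have "\<forall>\<^sub>F z in nhds q. z \<in> U" using U by (rule eventually_nhds_in_open)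
    ultimately have "\<forall>\<^sub>F z in nhds q. 1 + 2 * c * r z > 0 \<and> z \<in> U" by (rule eventually_conj)
    then obtain d where "d > 0" "\<And>z. dist z q < d \<Longrightarrow> 1 + 2 * c * r z > 0 \<and> z \<in> U"
      unfolding eventually_nhds_metric by blast
    then show thesis by (intro that[of d]) (auto simp: dist_commute)
  qed
  \<comment> \<open>Bounds the deviation of the second order form of \<open>\<rho>\<close> at
    \<open>y\<close> from that at \<open>q\<close>, with one summand each for \<open>r\<close> times
    \<open>r''\<close>, for \<open>r''\<close>, and for the square of \<open>r'\<close>. It tends to
    0 by \<open>C^2\<close> regularity and \<open>r q = 0\<close>.\<close>
  define E where "E y = 4 * c * \<bar>r y\<bar> * norm (r'' y) + norm (r'' y - r'' q) + 4 * c * (norm (r' y - r' q) * (norm (r' y) + norm (r' q)))" for y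
  have second: "\<bar>((1 + 4 * c * r y) * blinfun_apply (blinfun_apply (r'' y) h) h + 4 * c * (blinfun_apply (r' y) h)\<^sup>2) - \<beta> h h\<bar> \<le> E y * (norm h)\<^sup>2" for y h
  proof -
    let ?B = "blinfun_apply (blinfun_apply (r'' y) h) h" and ?Bq = "blinfun_apply (blinfun_apply (r'' q) h) h"
    let ?g = "blinfun_apply (r' y) h" and ?gq = "blinfun_apply (r' q) h"
    have n2: "\<bar>blinfun_apply (blinfun_apply X h) h\<bar> \<le> norm X * (norm h)\<^sup>2" for X :: "(complex ^ 'a) \<Rightarrow>\<^sub>L (complex ^ 'a) \<Rightarrow>\<^sub>L real"
    proof -
      have "\<bar>blinfun_apply (blinfun_apply X h) h\<bar> \<le> norm (blinfun_apply X h) * norm h"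
        using norm_blinfun[of "blinfun_apply X h" h] by simp
      also have "\<dots> \<le> norm X * norm h * norm h" by (intro mult_right_mono norm_blinfun) simp
      finally show ?thesis by (simp add: power2_eq_square mult.assoc)
    qed
    have n1: "\<bar>blinfun_apply X h\<bar> \<le> norm X * norm h" for X :: "(complex ^ 'a) \<Rightarrow>\<^sub>L real"
      using norm_blinfun[of X h] by simp
    have "\<bar>4 * c * r y * ?B\<bar> \<le> 4 * c * \<bar>r y\<bar> * (norm (r'' y) * (norm h)\<^sup>2)"
    proof -
      have "\<bar>4 * c * r y * ?B\<bar> = 4 * c * \<bar>r y\<bar> * \<bar>?B\<bar>" using c(1) by (simp add: abs_mult)
      also have "\<dots> \<le> 4 * c * \<bar>r y\<bar> * (norm (r'' y) * (norm h)\<^sup>2)"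
        using c(1) by (intro mult_left_mono n2) auto
      finally show ?thesis .
    qed
    moreover have "\<bar>?B - ?Bq\<bar> \<le> norm (r'' y - r'' q) * (norm h)\<^sup>2"
      using n2[of "r'' y - r'' q"] by (simp add: blinfun.diff_left)
    moreover have "\<bar>4 * c * (?g\<^sup>2 - ?gq\<^sup>2)\<bar> \<le> 4 * c * (norm (r' y - r' q) * (norm (r' y) + norm (r' q)) * (norm h)\<^sup>2)"
    proof -
      have "?g\<^sup>2 - ?gq\<^sup>2 = (?g - ?gq) * (?g + ?gq)" by (simp add: power2_eq_square algebra_simps)
      then have "\<bar>?g\<^sup>2 - ?gq\<^sup>2\<bar> = \<bar>?g - ?gq\<bar> * \<bar>?g + ?gq\<bar>" by (simp add: abs_mult)
      also have "\<dots> \<le> (norm (r' y - r' q) * norm h) * ((norm (r' y) + norm (r' q)) * norm h)"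
      proof (rule mult_mono)
        show "\<bar>?g - ?gq\<bar> \<le> norm (r' y - r' q) * norm h" using n1[of "r' y - r' q"] by (simp add: blinfun.diff_left)
        show "\<bar>?g + ?gq\<bar> \<le> (norm (r' y) + norm (r' q)) * norm h" using n1[of "r' y"] n1[of "r' q"] by (simp add: distrib_right)
      qed auto
      also have "\<dots> = norm (r' y - r' q) * (norm (r' y) + norm (r' q)) * (norm h)\<^sup>2" by (simp add: power2_eq_square)
      finally show ?thesis using c(1) by (simp add: abs_mult mult_left_mono)
    qed
    ultimately have "\<bar>4 * c * r y * ?B + (?B - ?Bq) + 4 * c * (?g\<^sup>2 - ?gq\<^sup>2)\<bar> \<le> 4 * c * \<bar>r y\<bar> * (norm (r'' y) * (norm h)\<^sup>2)
        + norm (r'' y - r'' q) * (norm h)\<^sup>2 + 4 * c * (norm (r' y - r' q) * (norm (r' y) + norm (r' q)) * (norm h)\<^sup>2)"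
      by linarith
    moreover have "(1 + 4 * c * r y) * ?B + 4 * c * ?g\<^sup>2 - \<beta> h h = 4 * c * r y * ?B + (?B - ?Bq) + 4 * c * (?g\<^sup>2 - ?gq\<^sup>2)"
      by (simp add: \<beta>_def b_def g_def power2_eq_square algebra_simps)
    ultimately show ?thesis by (simp add: E_def algebra_simps)
  qed
  have "isCont E q" unfolding E_def by (intro continuous_intros c_r c_r' c_r'' U(2))
  from isCont_imp_tendsto_nhds[OF this] have Elim: "(E \<longlongrightarrow> 0) (nhds q)"
    by (simp add: E_def rq)
  obtain K where K: "K > 0" "\<And>x. norm (Mi *v x) \<le> norm x * K"
    using bounded_linear.pos_bounded[OF bounded_linear_matrix_vector[of Mi]] by blast
  have expansion: "\<exists>d>0. \<forall>z\<in>ball q d. \<forall>x. norm x < d \<longrightarrow>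
      \<bar>\<rho> (z + Mi *v x) - \<rho> z - 2 * Re (hip x (n z)) - Re (bil N x x) - (norm x)\<^sup>2\<bar> \<le> e * (norm x)\<^sup>2" if e: "e > 0" for e
  proof -
    \<comment> \<open>Compensates the factor 1/2 of Taylor's formula and the norm bound
      \<open>K\<close> of \<open>Mi\<close>.\<close>
    define e' where "e' = 2 * e / K\<^sup>2"
    have e': "e' > 0" using e K(1) by (simp add: e'_def)
    have "\<forall>\<^sub>F y in nhds q. E y < e'" using order_tendstoD(2)[OF Elim e'] .
    moreover have "\<forall>\<^sub>F z in nhds q. z \<in> U" using U by (rule eventually_nhds_in_open)
    ultimately have "\<forall>\<^sub>F z in nhds q. E z < e' \<and> z \<in> U" by (rule eventually_conj)
    then obtain d0 where d0: "d0 > 0" "\<And>y. dist y q < d0 \<Longrightarrow> E y < e' \<and> y \<in> U"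
      unfolding eventually_nhds_metric by blast
    \<comment> \<open>Half of \<open>d0\<close> is for the centre \<open>z\<close> and half for the
      displacement \<open>Mi *v x\<close>, so the whole segment stays within \<open>d0\<close> of
      \<open>q\<close>.\<close>
    define d where "d = min (d0 / 2) (d0 / (2 * K))"
    have d: "d > 0" "d \<le> d0 / 2" "d \<le> d0 / (2 * K)" using d0 K by (auto simp: d_def)
    show ?thesis
    proof (intro exI[of _ d] conjI ballI allI impI d(1))
      fix z x :: "complex ^ 'a" assume z: "z \<in> ball q d" and x: "norm x < d"
      define h where "h = Mi *v x"
      have nh: "norm h \<le> K * norm x" using K(2)[of x] by (simp add: h_def mult.commute)
      have "K * norm x < K * (d0 / (2 * K))" using x d K(1) by (intro mult_strict_left_mono) auto
      then have hd: "norm h < d0 / 2" using nh K(1) by simp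
      have seg: "E (z + s *\<^sub>R h) < e' \<and> z + s *\<^sub>R h \<in> U" if "0 \<le> s" "s \<le> 1" for s
      proof (rule d0(2))
        have "norm (s *\<^sub>R h) \<le> norm h" using that by (simp add: mult_left_le_one_le)
        then show "dist (z + s *\<^sub>R h) q < d0"
          using hd z d(2) norm_triangle_ineq[of "z - q" "s *\<^sub>R h"] by (simp add: dist_norm norm_minus_commute algebra_simps)
      qed
      have line: "((\<lambda>s. z + s *\<^sub>R h) has_derivative (\<lambda>u. u *\<^sub>R h)) (at s)" for s
        by (auto intro!: derivative_eq_intros)
      have D1: "((\<lambda>s. r (z + s *\<^sub>R h)) has_real_derivative blinfun_apply (r' (z + s *\<^sub>R h)) h) (at s)" if "0 \<le> s" "s \<le> 1" for s
        using has_derivative_compose[OF line r'[OF conjunct2[OF seg[OF that]]]]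
        by (simp add: has_field_derivative_def blinfun.scaleR_right mult.commute[of _ "blinfun_apply _ _"])
      have D2: "((\<lambda>s. blinfun_apply (r' (z + s *\<^sub>R h)) h) has_real_derivative blinfun_apply (blinfun_apply (r'' (z + s *\<^sub>R h)) h) h) (at s)" if "0 \<le> s" "s \<le> 1" for s
        using bounded_linear.has_derivative[OF blinfun.bounded_linear_left has_derivative_compose[OF line r''[OF conjunct2[OF seg[OF that]]]], of h]
        by (simp add: has_field_derivative_def blinfun.scaleR_right blinfun.scaleR_left mult.commute[of _ "blinfun_apply _ _"])
      have "\<bar>\<rho> (z + 1 *\<^sub>R h) - \<rho> (z + 0 *\<^sub>R h) - \<rho>' (z + 0 *\<^sub>R h) h - \<beta> h h / 2\<bar> \<le> e' * (norm h)\<^sup>2 / 2"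
      proof (rule second_order_Taylor[where \<phi>'' = "\<lambda>s. (1 + 4 * c * r (z + s *\<^sub>R h)) * blinfun_apply (blinfun_apply (r'' (z + s *\<^sub>R h)) h) h + 4 * c * (blinfun_apply (r' (z + s *\<^sub>R h)) h)\<^sup>2"])
        fix s :: real assume s: "0 \<le> s" "s \<le> 1"
        show "((\<lambda>s. \<rho> (z + s *\<^sub>R h)) has_real_derivative \<rho>' (z + s *\<^sub>R h) h) (at s)"
          unfolding \<rho>_def \<rho>'_def by (rule derivative_eq_intros D1[OF s] refl)+ (simp add: algebra_simps power2_eq_square)
        show "((\<lambda>s. \<rho>' (z + s *\<^sub>R h) h) has_real_derivative (1 + 4 * c * r (z + s *\<^sub>R h)) * blinfun_apply (blinfun_apply (r'' (z + s *\<^sub>R h)) h) h + 4 * c * (blinfun_apply (r' (z + s *\<^sub>R h)) h)\<^sup>2) (at s)"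
          unfolding \<rho>'_def by (rule derivative_eq_intros D1[OF s] D2[OF s] refl)+ (simp add: algebra_simps power2_eq_square)
        have "E (z + s *\<^sub>R h) * (norm h)\<^sup>2 \<le> e' * (norm h)\<^sup>2" using seg[OF s] by (intro mult_right_mono) auto
        then show "\<bar>(1 + 4 * c * r (z + s *\<^sub>R h)) * blinfun_apply (blinfun_apply (r'' (z + s *\<^sub>R h)) h) h + 4 * c * (blinfun_apply (r' (z + s *\<^sub>R h)) h)\<^sup>2 - 2 * (\<beta> h h / 2)\<bar> \<le> 2 * (e' * (norm h)\<^sup>2 / 2)"
          using second[of "z + s *\<^sub>R h" h] by simp
      qed
      also have "e' * (norm h)\<^sup>2 / 2 \<le> e' * (K * norm x)\<^sup>2 / 2"
        using e' nh by (intro divide_right_mono mult_left_mono power_mono) auto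
      also have "\<dots> = e * (norm x)\<^sup>2" using K(1) by (simp add: e'_def power_mult_distrib)
      finally show "\<bar>\<rho> (z + Mi *v x) - \<rho> z - 2 * Re (hip x (n z)) - Re (bil N x x) - (norm x)\<^sup>2\<bar> \<le> e * (norm x)\<^sup>2"
        using H[of x] hn[of x z] by (simp add: h_def algebra_simps)
    qed
  qed
  have "strict_boundary_point D q \<rho> M Mi N n R"
  proof (unfold_locales)
    fix w assume w: "w \<in> ball q R"
    have "\<rho> w = r w * (1 + 2 * c * r w)" by (simp add: \<rho>_def power2_eq_square algebra_simps)
    then have "\<rho> w < 0 \<longleftrightarrow> r w < 0" using R(3)[OF w] by (simp add: mult_less_0_iff)
    then show "w \<in> D \<longleftrightarrow> \<rho> w < 0" using DU w R(2) by blast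
  next
    show "continuous_on (ball q R) \<rho>"
      unfolding \<rho>_def using R(2) c_r by (intro continuous_intros continuous_at_imp_continuous_on) auto
    show "\<rho> q = 0" by (simp add: \<rho>_def rq)
  qed (use R M n_cont n_q expansion in auto)
  then show ?thesis by blast
qed

section \<open>Domains exhausted by a strictly pseudoconvex domain\<close>

text \<open>A local peak function at \<open>q\<close> pulled back by \<open>G\<close> attains its maximum modulus.\<close>

lemma holomorphic_map_into_closure_constant:
  fixes G :: "complex ^ 'n \<Rightarrow> complex ^ 'n"
  assumes G: "holomorphic_map_on G \<Omega>" and \<Omega>: "open \<Omega>" "connected \<Omega>" and im: "G ` \<Omega> \<subseteq> closure D"
    and p: "p \<in> \<Omega>" "G p = q"
    and \<psi>: "slice_hol \<psi> UNIV" "\<psi> q = 0" and d: "d > 0"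
    and peak: "\<And>w. w \<in> closure D \<inter> ball q d \<Longrightarrow> Re (\<psi> w) \<le> 0 \<and> (Re (\<psi> w) = 0 \<longrightarrow> w = q)"
    and w: "w \<in> \<Omega>"
  shows "G w = q"
proof -
  let ?Z = "{w \<in> \<Omega>. G w = q}"
  have Gc: "continuous_on \<Omega> G" by (rule holomorphic_map_on_continuous[OF G])
  have E: "slice_hol (\<lambda>w. exp (\<psi> (G w))) \<Omega>"
    by (rule slice_hol_comp_entire[OF slice_hol_compose[OF G \<psi>(1)]]) (auto intro: holomorphic_intros)
  have "open ?Z" unfolding open_contains_ball
  proof
    fix w assume w: "w \<in> ?Z"
    have "open (\<Omega> \<inter> G -` ball q d)" by (rule continuous_open_preimage[OF Gc \<Omega>(1)]) simp
    moreover have "w \<in> \<Omega> \<inter> G -` ball q d" using w d by simp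
    ultimately obtain r where r: "r > 0" "ball w r \<subseteq> \<Omega> \<inter> G -` ball q d" using open_contains_ball by blast
    have "w' \<in> ?Z" if w': "w' \<in> ball w r" for w'
    proof (cases "w' = w")
      case False
      define v where "v = w' - w"
      have v: "v \<noteq> 0" "norm v < r" using False w' by (auto simp: v_def dist_norm norm_minus_commute)
      let ?S = "ball (0::complex) (r / norm v)"
      have inS: "w + \<zeta> *s v \<in> ball w r" if "\<zeta> \<in> ?S" for \<zeta>
        using that v by (simp add: dist_norm norm_vector_scalar_mult field_simps)
      have inP: "G x \<in> closure D \<inter> ball q d" if "x \<in> ball w r" for x using r(2) im that by blast
      have le1: "norm (exp (\<psi> (G x))) \<le> 1" if "x \<in> ball w r" for x
        using peak[OF inP[OF that]] by simp
      have "(\<lambda>\<zeta>. exp (\<psi> (G (w + \<zeta> *s v)))) constant_on ?S"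
      proof (rule maximum_modulus_principle[of _ ?S ?S 0])
        show "(\<lambda>\<zeta>. exp (\<psi> (G (w + \<zeta> *s v)))) holomorphic_on ?S"
          by (rule slice_hol_slice[OF E]) (use inS r(2) in auto)
        show "norm (exp (\<psi> (G (w + \<zeta> *s v)))) \<le> norm (exp (\<psi> (G (w + 0 *s v))))" if "\<zeta> \<in> ?S" for \<zeta>
          using le1[OF inS[OF that]] w \<psi>(2) by simp
      qed (use v r(1) in auto)
      moreover have "0 \<in> ?S" "1 \<in> ?S" using v r by simp_all
      ultimately have "exp (\<psi> (G (w + 1 *s v))) = exp (\<psi> (G (w + 0 *s v)))" unfolding constant_on_def by metis
      then have "exp (\<psi> (G w')) = 1" using w \<psi>(2) by (simp add: v_def)
      then have "norm (exp (\<psi> (G w'))) = 1" by simp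
      then have "Re (\<psi> (G w')) = 0" by simp
      then show ?thesis using peak[OF inP[OF w']] r(2) w' by blast
    qed (use w in simp)
    then show "\<exists>e>0. ball w e \<subseteq> ?Z" using r(1) by blast
  qed
  then have "openin (top_of_set \<Omega>) ?Z" using openin_open_eq[OF \<Omega>(1)] by blast
  moreover have "closedin (top_of_set \<Omega>) ?Z" using continuous_closedin_preimage_constant[OF Gc, of q] by simp
  ultimately have "?Z = {} \<or> ?Z = \<Omega>" using \<Omega>(2) connected_clopen by blast
  then show ?thesis using p w by blast
qed

theorem theorem1p1:
  fixes D \<Omega> :: "(complex ^ 'n) set"
  assumes "complex_domain D" and "bounded D"
    and "C2_boundary D" and "strictly_pseudoconvex D"
    and "complex_domain \<Omega>" and "bounded \<Omega>"
    and "exhausted_by \<Omega> D"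
  shows "biholomorphic \<Omega> D \<or> biholomorphic \<Omega> (ball (0 :: complex ^ 'n) 1)"
proof -
  have oD: "open D" and o\<Omega>: "open \<Omega>" "connected \<Omega>" using assms(1,5) by (auto simp: complex_domain_def)
  obtain p where p: "p \<in> \<Omega>" using assms(5) by (auto simp: complex_domain_def)
  obtain C where C: "\<And>k :: nat. compact (C k)" "\<And>k. C k \<subseteq> \<Omega>"
    and Cex: "\<And>K. compact K \<Longrightarrow> K \<subseteq> \<Omega> \<Longrightarrow> \<exists>N. \<forall>k\<ge>N. K \<subseteq> C k"
    by (rule open_Union_compact_subsets[OF o\<Omega>(1)]) blast
  \<comment> \<open>Inserting \<open>p\<close> into the compact sets makes \<open>g k p\<close> a
    point of \<open>D\<close> for every \<open>k\<close>.\<close>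
  have "\<forall>k. \<exists>f. holomorphic_map_on f D \<and> inj_on f D \<and> f ` D \<subseteq> \<Omega> \<and> insert p (C k) \<subseteq> f ` D"
  proof
    fix k
    have "compact (insert p (C k)) \<and> insert p (C k) \<subseteq> \<Omega>" using C p by (auto intro: compact_insert)
    with assms(7) show "\<exists>f. holomorphic_map_on f D \<and> inj_on f D \<and> f ` D \<subseteq> \<Omega> \<and> insert p (C k) \<subseteq> f ` D"
      unfolding exhausted_by_def by blast
  qed
  then obtain f where f: "\<And>k. holomorphic_map_on (f k) D" "\<And>k. inj_on (f k) D" "\<And>k. f k ` D \<subseteq> \<Omega>"
    "\<And>k. insert p (C k) \<subseteq> f k ` D" by metis
  define g where "g k = inv_into D (f k)" for k
  have g: "holomorphic_map_on (g k) (f k ` D)" "open (f k ` D)" for k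
    using holomorphic_inverse[OF f(1) oD f(2)] by (auto simp: g_def)
  have gf: "g k (f k z) = z" if "z \<in> D" for k z using that f(2) by (simp add: g_def)
  have fg: "f k (g k w) = w" "g k w \<in> D" if "w \<in> f k ` D" for k w using that by (auto simp: gf)
  have gp: "g k p \<in> D" for k using f(4)[of k] by (intro fg) auto
  have ex: "\<forall>\<^sub>F k in sequentially. K \<subseteq> f k ` D" if K: "compact K" "K \<subseteq> \<Omega>" for K
    using Cex[OF K] f(4) unfolding eventually_sequentially by blast
  have "compact (closure D)" using assms(2) by (simp add: compact_closure)
  moreover have "\<forall>k. g k p \<in> closure D" using gp closure_subset by blast
  ultimately obtain q s where q: "q \<in> closure D" and s: "strict_mono (s :: nat \<Rightarrow> nat)" and lim: "(\<lambda>k. g (s k) p) \<longlonglongrightarrow> q"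
    unfolding compact_def o_def by (elim allE[of _ "\<lambda>k. g k p"]) blast
  have exs: "\<forall>\<^sub>F k in sequentially. K \<subseteq> f (s k) ` D" if K: "compact K" "K \<subseteq> \<Omega>" for K
    by (rule eventually_subseq[OF s ex[OF K]])
  show ?thesis
  proof (cases "q \<in> D")
    case True
    \<comment> \<open>Each \<open>g k\<close> maps onto all of \<open>D\<close>, so its images
      exhaust \<open>D\<close> trivially and the limit theorem applies with target
      \<open>D\<close>.\<close>
    have gim: "g k ` f k ` D = D" for k by (auto simp: gf image_image)
    have "biholomorphic \<Omega> D"
    proof (rule biholomorphic_limit[OF assms(5,6,1,2), where F = "\<lambda>k. g (s k)" and A = "\<lambda>k. f (s k) ` D"])
      show "inj_on (g (s k)) (f (s k) ` D)" for k by (metis fg(1) inj_onI)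
    qed (use g f(3) gim exs p lim True in auto)
    then show ?thesis ..
  next
    case False
    then have "q \<in> frontier D" using q oD by (simp add: frontier_def interior_open)
    then obtain \<rho> M Mi N n R where "strict_boundary_point D q \<rho> M Mi N n R"
      using strict_boundary_point_exists[OF oD assms(4)] by blast
    then interpret strict_boundary_point D q \<rho> M Mi N n R .
    obtain B where B: "\<And>z. z \<in> D \<Longrightarrow> norm z \<le> B" using assms(2) by (auto simp: bounded_iff)
    have "\<exists>t G. strict_mono (t :: nat \<Rightarrow> nat) \<and> holomorphic_map_on G \<Omega> \<and>
      (\<forall>K. compact K \<longrightarrow> K \<subseteq> \<Omega> \<longrightarrow> uniform_limit K ((\<lambda>k. g (s k)) \<circ> t) G sequentially)"
      by (rule holomorphic_map_Montel[OF o\<Omega>(1) g exs, of B]) (use B fg(2) in auto)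
    then obtain t G where t: "strict_mono (t :: nat \<Rightarrow> nat)" and G: "holomorphic_map_on G \<Omega>"
      and ulG: "\<And>K. compact K \<Longrightarrow> K \<subseteq> \<Omega> \<Longrightarrow> uniform_limit K (\<lambda>k. g (s (t k))) G sequentially"
      by (auto simp: o_def)
    have limG: "(\<lambda>k. g (s (t k)) w) \<longlonglongrightarrow> G w" if "w \<in> \<Omega>" for w
      by (rule tendsto_uniform_limitI[OF ulG[of "{w}"]]) (use that in auto)
    have Gp: "G p = q"
      using LIMSEQ_unique[OF limG[OF p] LIMSEQ_subseq_LIMSEQ[OF lim t, unfolded o_def]] .
    have Gim: "G ` \<Omega> \<subseteq> closure D"
    proof
      fix y assume "y \<in> G ` \<Omega>"
      then obtain w where w: "w \<in> \<Omega>" "y = G w" by blast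
      have "\<forall>\<^sub>F k in sequentially. {w} \<subseteq> f (s (t k)) ` D"
        by (rule eventually_subseq[OF t exs]) (use w in auto)
      then have "\<forall>\<^sub>F k in sequentially. g (s (t k)) w \<in> closure D"
        by eventually_elim (use fg(2) closure_subset in blast)
      then show "y \<in> closure D" unfolding w(2)
        by (rule Lim_in_closed_set[OF closed_closure _ sequentially_bot limG[OF w(1)]])
    qed
    obtain d0 \<psi> where d0: "d0 > 0" and \<psi>: "slice_hol \<psi> UNIV" "\<psi> q = 0"
      "\<And>w. w \<in> closure D \<inter> ball q d0 \<Longrightarrow> Re (\<psi> w) \<le> 0 \<and> (Re (\<psi> w) = 0 \<longrightarrow> w = q)"
      using local_peak_function by blast
    \<comment> \<open>A constant limit yields no biholomorphism; its use is to push the preimages of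
      any compact set into a prescribed neighbourhood of \<open>q\<close>.\<close>
    have Gq: "G w = q" if "w \<in> \<Omega>" for w
      by (rule holomorphic_map_into_closure_constant[OF G o\<Omega> Gim p Gp \<psi>(1,2) d0 \<psi>(3) that])
    have concentrate: "\<exists>k. L \<subseteq> f k ` D \<and> g k ` L \<subseteq> ball q \<delta>" if L: "compact L" "L \<subseteq> \<Omega>" and \<delta>: "\<delta> > 0" for L \<delta>
    proof -
      have "\<forall>\<^sub>F k in sequentially. \<forall>w\<in>L. dist (g (s (t k)) w) (G w) < \<delta>"
        using ulG[OF L] \<delta> unfolding uniform_limit_iff by blast
      moreover have "\<forall>\<^sub>F k in sequentially. L \<subseteq> f (s (t k)) ` D" by (rule eventually_subseq[OF t exs[OF L]])
      ultimately have "\<forall>\<^sub>F k in sequentially. (\<forall>w\<in>L. dist (g (s (t k)) w) (G w) < \<delta>) \<and> L \<subseteq> f (s (t k)) ` D"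
        by (rule eventually_conj)
      from eventually_happens'[OF sequentially_bot this]
      obtain k where k: "\<And>w. w \<in> L \<Longrightarrow> dist (g (s (t k)) w) (G w) < \<delta>" "L \<subseteq> f (s (t k)) ` D" by blast
      have "g (s (t k)) ` L \<subseteq> ball q \<delta>"
        using k(1) Gq L(2) by (auto simp: dist_commute subset_iff)
      with k(2) show ?thesis by blast
    qed
    have "\<exists>A. \<exists>F :: complex ^ 'n \<Rightarrow> complex ^ 'n. open A \<and> A \<subseteq> \<Omega> \<and> C k \<subseteq> A \<and> holomorphic_map_on F A \<and> inj_on F A \<and> F ` A \<subseteq> ball 0 1 \<and> F p = 0 \<and>
        ball 0 (1 - inverse (real (Suc (Suc k)))) \<subseteq> F ` (A :: (complex ^ 'n) set)" for k
    proof -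
      \<comment> \<open>Shifted by two because \<open>local_squeezing\<close> requires
        \<open>\<eta> < 1\<close> also for \<open>k = 0\<close>.\<close>
      define \<eta> where "\<eta> = inverse (real (Suc (Suc k)))"
      have \<eta>: "0 < \<eta>" "\<eta> < 1" by (simp_all add: \<eta>_def inverse_less_1_iff)
      obtain d d1 where d: "d1 > 0" "d1 \<le> d" and sq: "\<And>z. z \<in> D \<inter> ball q d1 \<Longrightarrow>
          \<exists>\<phi> :: complex ^ 'n \<Rightarrow> complex ^ 'n. holomorphic_map_on \<phi> (D \<inter> ball q d) \<and> inj_on \<phi> (D \<inter> ball q d) \<and>
          \<phi> ` (D \<inter> ball q d) \<subseteq> ball 0 1 \<and> \<phi> z = 0 \<and> ball 0 (1 - \<eta>) \<subseteq> \<phi> ` (D \<inter> ball q d)"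
        using local_squeezing[OF \<eta>] by blast
      \<comment> \<open>The index \<open>j\<close> is chosen after \<open>d1\<close>, which depends
        on \<open>k\<close>; the centre of the squeezing map is \<open>g j p\<close>.\<close>
      obtain j where j: "insert p (C k) \<subseteq> f j ` D" "g j ` insert p (C k) \<subseteq> ball q d1"
        using concentrate[of "insert p (C k)" d1] C p d(1) by (auto intro: compact_insert)
      have "g j p \<in> D \<inter> ball q d1" using gp j(2) by auto
      from sq[OF this] obtain \<phi> :: "complex ^ 'n \<Rightarrow> complex ^ 'n" where \<phi>: "holomorphic_map_on \<phi> (D \<inter> ball q d)"
        "inj_on \<phi> (D \<inter> ball q d)" "\<phi> ` (D \<inter> ball q d) \<subseteq> ball 0 1" "\<phi> (g j p) = 0" "ball 0 (1 - \<eta>) \<subseteq> \<phi> ` (D \<inter> ball q d)"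
        by blast
      \<comment> \<open>Only the part of \<open>D\<close> near \<open>q\<close> is squeezed, so the
        composite lives on the image of that part, which still contains \<open>C k\<close>.\<close>
      define A where "A = f j ` (D \<inter> ball q d)"
      have gA: "g j ` A = D \<inter> ball q d" by (auto simp: A_def image_image gf)
      have AD: "A \<subseteq> f j ` D" by (auto simp: A_def)
      have "open A" unfolding A_def
        by (rule holomorphic_inverse(1)[OF holomorphic_map_on_subset[OF f(1)] _ inj_on_subset[OF f(2)]]) (use oD in auto)
      moreover have "A \<subseteq> \<Omega>" using AD f(3) by blast
      moreover have "C k \<subseteq> A"
      proof
        fix w assume w: "w \<in> C k"
        then have "w \<in> f j ` D" "g j w \<in> ball q d" using j d(2) by auto
        then show "w \<in> A" using fg[of w j] unfolding A_def by (metis IntI imageI)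
      qed
      moreover have "holomorphic_map_on (\<phi> \<circ> g j) A"
        by (rule holomorphic_map_on_compose[OF holomorphic_map_on_subset[OF g(1) AD] \<phi>(1)]) (simp add: gA)
      moreover have "inj_on (g j) A" using fg(1) AD by (metis inj_onI subsetD)
      then have "inj_on (\<phi> \<circ> g j) A" by (rule comp_inj_on) (simp add: gA \<phi>(2))
      moreover have "(\<phi> \<circ> g j) ` A = \<phi> ` (D \<inter> ball q d)" unfolding image_comp[symmetric] gA ..
      ultimately show ?thesis using \<phi>(3,4,5) unfolding \<eta>_def[symmetric] by (intro exI[of _ A] exI[of _ "\<phi> \<circ> g j"]) auto
    qed
    then obtain A and F :: "nat \<Rightarrow> complex ^ 'n \<Rightarrow> complex ^ 'n" where A: "\<And>k. open (A k)" "\<And>k. A k \<subseteq> \<Omega>" "\<And>k. C k \<subseteq> A k"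
      and F: "\<And>k. holomorphic_map_on (F k) (A k)" "\<And>k. inj_on (F k) (A k)" "\<And>k. F k ` A k \<subseteq> ball 0 1" "\<And>k. F k p = 0"
        "\<And>k. ball 0 (1 - inverse (real (Suc (Suc k)))) \<subseteq> F k ` (A k :: (complex ^ 'n) set)"

      by metis
    \<comment> \<open>All images of \<open>p\<close> now equal the interior point 0, so the limit
      theorem applies to the rescaled maps, with the ball as target.\<close>
    have "biholomorphic \<Omega> (ball (0 :: complex ^ 'n) 1)"
    proof (rule biholomorphic_limit[OF assms(5,6) _ bounded_ball F(1) A(1,2) F(2,3)])
      show "complex_domain (ball (0 :: complex ^ 'n) 1)" by (simp add: complex_domain_def)
      show "\<forall>\<^sub>F k in sequentially. K \<subseteq> A k" if K: "compact K" "K \<subseteq> \<Omega>" for K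
        using Cex[OF K] A(3) unfolding eventually_sequentially by blast
      show "\<forall>\<^sub>F k in sequentially. K \<subseteq> F k ` A k" if K: "compact K" "K \<subseteq> ball 0 1" for K
      proof (cases "K = {}")
        case False
        obtain x where x: "x \<in> K" "\<And>y. y \<in> K \<Longrightarrow> norm y \<le> norm x"
          using continuous_attains_sup[OF K(1) False, of norm] continuous_on_norm_id by blast
        have "norm x < 1" using x(1) K(2) by auto
        then obtain m where m: "inverse (real (Suc m)) < 1 - norm x" using reals_Archimedean[of "1 - norm x"] by auto
        have "K \<subseteq> F k ` A k" if "k \<ge> m" for k
        proof
          fix y assume "y \<in> K"
          have "inverse (real (Suc (Suc k))) \<le> inverse (real (Suc m))" using that by (intro le_imp_inverse_le) auto
          then have "norm y < 1 - inverse (real (Suc (Suc k)))" using m x(2)[OF \<open>y \<in> K\<close>] by linarith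
          then show "y \<in> F k ` A k" using F(5)[of k] by auto
        qed
        then show ?thesis unfolding eventually_sequentially by blast
      qed simp
      show "p \<in> \<Omega>" by (rule p)
      show "(\<lambda>k. F k p) \<longlonglongrightarrow> 0" by (simp add: F(4))
    qed simp
    then show ?thesis ..
  qed
qed

end
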